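(* Let $\mathbb A\mathbb P^2\subset\mathbb P(\mathcal J_3(\mathbb A))$ be one of the four Severi varieties ($m=1,2,4,8$). There are three types of hyperplane sections of $\mathbb A\mathbb P^2$: 1. homogeneous sections (this is the generic case); 2. sections with a unique singular point, which is an ordinary quadratic singularity; 3. sections whose singular locus is an $\mathbb A\mathbb P^1$, i.e. a smooth quadric $Q^m$ of dimension $m$.
   Context: Everything is over $\mathbb C$. $\mathbb A$ is the complexification of $\mathbb R,\mathbb C,\mathbb H,\mathbb O$, $m=\dim_{\mathbb C}\mathbb A=1,2,4,8$, and the Severi varieties are, in their minimal equivariant embeddings (except that the first is the quadratic Veronese embedding): $v_2(\mathbb P^2)\subset\mathbb P^5$, $\mathbb P^2\times\mathbb P^2\subset\mathbb P^8$, $G(2,6)\subset\mathbb P^{14}$, $\mathbb O\mathbb P^2=E_6/P_1\subset\mathbb P^{26}$. $\mathcal J_3(\mathbb A)$ is the $(3m+3)$-dimensional space of $3\times3$ $\mathbb A$-Hermitian matrices. The statement means that every hyperplane section is of one of the three types, and each type occurs. A section is homogeneous if it is a (smooth) projective homogeneous variety. *)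

theory Defs
  imports Complex_Main "Jordan_Normal_Form.Matrix"
begin

section \<open>Projective geometry over the complex numbers\<close>

text \<open>
  The space \<open>\<complex>\<^sup>n\<close> is \<open>carrier_vec n\<close>. A subset of \<open>\<P>\<^sup>n\<^sup>-\<^sup>1\<close> is represented by the set of all
  nonzero vectors representing its points, that is, by its affine cone without the origin.
\<close>

definition same_point :: "complex vec \<Rightarrow> complex vec \<Rightarrow> bool" where
  "same_point x y \<longleftrightarrow> (\<exists>c. c \<noteq> 0 \<and> y = c \<cdot>\<^sub>v x)"

text \<open>
  The algebra of polynomial functions in a given set of coordinate functions. As the field is
  infinite, polynomials on \<open>\<complex>\<^sup>n\<close> may be identified with the functions they induce.
\<close>

inductive_set poly_funs :: "('a \<Rightarrow> complex) set \<Rightarrow> ('a \<Rightarrow> complex) set"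
  for C :: "('a \<Rightarrow> complex) set" where
  const: "(\<lambda>_. c) \<in> poly_funs C"
| coord: "f \<in> C \<Longrightarrow> f \<in> poly_funs C"
| add: "p \<in> poly_funs C \<Longrightarrow> q \<in> poly_funs C \<Longrightarrow> (\<lambda>x. p x + q x) \<in> poly_funs C"
| mult: "p \<in> poly_funs C \<Longrightarrow> q \<in> poly_funs C \<Longrightarrow> (\<lambda>x. p x * q x) \<in> poly_funs C"

definition vec_coords :: "nat \<Rightarrow> (complex vec \<Rightarrow> complex) set" where
  "vec_coords n = {\<lambda>x. x $ i |i. i < n}"

definition mat_coords :: "nat \<Rightarrow> (complex mat \<Rightarrow> complex) set" where
  "mat_coords n = {\<lambda>g. g $$ (i, j) |i j. i < n \<and> j < n}"

definition mat_vec_coords :: "nat \<Rightarrow> nat \<Rightarrow> (complex mat \<times> complex vec \<Rightarrow> complex) set" where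
  "mat_vec_coords N n =
     (\<lambda>f. f \<circ> fst) ` mat_coords N \<union> (\<lambda>f. f \<circ> snd) ` vec_coords n"

definition zariski_closed :: "nat \<Rightarrow> complex vec set \<Rightarrow> bool" where
  "zariski_closed n Z \<longleftrightarrow>
     (\<exists>P \<subseteq> poly_funs (vec_coords n). Z = {x \<in> carrier_vec n. \<forall>p\<in>P. p x = 0})"

text \<open>A closed subset of projective space: the cone becomes Zariski closed when \<open>0\<close> is added.\<close>

definition projective_set :: "nat \<Rightarrow> complex vec set \<Rightarrow> bool" where
  "projective_set n X \<longleftrightarrow>
     0\<^sub>v n \<notin> X \<and> zariski_closed n (insert (0\<^sub>v n) X) \<and>
     (\<forall>x\<in>X. \<forall>c. c \<noteq> 0 \<longrightarrow> c \<cdot>\<^sub>v x \<in> X)"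

definition vanishing_ideal :: "nat \<Rightarrow> complex vec set \<Rightarrow> (complex vec \<Rightarrow> complex) set" where
  "vanishing_ideal n X = {p \<in> poly_funs (vec_coords n). \<forall>x\<in>X. p x = 0}"

text \<open>Irreducible (and nonempty): the vanishing ideal is prime.\<close>

definition projective_variety :: "nat \<Rightarrow> complex vec set \<Rightarrow> bool" where
  "projective_variety n X \<longleftrightarrow>
     projective_set n X \<and> X \<noteq> {} \<and>
     (\<forall>p \<in> poly_funs (vec_coords n). \<forall>q \<in> poly_funs (vec_coords n).
        (\<lambda>x. p x * q x) \<in> vanishing_ideal n X \<longrightarrow>
        p \<in> vanishing_ideal n X \<or> q \<in> vanishing_ideal n X)"


section \<open>Projective homogeneous varieties\<close>

definition linear_algebraic_group :: "nat \<Rightarrow> complex mat set \<Rightarrow> bool" where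
  "linear_algebraic_group N G \<longleftrightarrow>
     (\<exists>P \<subseteq> poly_funs (mat_coords N).
        G = {g \<in> carrier_mat N N. invertible_mat g \<and> (\<forall>p\<in>P. p g = 0)}) \<and>
     1\<^sub>m N \<in> G \<and> (\<forall>g\<in>G. \<forall>h\<in>G. g * h \<in> G) \<and> (\<forall>g\<in>G. \<exists>h\<in>G. g * h = 1\<^sub>m N)"

text \<open>
  An action of \<open>G\<close> on the projective set \<open>X\<close> by a morphism \<open>G \<times> X \<rightarrow> X\<close>: \<open>a g x\<close> is a representative
  of the image of the point represented by \<open>x\<close>, and locally on \<open>G \<times> X\<close> the homogeneous
  coordinates of the image can be given by polynomials without common zero. (Denominators, such as
  powers of the determinant on \<open>G\<close>, can be cleared in homogeneous coordinates.)
\<close>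

definition algebraic_action ::
  "nat \<Rightarrow> complex mat set \<Rightarrow> nat \<Rightarrow> complex vec set \<Rightarrow>
   (complex mat \<Rightarrow> complex vec \<Rightarrow> complex vec) \<Rightarrow> bool" where
  "algebraic_action N G n X a \<longleftrightarrow>
     (\<forall>g\<in>G. \<forall>x\<in>X. a g x \<in> X) \<and>
     (\<forall>g\<in>G. \<forall>x\<in>X. \<forall>y\<in>X. same_point x y \<longrightarrow> same_point (a g x) (a g y)) \<and>
     (\<forall>x\<in>X. same_point (a (1\<^sub>m N) x) x) \<and>
     (\<forall>g\<in>G. \<forall>h\<in>G. \<forall>x\<in>X. same_point (a (g * h) x) (a g (a h x))) \<and>
     (\<forall>g0\<in>G. \<forall>x0\<in>X. \<exists>F :: nat \<Rightarrow> complex mat \<times> complex vec \<Rightarrow> complex.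
        (\<forall>i<n. F i \<in> poly_funs (mat_vec_coords N n)) \<and>
        (\<exists>i<n. F i (g0, x0) \<noteq> 0) \<and>
        (\<forall>g\<in>G. \<forall>x\<in>X. (\<exists>i<n. F i (g, x) \<noteq> 0) \<longrightarrow>
           same_point (a g x) (vec n (\<lambda>i. F i (g, x)))))"

definition homogeneous_variety :: "nat \<Rightarrow> complex vec set \<Rightarrow> bool" where
  "homogeneous_variety n X \<longleftrightarrow>
     projective_variety n X \<and>
     (\<exists>N G a. linear_algebraic_group N G \<and> algebraic_action N G n X a \<and>
        (\<forall>x\<in>X. \<forall>y\<in>X. \<exists>g\<in>G. same_point (a g x) y))"


section \<open>Hyperplane sections and their singularities\<close>

text \<open>
  The hyperplane given by \<open>h \<noteq> 0\<close> is \<open>{x. h \<bullet> x = 0}\<close>, where \<open>\<bullet>\<close> is the bilinear (not sesquilinear)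
  standard form.
\<close>

definition hyperplane_section :: "complex vec set \<Rightarrow> complex vec \<Rightarrow> complex vec set" where
  "hyperplane_section X h = {x \<in> X. h \<bullet> x = 0}"

definition dir_deriv :: "(complex vec \<Rightarrow> complex) \<Rightarrow> complex vec \<Rightarrow> complex vec \<Rightarrow> complex" where
  "dir_deriv p x v = (THE D. ((\<lambda>t. p (x + t \<cdot>\<^sub>v v)) has_field_derivative D) (at 0))"

definition hessian ::
  "(complex vec \<Rightarrow> complex) \<Rightarrow> complex vec \<Rightarrow> complex vec \<Rightarrow> complex vec \<Rightarrow> complex" where
  "hessian p x v w = dir_deriv (\<lambda>y. dir_deriv p y w) x v"

text \<open>The Zariski tangent space at \<open>x\<close> of the affine cone over \<open>X\<close>.\<close>

definition tangent_space :: "nat \<Rightarrow> complex vec set \<Rightarrow> complex vec \<Rightarrow> complex vec set" where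
  "tangent_space n X x =
     {v \<in> carrier_vec n. \<forall>p \<in> vanishing_ideal n X. dir_deriv p x v = 0}"

text \<open>
  The section is taken with its scheme structure, so that a double hyperplane section is singular
  everywhere. For \<open>X\<close> smooth and irreducible and not contained in the hyperplane, the section has
  codimension one in \<open>X\<close>, and by the Jacobian criterion it is singular at \<open>x\<close> if and only if the
  hyperplane contains the tangent space of \<open>X\<close> at \<open>x\<close>.
\<close>

definition singular_locus :: "nat \<Rightarrow> complex vec set \<Rightarrow> complex vec \<Rightarrow> complex vec set" where
  "singular_locus n X h =
     {x \<in> hyperplane_section X h. \<forall>v \<in> tangent_space n X x. h \<bullet> v = 0}"

text \<open>
  At a singular point \<open>x\<close> of the section, the restriction of \<open>h\<close> to the cone over \<open>X\<close> is also
  induced by a polynomial \<open>h - p\<close>, with \<open>p\<close> in the ideal of \<open>X\<close>, whose differential at \<open>x\<close> vanishes.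
  The leading quadratic term of the local equation of the section is then the Hessian of \<open>h - p\<close> on
  the tangent space of \<open>X\<close>, which is the tangent space of the cone modulo the line through \<open>x\<close>.
  The singularity is an ordinary quadratic one if this quadratic form is nondegenerate.
\<close>

definition ordinary_quadratic_singularity ::
  "nat \<Rightarrow> complex vec set \<Rightarrow> complex vec \<Rightarrow> complex vec \<Rightarrow> bool" where
  "ordinary_quadratic_singularity n X h x \<longleftrightarrow>
     x \<in> singular_locus n X h \<and>
     (\<exists>p \<in> vanishing_ideal n X.
        (\<forall>v \<in> carrier_vec n. dir_deriv (\<lambda>y. h \<bullet> y - p y) x v = 0) \<and>
        {v \<in> tangent_space n X x.
           \<forall>w \<in> tangent_space n X x. hessian (\<lambda>y. h \<bullet> y - p y) x v w = 0}
        = {c \<cdot>\<^sub>v x |c. True})"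

text \<open>
  A smooth quadric of dimension \<open>d\<close>: the zero locus of a nondegenerate quadratic form on a linear
  subspace \<open>\<P>\<^sup>d\<^sup>+\<^sup>1\<close>, the latter parametrized by an injective linear map \<open>B\<close>.
\<close>

definition smooth_quadric :: "nat \<Rightarrow> nat \<Rightarrow> complex vec set \<Rightarrow> bool" where
  "smooth_quadric n d Q \<longleftrightarrow>
     (\<exists>B \<in> carrier_mat n (d + 2). \<exists>S \<in> carrier_mat (d + 2) (d + 2).
        (\<forall>y \<in> carrier_vec (d + 2). B *\<^sub>v y = 0\<^sub>v n \<longrightarrow> y = 0\<^sub>v (d + 2)) \<and>
        transpose_mat S = S \<and> invertible_mat S \<and>
        Q = {B *\<^sub>v y |y. y \<in> carrier_vec (d + 2) \<and> y \<noteq> 0\<^sub>v (d + 2) \<and> y \<bullet> (S *\<^sub>v y) = 0})"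

definition homogeneous_section :: "nat \<Rightarrow> complex vec set \<Rightarrow> complex vec \<Rightarrow> bool" where
  "homogeneous_section n X h \<longleftrightarrow>
     singular_locus n X h = {} \<and> homogeneous_variety n (hyperplane_section X h)"

definition nodal_section :: "nat \<Rightarrow> complex vec set \<Rightarrow> complex vec \<Rightarrow> bool" where
  "nodal_section n X h \<longleftrightarrow>
     (\<exists>x. singular_locus n X h = {y. same_point x y} \<and> ordinary_quadratic_singularity n X h x)"

definition quadric_singular_section ::
  "nat \<Rightarrow> nat \<Rightarrow> complex vec set \<Rightarrow> complex vec \<Rightarrow> bool" where
  "quadric_singular_section n d X h \<longleftrightarrow> smooth_quadric n d (singular_locus n X h)"


section \<open>The complexified composition algebras\<close>

text \<open>
  The Cayley--Dickson process with scalars \<open>\<complex>\<close> instead of \<open>\<real>\<close>, i.e. with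
  \<open>(a, b)(c, d) = (a c - d\<^sup>* b, d a + b c\<^sup>*)\<close> and \<open>(a, b)\<^sup>* = (a\<^sup>*, - b)\<close>, all maps being complex
  (bi)linear. On the space \<open>\<complex>\<^sup>m\<close> with \<open>m = 2^k\<close>, for \<open>k = 0, 1, 2, 3\<close>, this gives the complexifications of the real
  numbers, the complex numbers, the quaternions and the octonions. The unit is the first basis
  vector.
\<close>

fun cd_conj :: "nat \<Rightarrow> complex vec \<Rightarrow> complex vec" where
  "cd_conj 0 x = x"
| "cd_conj (Suc k) x = cd_conj k (vec_first x (2^k)) @\<^sub>v - vec_last x (2^k)"

fun cd_mult :: "nat \<Rightarrow> complex vec \<Rightarrow> complex vec \<Rightarrow> complex vec" where
  "cd_mult 0 x y = vec 1 (\<lambda>_. x $ 0 * y $ 0)"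
| "cd_mult (Suc k) x y =
     (let a = vec_first x (2^k); b = vec_last x (2^k);
          c = vec_first y (2^k); d = vec_last y (2^k)
      in (cd_mult k a c - cd_mult k (cd_conj k d) b) @\<^sub>v
         (cd_mult k d a + cd_mult k b (cd_conj k c)))"

text \<open>\<open>x x\<^sup>*\<close> and \<open>x + x\<^sup>*\<close> are multiples of the unit, by the norm and the trace respectively.\<close>

definition cd_norm :: "nat \<Rightarrow> complex vec \<Rightarrow> complex" where
  "cd_norm k x = cd_mult k x (cd_conj k x) $ 0"

definition cd_trace :: "nat \<Rightarrow> complex vec \<Rightarrow> complex" where
  "cd_trace k x = (x + cd_conj k x) $ 0"


section \<open>The Severi varieties\<close>

text \<open>
  With \<open>m = 2^k\<close>, the space of Hermitian \<open>3 \<times> 3\<close> matrices is \<open>carrier_vec (3 * m + 3)\<close>: the vector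
  with entries \<open>r\<^sub>0, r\<^sub>1, r\<^sub>2\<close>, followed by the coordinates of \<open>a\<^sub>0, a\<^sub>1, a\<^sub>2\<close>, stands for the matrix
  with rows \<open>(r\<^sub>0, a\<^sub>2, a\<^sub>1\<^sup>*)\<close>, \<open>(a\<^sub>2\<^sup>*, r\<^sub>1, a\<^sub>0)\<close>, \<open>(a\<^sub>1, a\<^sub>0\<^sup>*, r\<^sub>2)\<close>.
\<close>

definition off_diag :: "nat \<Rightarrow> complex vec \<Rightarrow> nat \<Rightarrow> complex vec" where
  "off_diag k x i = vec (2^k) (\<lambda>j. x $ (3 + i * 2^k + j))"

definition jordan_det :: "nat \<Rightarrow> complex vec \<Rightarrow> complex" where
  "jordan_det k x =
     x $ 0 * x $ 1 * x $ 2
     - (\<Sum>i<3. x $ i * cd_norm k (off_diag k x i))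
     + cd_trace k (cd_mult k (cd_mult k (off_diag k x 0) (off_diag k x 1)) (off_diag k x 2))"

text \<open>
  The group \<open>SL\<^sub>3(\<A>)\<close> of linear transformations preserving the determinant. Up to finite groups
  it is \<open>SL\<^sub>3\<close>, \<open>SL\<^sub>3 \<times> SL\<^sub>3\<close>, \<open>SL\<^sub>6\<close>, \<open>E\<^sub>6\<close> for \<open>k = 0, 1, 2, 3\<close>.
\<close>

definition SL3_group :: "nat \<Rightarrow> complex mat set" where
  "SL3_group k =
     {g \<in> carrier_mat (3 * 2^k + 3) (3 * 2^k + 3). invertible_mat g \<and>
        (\<forall>x \<in> carrier_vec (3 * 2^k + 3). jordan_det k (g *\<^sub>v x) = jordan_det k x)}"

text \<open>
  \<open>\<A>\<P>\<^sup>2\<close> is the closed orbit of \<open>SL\<^sub>3(\<A>)\<close> in \<open>\<P>(J\<^sub>3(\<A>))\<close>, that is, the orbit of the class of the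
  rank one matrix \<open>diag(1, 0, 0)\<close>. For \<open>k = 0, 1, 2, 3\<close> this is the Veronese surface
  \<open>v\<^sub>2(\<P>\<^sup>2)\<close>, the Segre variety \<open>\<P>\<^sup>2 \<times> \<P>\<^sup>2\<close>, the Grassmannian \<open>G(2, 6)\<close> and \<open>E\<^sub>6 / P\<^sub>1\<close>.
\<close>

definition severi :: "nat \<Rightarrow> complex vec set" where
  "severi k = {c \<cdot>\<^sub>v (g *\<^sub>v unit_vec (3 * 2^k + 3) 0) |c g. c \<noteq> 0 \<and> g \<in> SL3_group k}"

end

theory Submission
  imports Defs "HOL-Library.Product_Plus" "HOL-Computational_Algebra.Polynomial"
begin

text \<open>
  Write \<open>\<A>\<close> as a composition algebra with the product \<open>x \<star> y = (x y)\<^sup>*\<close>. The maps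
  \<open>x \<mapsto> (1 + u e\<^sub>i\<^sub>j) x (1 + u e\<^sub>i\<^sub>j)\<^sup>*\<close> preserve the determinant, and Gaussian elimination with them and
  with diagonal maps moves every nonzero linear form to one of \<open>r\<^sub>0\<close>, \<open>r\<^sub>0 + r\<^sub>1\<close>,
  \<open>c (r\<^sub>0 + r\<^sub>1 + r\<^sub>2)\<close>, and every \<open>x \<noteq> 0\<close> with vanishing adjoint to a multiple of
  \<open>diag(1, 0, 0)\<close>. So \<open>\<A>\<P>\<^sup>2\<close> is cut out by the adjoint, whose differential bounds the tangent spaces
  from above, while the curves \<open>(1 + t u e\<^sub>i\<^sub>j) x (1 + t u e\<^sub>i\<^sub>j)\<^sup>*\<close> bound them from below; this determines
  the singular points of the three normal forms. For rank three we pass to the equivalent form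
  \<open>r\<^sub>1 - 2 \<langle>e, a\<^sub>1\<rangle>\<close>: unipotent maps in its stabilizer act transitively on the cell \<open>r\<^sub>0 \<noteq> 0\<close> of the
  section, and opposite ones move every other point into this cell. As all these elements lie on
  polynomial one-parameter families, the section is homogeneous and irreducible.
\<close>

section \<open>Coordinatized complex vector spaces\<close>

text \<open>Matrices over the nonassociative octonions have no associative product, so the
  elementary maps cannot be verified as matrix products. The four algebras are treated together as
  types of the class \<open>compalg\<close>, where the computations rest mainly on the cyclic
  symmetry of \<open>dot (x \<star> y) z\<close> and on
  \<open>(x \<star> y) \<star> x = dot x x *c y\<close>; \<open>coords\<close> carries the results
  back to the vectors of the statement. The tangent space is defined by the whole vanishing ideal,
  of which only the quadrics \<open>sharp\<close> are explicit. This is why it has to be bounded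
  from both sides. The section by \<open>r0 + r1 + r2\<close> misses diag(1, 0, 0), and the
  stabilizer of this form contains no evident unipotent families. The equivalent form vanishes at
  diag(1, 0, 0), and two opposite families fixing it can be written down. Homogeneity asks for an
  algebraic group and for an irreducible section. The full stabilizer is visibly algebraic but might
  be disconnected, so irreducibility is drawn from polynomial paths inside it.\<close>

class cspace = ab_group_add +
  fixes scl :: "complex \<Rightarrow> 'a \<Rightarrow> 'a"  (infixr \<open>*c\<close> 75)
  assumes scl_add_right: "a *c (x + y) = a *c x + a *c y"
    and scl_add_left: "(a + b) *c x = a *c x + b *c x"
    and scl_scl: "a *c b *c x = (a * b) *c x"
    and scl_one [simp]: "1 *c x = x"
begin

lemma scl_zero_left [simp]: "0 *c x = 0"
  using scl_add_left[of 0 0 x] by simp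

lemma scl_zero_right [simp]: "a *c 0 = 0"
  using scl_add_right[of a 0 0] by simp

lemma scl_minus_left: "(- a) *c x = - (a *c x)"
  using scl_add_left[of a "- a" x] by (simp add: eq_neg_iff_add_eq_0 add.commute)

lemma scl_minus_right: "a *c (- x) = - (a *c x)"
  using scl_add_right[of a x "- x"] by (simp add: eq_neg_iff_add_eq_0 add.commute)

lemma scl_diff_right: "a *c (x - y) = a *c x - a *c y"
  using scl_add_right[of a x "- y"] by (simp add: scl_minus_right)

lemma scl_diff_left: "(a - b) *c x = a *c x - b *c x"
  using scl_add_left[of a "- b" x] by (simp add: scl_minus_left)

lemma scl_eq_0_iff [simp]: "a *c x = 0 \<longleftrightarrow> a = 0 \<or> x = 0"
proof -
  have "x = 0" if "a *c x = 0" "a \<noteq> 0"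
  proof -
    have "x = (inverse a * a) *c x" using that(2) by simp
    then show ?thesis using that(1) by (simp add: scl_scl[symmetric])
  qed
  then show ?thesis by auto
qed

end

instantiation complex :: cspace
begin
definition "scl_complex (a::complex) x = a * x"
instance by standard (simp_all add: scl_complex_def algebra_simps)
end

instantiation prod :: (cspace, cspace) cspace
begin
definition "scl_prod a x = (a *c fst x, a *c snd x)"
instance by standard (simp_all add: scl_prod_def prod_eq_iff scl_add_right scl_add_left scl_scl)
end

lemma scl_Pair [simp]: "a *c (x, y) = (a *c x, a *c y)"
  by (simp add: scl_prod_def)

declare scl_complex_def [simp]

definition lin :: "('a::cspace \<Rightarrow> 'b::cspace) \<Rightarrow> bool" where
  "lin f \<longleftrightarrow> (\<forall>x y. f (x + y) = f x + f y) \<and> (\<forall>c x. f (c *c x) = c *c f x)"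

lemma linI: "(\<And>x y. f (x + y) = f x + f y) \<Longrightarrow> (\<And>c x. f (c *c x) = c *c f x) \<Longrightarrow> lin f"
  by (simp add: lin_def)

lemma lin_add: "lin f \<Longrightarrow> f (x + y) = f x + f y"
  and lin_scl: "lin f \<Longrightarrow> f (c *c x) = c *c f x"
  by (simp_all add: lin_def)

lemma lin_zero: "lin f \<Longrightarrow> f 0 = 0"
  using lin_scl[of f 0 0] by simp

lemma lin_minus: "lin f \<Longrightarrow> f (- x) = - f x"
  using lin_scl[of f "-1" x] by (simp add: scl_minus_left)

lemma lin_sum: "lin f \<Longrightarrow> f (sum g I) = (\<Sum>i\<in>I. f (g i))"
  by (induction I rule: infinite_finite_induct) (simp_all add: lin_zero lin_add)

lemma lin_comp: "lin f \<Longrightarrow> lin g \<Longrightarrow> lin (\<lambda>x. f (g x))"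
  by (simp add: lin_def)

lemma lin_inverse:
  assumes "lin f" "\<And>x. g (f x) = x" "\<And>x. f (g x) = x"
  shows "lin g"
proof (rule linI)
  fix x y
  have "g (f (g x + g y)) = g (x + y)" by (simp only: lin_add[OF assms(1)] assms(3))
  then show "g (x + y) = g x + g y" by (simp only: assms(2))
next
  fix c x
  have "g (f (c *c g x)) = g (c *c x)" by (simp only: lin_scl[OF assms(1)] assms(3))
  then show "g (c *c x) = c *c g x" by (simp only: assms(2))
qed

text \<open>The bijection with \<open>carrier_vec\<close> is part of the structure, so that each
  algebra and each space of Hermitian matrices is a type of its own. Pairs concatenate coordinates,
  which reproduces the order of entries prescribed for Hermitian matrices.\<close>

class coordspace = cspace +
  fixes cdim :: "'a itself \<Rightarrow> nat" and coords :: "'a \<Rightarrow> complex vec"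
  assumes coords_carrier [simp]: "coords x \<in> carrier_vec (cdim TYPE('a))"
    and coords_add: "coords (x + y) = coords x + coords y"
    and coords_scl: "coords (a *c x) = a \<cdot>\<^sub>v coords x"
    and coords_inj: "coords x = coords y \<Longrightarrow> x = y"
    and coords_surj: "v \<in> carrier_vec (cdim TYPE('a)) \<Longrightarrow> \<exists>x. coords x = v"
begin

lemma dim_coords [simp]: "dim_vec (coords x) = cdim TYPE('a)"
  using coords_carrier[of x] by (simp only: carrier_vec_def) simp

lemma coords_eq_iff: "coords x = coords y \<longleftrightarrow> x = y"
  using coords_inj by auto

lemma coords_zero: "coords 0 = 0\<^sub>v (cdim TYPE('a))"
proof -
  have "coords (0 *c 0) = 0 \<cdot>\<^sub>v coords 0" by (rule coords_scl)
  then show ?thesis by (auto simp: vec_eq_iff)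
qed

lemma coords_eq_0_iff: "coords x = 0\<^sub>v (cdim TYPE('a)) \<longleftrightarrow> x = 0"
  using coords_eq_iff[of x 0] by (simp add: coords_zero)

definition bas :: "nat \<Rightarrow> 'a" where
  "bas i = (SOME x. coords x = unit_vec (cdim TYPE('a)) i)"

lemma coords_bas [simp]: "coords (bas i) = unit_vec (cdim TYPE('a)) i"
  unfolding bas_def by (rule someI_ex) (simp add: coords_surj)

definition dot :: "'a \<Rightarrow> 'a \<Rightarrow> complex" where
  "dot x y = coords x \<bullet> coords y"

definition re :: "'a \<Rightarrow> complex" where
  "re x = coords x $ 0"

lemma dot_commute: "dot x y = dot y x"
  unfolding dot_def by (rule comm_scalar_prod[OF coords_carrier coords_carrier])

lemma dot_add_left: "dot (x + y) z = dot x z + dot y z"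
  unfolding dot_def coords_add
  by (rule add_scalar_prod_distrib[OF coords_carrier coords_carrier coords_carrier])

lemma dot_scl_left: "dot (a *c x) y = a * dot x y"
  unfolding dot_def coords_scl by (simp add: smult_scalar_prod_distrib[OF coords_carrier coords_carrier])

lemma dot_add_right: "dot x (y + z) = dot x y + dot x z"
  and dot_scl_right: "dot x (a *c y) = a * dot x y"
  by (simp_all add: dot_commute[of x] dot_add_left dot_scl_left)

lemma dot_zero_left [simp]: "dot 0 x = 0" and dot_zero_right [simp]: "dot x 0 = 0"
  using dot_scl_left[of 0 0 x] dot_scl_right[of x 0 0] by simp_all

lemma dot_minus_left: "dot (- x) y = - dot x y"
  using dot_scl_left[of "-1" x y] by (simp add: scl_minus_left)

lemma dot_minus_right: "dot x (- y) = - dot x y"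
  by (simp add: dot_commute[of x] dot_minus_left)

lemma dot_diff_left: "dot (x - y) z = dot x z - dot y z"
  and dot_diff_right: "dot z (x - y) = dot z x - dot z y"
  using dot_add_left[of x "- y" z] dot_add_right[of z x "- y"]
  by (simp_all add: dot_minus_left dot_minus_right)

lemma dot_bas: "i < cdim TYPE('a) \<Longrightarrow> dot (bas i) x = coords x $ i"
  unfolding dot_def by simp

lemma dot_nondegenerate: assumes "\<And>y. dot y x = 0" shows "x = 0"
proof -
  have "coords x = 0\<^sub>v (cdim TYPE('a))"
    using assms dot_bas[of _ x] by (auto simp: vec_eq_iff)
  then show ?thesis by (simp add: coords_eq_0_iff)
qed

lemma dot_eqI: assumes "\<And>z. dot x z = dot y z" shows "x = y"
proof -
  have "dot z (x - y) = 0" for z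
    using assms[of z] by (simp add: dot_diff_right dot_commute)
  from dot_nondegenerate[OF this] show ?thesis by simp
qed

lemmas dot_simps = dot_add_left dot_add_right dot_scl_left dot_scl_right
  dot_minus_left dot_minus_right dot_diff_left dot_diff_right

end

instantiation complex :: coordspace
begin
definition "cdim_complex (_ :: complex itself) = (1::nat)"
definition "coords_complex (x::complex) = vec 1 (\<lambda>_. x)"
instance
proof
  fix v :: "complex vec" assume "v \<in> carrier_vec (cdim TYPE(complex))"
  then have "coords (v $ 0) = v" by (auto simp: vec_eq_iff cdim_complex_def coords_complex_def)
  then show "\<exists>x::complex. coords x = v" ..
qed (auto simp: vec_eq_iff cdim_complex_def coords_complex_def)
end

instantiation prod :: (coordspace, coordspace) coordspace
begin
definition "cdim_prod (_ :: ('a \<times> 'b) itself) = cdim TYPE('a) + cdim TYPE('b)"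
definition "coords_prod (x :: 'a \<times> 'b) = coords (fst x) @\<^sub>v coords (snd x)"
instance
proof
  fix v :: "complex vec" assume v: "v \<in> carrier_vec (cdim TYPE('a \<times> 'b))"
  obtain x :: 'a where x: "coords x = vec_first v (cdim TYPE('a))"
    using coords_surj by (metis vec_first_carrier)
  obtain y :: 'b where y: "coords y = vec_last v (cdim TYPE('b))"
    using coords_surj by (metis vec_last_carrier)
  have "coords (x, y) = v" using v by (simp add: coords_prod_def x y cdim_prod_def)
  then show "\<exists>x::'a\<times>'b. coords x = v" ..
next
  fix x y :: "'a \<times> 'b" assume "coords x = coords y"
  then have "coords (fst x) = coords (fst y) \<and> coords (snd x) = coords (snd y)"
    unfolding coords_prod_def
    using append_vec_eq[OF coords_carrier[of "fst x"] coords_carrier[of "fst y"]] by blast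
  then show "x = y" by (simp add: coords_eq_iff prod_eq_iff)
qed (auto simp: vec_eq_iff cdim_prod_def coords_prod_def coords_add coords_scl scl_prod_def)
end

lemma coords_Pair: "coords (x, y) = coords x @\<^sub>v coords y"
  by (simp add: coords_prod_def)

lemma dot_Pair [simp]: "dot (x, y) (x', y') = dot x x' + dot y y'"
  unfolding dot_def coords_Pair 
  by (rule scalar_prod_append[OF coords_carrier coords_carrier coords_carrier coords_carrier])

lemma dot_complex [simp]: "dot (x::complex) y = x * y"
  by (simp add: dot_def coords_complex_def scalar_prod_def)


section \<open>Cayley--Dickson algebras\<close>

text \<open>These identities survive every doubling: an anti-involution, and a trace
  \<open>re\<close> that is symmetric and associative even where the product is not. The composition
  law does not survive and is left to a subclass.\<close>

class cdalg = coordspace +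
  fixes level :: "'a itself \<Rightarrow> nat" and mul :: "'a \<Rightarrow> 'a \<Rightarrow> 'a" and bar :: "'a \<Rightarrow> 'a"
  assumes cdim_level: "cdim TYPE('a) = 2 ^ level TYPE('a)"
    and coords_mul: "coords (mul x y) = cd_mult (level TYPE('a)) (coords x) (coords y)"
    and coords_bar: "coords (bar x) = cd_conj (level TYPE('a)) (coords x)"
    and mul_add_left: "mul (x + y) z = mul x z + mul y z"
    and mul_add_right: "mul x (y + z) = mul x y + mul x z"
    and mul_scl_left: "mul (a *c x) y = a *c mul x y"
    and mul_scl_right: "mul x (a *c y) = a *c mul x y"
    and bar_add: "bar (x + y) = bar x + bar y"
    and bar_scl: "bar (a *c x) = a *c bar x"
    and bar_bar [simp]: "bar (bar x) = x"
    and bar_mul: "bar (mul x y) = mul (bar y) (bar x)"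
    and re_bar [simp]: "re (bar x) = re x"
    and re_mul_commute: "re (mul x y) = re (mul y x)"
    and re_mul_assoc: "re (mul (mul x y) z) = re (mul x (mul y z))"
    and re_mul_bar: "re (mul x (bar y)) = dot x y"
begin

lemma re_add: "re (x + y) = re x + re y"
  by (simp add: re_def coords_add cdim_level)

lemma re_scl: "re (a *c x) = a * re x"
  by (simp add: re_def coords_scl cdim_level)

lemma re_minus: "re (- x) = - re x"
  using re_scl[of "-1" x] by (simp add: scl_minus_left)

lemma re_diff: "re (x - y) = re x - re y"
  using re_add[of x "- y"] by (simp add: re_minus)

lemma mul_minus_left: "mul (- x) y = - mul x y" and mul_minus_right: "mul x (- y) = - mul x y"
  using mul_scl_left[of "-1" x y] mul_scl_right[of x "-1" y] by (simp_all add: scl_minus_left)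

lemma mul_diff_left: "mul (x - y) z = mul x z - mul y z"
  and mul_diff_right: "mul x (y - z) = mul x y - mul x z"
  using mul_add_left[of x "- y" z] mul_add_right[of x y "- z"]
  by (simp_all add: mul_minus_left mul_minus_right)

lemma bar_minus: "bar (- x) = - bar x"
  using bar_scl[of "-1" x] by (simp add: scl_minus_left)

lemma bar_diff: "bar (x - y) = bar x - bar y"
  using bar_add[of x "- y"] by (simp add: bar_minus)

lemma dot_bar_bar: "dot (bar x) (bar y) = dot x y"
  by (metis re_mul_bar bar_bar re_mul_commute dot_commute)

end

text \<open>The chain of subclasses mirrors the loss of one property per doubling: trivial
  conjugation makes the double commutative, commutativity makes it associative, associativity makes
  it a composition algebra. Thus three doublings of \<open>complex\<close> stay in
  \<open>compalg\<close>.\<close>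

class compalg = cdalg +
  assumes dot_mul: "dot (mul x y) (mul x y) = dot x x * dot y y"

class assoc_cdalg = compalg +
  assumes mul_assoc: "mul (mul x y) z = mul x (mul y z)"

class comm_cdalg = assoc_cdalg +
  assumes mul_comm: "mul x y = mul y x"

class triv_cdalg = comm_cdalg +
  assumes bar_triv: "bar x = x"

instantiation complex :: triv_cdalg
begin
definition "level_complex (_ :: complex itself) = (0::nat)"
definition "mul_complex (x::complex) y = x * y"
definition "bar_complex (x::complex) = x"
instance
  by standard (simp_all add: level_complex_def mul_complex_def bar_complex_def cdim_complex_def
      coords_complex_def algebra_simps re_def)
end

text \<open>A new type, because doubling needs both components of the same type, while pairs already
  serve as direct sums of different spaces.\<close>

datatype 'a cd = CD 'a 'a

instantiation cd :: (ab_group_add) ab_group_add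
begin
definition "zero_cd = CD 0 0"
fun plus_cd where "plus_cd (CD a b) (CD c d) = CD (a + c) (b + d)"
fun minus_cd where "minus_cd (CD a b) (CD c d) = CD (a - c) (b - d)"
fun uminus_cd where "uminus_cd (CD a b) = CD (- a) (- b)"
instance
proof
  fix x y z :: "'a cd"
  show "x + y + z = x + (y + z)" by (cases x; cases y; cases z) (simp add: add.assoc)
  show "x + y = y + x" by (cases x; cases y) (simp add: add.commute)
  show "0 + x = x" by (cases x) (simp add: zero_cd_def)
  show "- x + x = 0" by (cases x) (simp add: zero_cd_def)
  show "x - y = x + - y" by (cases x; cases y) simp
qed
end

instantiation cd :: (coordspace) coordspace
begin
fun scl_cd where "scl_cd c (CD a b) = CD (c *c a) (c *c b)"
definition "cdim_cd (_ :: 'a cd itself) = cdim TYPE('a) + cdim TYPE('a)"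
fun coords_cd where "coords_cd (CD a b) = coords a @\<^sub>v coords b"
instance
proof
  fix x y :: "'a cd" and a b :: complex
  show "a *c (x + y) = a *c x + a *c y" by (cases x; cases y) (simp add: scl_add_right)
  show "(a + b) *c x = a *c x + b *c x" by (cases x) (simp add: scl_add_left)
  show "a *c b *c x = (a * b) *c x" by (cases x) (simp add: scl_scl)
  show "1 *c x = x" by (cases x) simp
  show "coords x \<in> carrier_vec (cdim TYPE('a cd))" by (cases x) (simp add: cdim_cd_def)
  show "coords (x + y) = coords x + coords y"
    by (cases x; cases y) (auto simp: vec_eq_iff coords_add)
  show "coords (a *c x) = a \<cdot>\<^sub>v coords x" by (cases x) (auto simp: vec_eq_iff coords_scl)
  show "x = y" if "coords x = coords y"
  proof (cases x; cases y)
    fix a b c d assume [simp]: "x = CD a b" "y = CD c d"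
    show ?thesis
      using that append_vec_eq[OF coords_carrier[of a] coords_carrier[of c]]
      by (simp add: coords_eq_iff)
  qed
next
  fix v :: "complex vec" assume v: "v \<in> carrier_vec (cdim TYPE('a cd))"
  obtain x :: 'a where x: "coords x = vec_first v (cdim TYPE('a))"
    using coords_surj by (metis vec_first_carrier)
  obtain y :: 'a where y: "coords y = vec_last v (cdim TYPE('a))"
    using coords_surj by (metis vec_last_carrier)
  have "coords (CD x y) = v" using v by (simp add: x y cdim_cd_def)
  then show "\<exists>x::'a cd. coords x = v" ..
qed
end

lemma dot_CD [simp]: "dot (CD x y) (CD x' y') = dot x x' + dot y y'"
  unfolding dot_def coords_cd.simps 
  by (rule scalar_prod_append[OF coords_carrier coords_carrier coords_carrier coords_carrier])

lemma re_CD [simp]: "re (CD a (b::'a::cdalg)) = re a"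
  by (simp add: re_def cdim_level)

lemma vec_first_append: "v \<in> carrier_vec n \<Longrightarrow> vec_first (v @\<^sub>v w) n = v"
  by (auto simp: vec_first_def vec_eq_iff)

lemma vec_last_append: "w \<in> carrier_vec n \<Longrightarrow> vec_last (v @\<^sub>v w) n = w"
  by (auto simp: vec_last_def vec_eq_iff)

lemma (in coordspace) coords_minus: "coords (- x) = - coords x"
  using coords_scl[of "-1" x] by (auto simp: vec_eq_iff scl_minus_left)

lemma (in coordspace) coords_diff: "coords (x - y) = coords x - coords y"
  using coords_add[of x "- y"] by (auto simp: vec_eq_iff coords_minus)

instantiation cd :: (cdalg) cdalg
begin
definition "level_cd (_ :: 'a cd itself) = Suc (level TYPE('a))"
fun mul_cd where
  "mul_cd (CD a b) (CD c d) = CD (mul a c - mul (bar d) b) (mul d a + mul b (bar c))"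
fun bar_cd where "bar_cd (CD a b) = CD (bar a) (- b)"
instance
proof
  fix x y z :: "'a cd" and a b :: complex
  note bil = mul_add_left mul_add_right mul_scl_left mul_scl_right mul_minus_left mul_minus_right
    mul_diff_left mul_diff_right
  note cn = bar_add bar_scl bar_minus bar_diff bar_mul
  note sc = scl_add_right scl_diff_right scl_minus_right
  note rl = re_add re_diff re_minus re_scl
  have [simp]: "coords v \<in> carrier_vec (2 ^ level TYPE('a))" for v :: 'a
    using coords_carrier[of v] by (simp only: cdim_level)
  show "cdim TYPE('a cd) = 2 ^ level TYPE('a cd)"
    by (simp add: cdim_cd_def level_cd_def cdim_level)
  show "coords (mul x y) = cd_mult (level TYPE('a cd)) (coords x) (coords y)"
    by (cases x; cases y)
      (simp add: level_cd_def vec_first_append vec_last_append Let_def coords_mul coords_bar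
        coords_add coords_diff)
  show "coords (bar x) = cd_conj (level TYPE('a cd)) (coords x)"
    by (cases x)
      (simp add: level_cd_def vec_first_append vec_last_append coords_bar coords_minus)
  show "mul (x + y) z = mul x z + mul y z" by (cases x; cases y; cases z) (simp add: bil cn)
  show "mul x (y + z) = mul x y + mul x z" by (cases x; cases y; cases z) (simp add: bil cn)
  show "mul (a *c x) y = a *c mul x y" by (cases x; cases y) (simp add: bil cn sc)
  show "mul x (a *c y) = a *c mul x y" by (cases x; cases y) (simp add: bil cn sc)
  show "bar (x + y) = bar x + bar y" by (cases x; cases y) (simp add: cn)
  show "bar (a *c x) = a *c bar x" by (cases x) (simp add: cn sc)
  show "bar (bar x) = x" by (cases x) simp
  show "bar (mul x y) = mul (bar y) (bar x)" by (cases x; cases y) (simp add: bil cn)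
  show "re (bar x) = re x" by (cases x) simp
  have c: "re (mul u (bar v)) = re (mul v (bar u))" for u v :: 'a
    by (simp add: re_mul_bar dot_commute)
  have c': "re (mul (bar u) v) = re (mul v (bar u))" for u v :: 'a
    by (rule re_mul_commute)
  show "re (mul x y) = re (mul y x)"
    by (cases x; cases y) (simp add: rl, metis c c' re_mul_commute)
  show "re (mul x (bar y)) = dot x y"
    by (cases x; cases y) (simp add: rl bil cn re_mul_bar c' dot_commute)
  show "re (mul (mul x y) z) = re (mul x (mul y z))"
  proof (cases x; cases y; cases z)
    fix a b c d e f assume [simp]: "x = CD a b" "y = CD c d" "z = CD e f"
    have 1: "re (mul (mul (bar d) b) e) = re (mul (mul e (bar d)) b)"
      by (metis re_mul_assoc re_mul_commute)
    have 2: "re (mul (bar f) (mul d a)) = re (mul a (mul (bar f) d))"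
      by (metis re_mul_assoc re_mul_commute)
    have 3: "re (mul (bar f) (mul b (bar c))) = re (mul (mul (bar c) (bar f)) b)"
      by (metis re_mul_assoc re_mul_commute)
    show ?thesis by (simp add: rl bil cn 1 2 3 re_mul_assoc[of a c e])
  qed
qed
end

text \<open>The norm of a product has two mixed terms of opposite sign, one from each component.
  They cancel because associativity allows the factors under \<open>re\<close> to be regrouped
  cyclically.\<close>

instance cd :: (assoc_cdalg) compalg
proof
  fix x y :: "'a cd"
  show "dot (mul x y) (mul x y) = dot x x * dot y y"
  proof (cases x; cases y)
    fix a b c d assume [simp]: "x = CD a b" "y = CD c d"
    have "dot (mul a c) (mul (bar d) b) = re (mul (mul a c) (mul (bar b) d))"
      by (simp add: re_mul_bar[symmetric] bar_mul)
    also have "\<dots> = re (mul (mul d a) (mul c (bar b)))"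
      by (metis mul_assoc re_mul_commute)
    also have "\<dots> = dot (mul d a) (mul b (bar c))"
      by (simp add: re_mul_bar[symmetric] bar_mul)
    finally have e: "dot (mul a c) (mul (bar d) b) = dot (mul d a) (mul b (bar c))" .
    show ?thesis
      by (simp add: dot_simps dot_commute[of "mul (bar d) b" "mul a c"]
          dot_commute[of "mul b (bar c)" "mul d a"] e dot_mul dot_bar_bar algebra_simps)
  qed
qed

instance cd :: (comm_cdalg) assoc_cdalg
proof
  fix x y z :: "'a cd"
  have lc: "mul u (mul v w) = mul v (mul u w)" for u v w :: 'a
    by (metis mul_assoc mul_comm)
  show "mul (mul x y) z = mul x (mul y z)"
    by (cases x; cases y; cases z)
      (simp add: mul_add_left mul_add_right mul_diff_left mul_diff_right bar_add bar_diff bar_mul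
        mul_assoc mul_comm lc algebra_simps)
qed

instance cd :: (triv_cdalg) comm_cdalg
proof
  fix x y :: "'a cd"
  show "mul x y = mul y x"
    by (cases x; cases y) (simp add: bar_triv mul_comm add.commute)
qed

section \<open>Identities in composition algebras\<close>

context compalg
begin

text \<open>For this product the trilinear form \<open>dot (x \<star> y) z\<close> is cyclically symmetric, which makes the
  cubic form invariant under cyclic permutation of the three indices.\<close>

definition star :: "'a \<Rightarrow> 'a \<Rightarrow> 'a"  (infixl \<open>\<star>\<close> 72) where
  "x \<star> y = bar (mul x y)"

lemma star_add_left: "(x + y) \<star> z = x \<star> z + y \<star> z"
  and star_add_right: "z \<star> (x + y) = z \<star> x + z \<star> y"
  and star_scl_left: "(a *c x) \<star> y = a *c (x \<star> y)"
  and star_scl_right: "x \<star> (a *c y) = a *c (x \<star> y)"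
  and star_minus_left: "(- x) \<star> y = - (x \<star> y)"
  and star_minus_right: "x \<star> (- y) = - (x \<star> y)"
  and star_diff_left: "(x - y) \<star> z = x \<star> z - y \<star> z"
  and star_diff_right: "z \<star> (x - y) = z \<star> x - z \<star> y"
  by (simp_all add: star_def mul_add_left mul_add_right mul_scl_left mul_scl_right mul_minus_left
      mul_minus_right mul_diff_left mul_diff_right bar_add bar_scl bar_minus bar_diff)

lemmas star_simps = star_add_left star_add_right star_scl_left star_scl_right star_minus_left
  star_minus_right star_diff_left star_diff_right

lemma star_zero_left [simp]: "0 \<star> x = 0" and star_zero_right [simp]: "x \<star> 0 = 0"
  using star_scl_left[of 0 0 x] star_scl_right[of x 0 0] by simp_all

lemma dot_star: "dot (x \<star> y) z = re (mul (mul x y) z)"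
  by (metis star_def re_mul_bar bar_bar dot_commute bar_mul re_mul_commute re_bar)

text \<open>Under \<open>re\<close> a triple product may be rebracketed and rotated, even for
  octonions.\<close>

lemma dot_star_cyclic: "dot (x \<star> y) z = dot (y \<star> z) x"
  by (simp add: dot_star re_mul_assoc re_mul_commute[of x])

lemma dot_star_star_same: "dot (x \<star> y) (x \<star> y) = dot x x * dot y y"
  by (simp add: star_def dot_bar_bar dot_mul)

lemma dot_star_star: "dot (x \<star> y) (x \<star> z) = dot x x * dot y z"
  using dot_star_star_same[of x "y + z"] dot_star_star_same[of x y] dot_star_star_same[of x z]
  by (simp add: star_simps dot_simps dot_commute[of z y] dot_commute[of "x \<star> z" "x \<star> y"]
      algebra_simps)

lemma dot_star_star': "dot (y \<star> x) (z \<star> x) = dot x x * dot y z"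
  using dot_star_star_same[of "y + z" x] dot_star_star_same[of y x] dot_star_star_same[of z x]
  by (simp add: star_simps dot_simps dot_commute[of z y] dot_commute[of "z \<star> x" "y \<star> x"]
      algebra_simps)

text \<open>Cyclicity makes right multiplication by \<open>x\<close> the adjoint of left
  multiplication by \<open>x\<close>, and the polarized composition law says that their composite is
  the scalar \<open>dot x x\<close>. This replaces associativity in all later computations.\<close>

lemma star_star_left: "(x \<star> y) \<star> x = dot x x *c y"
proof (rule dot_eqI)
  fix z show "dot ((x \<star> y) \<star> x) z = dot (dot x x *c y) z"
    by (metis dot_star_cyclic dot_star_star dot_scl_left dot_commute)
qed

lemma star_star_right: "x \<star> (y \<star> x) = dot x x *c y"
proof (rule dot_eqI)
  fix z show "dot (x \<star> (y \<star> x)) z = dot (dot x x *c y) z"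
    by (metis dot_star_cyclic dot_star_star' dot_scl_left dot_commute)
qed

end

section \<open>The cubic form and its automorphisms\<close>

type_synonym 'a jordan = "complex \<times> complex \<times> complex \<times> 'a \<times> 'a \<times> 'a"

definition Nrm :: "'a::compalg jordan \<Rightarrow> complex" where
  "Nrm = (\<lambda>(r0, r1, r2, a0, a1, a2).
     r0 * r1 * r2 - r0 * dot a0 a0 - r1 * dot a1 a1 - r2 * dot a2 a2 + 2 * dot (a0 \<star> a1) a2)"

text \<open>The adjoint matrix of 2 x 2 cofactors. By \<open>Nrm_add\<close> it is the gradient of
  \<open>Nrm\<close> with respect to \<open>pr\<close>.\<close>

definition sharp :: "'a::compalg jordan \<Rightarrow> 'a jordan" where
  "sharp = (\<lambda>(r0, r1, r2, a0, a1, a2).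
     (r1 * r2 - dot a0 a0, r2 * r0 - dot a1 a1, r0 * r1 - dot a2 a2,
      a1 \<star> a2 - r0 *c a0, a2 \<star> a0 - r1 *c a1, a0 \<star> a1 - r2 *c a2))"

text \<open>The trace form of the Jordan algebra; the factor 2 arises because a Hermitian matrix
  contains each off-diagonal entry twice, once conjugated.\<close>

definition pr :: "'a::compalg jordan \<Rightarrow> 'a jordan \<Rightarrow> complex" where
  "pr = (\<lambda>(s0, s1, s2, c0, c1, c2) (r0, r1, r2, a0, a1, a2).
     s0 * r0 + s1 * r1 + s2 * r2 + 2 * (dot c0 a0 + dot c1 a1 + dot c2 a2))"

text \<open>The Freudenthal product: the polarization, hence the differential, of the quadratic map
  \<open>sharp\<close>.\<close>

definition cross :: "'a::compalg jordan \<Rightarrow> 'a jordan \<Rightarrow> 'a jordan" where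
  "cross x v = sharp (x + v) - sharp x - sharp v"

declare split_paired_All [simp del] split_paired_Ex [simp del]

lemma Nrm_tuple [simp]: "Nrm (r0, r1, r2, a0, a1, a2) =
    r0 * r1 * r2 - r0 * dot a0 a0 - r1 * dot a1 a1 - r2 * dot a2 a2 + 2 * dot (a0 \<star> a1) a2"
  by (simp add: Nrm_def)

lemma sharp_tuple [simp]: "sharp (r0, r1, r2, a0, a1, a2) =
     (r1 * r2 - dot a0 a0, r2 * r0 - dot a1 a1, r0 * r1 - dot a2 a2,
      a1 \<star> a2 - r0 *c a0, a2 \<star> a0 - r1 *c a1, a0 \<star> a1 - r2 *c a2)"
  by (simp add: sharp_def)

lemma pr_tuple [simp]: "pr (s0, s1, s2, c0, c1, c2) (r0, r1, r2, a0, a1, a2) =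
     s0 * r0 + s1 * r1 + s2 * r2 + 2 * (dot c0 a0 + dot c1 a1 + dot c2 a2)"
  by (simp add: pr_def)

lemma cross_tuple [simp]: "cross (r0, r1, r2, a0, a1, a2) (s0, s1, s2, c0, c1, c2) =
     (r1 * s2 + s1 * r2 - 2 * dot a0 c0, r2 * s0 + s2 * r0 - 2 * dot a1 c1,
      r0 * s1 + s0 * r1 - 2 * dot a2 c2,
      a1 \<star> c2 + c1 \<star> a2 - r0 *c c0 - s0 *c a0,
      a2 \<star> c0 + c2 \<star> a0 - r1 *c c1 - s1 *c a1,
      a0 \<star> c1 + c0 \<star> a1 - r2 *c c2 - s2 *c a2)"
  by (simp add: cross_def dot_simps star_simps scl_add_left scl_add_right dot_commute[of c0 a0]
      dot_commute[of c1 a1] dot_commute[of c2 a2] algebra_simps)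

lemma pr_commute: "pr x y = pr y x"
  by (cases x; cases y) (simp add: dot_commute algebra_simps)

lemma pr_add_right: "pr y (x + v) = pr y x + pr y v"
  by (cases x; cases y; cases v) (simp add: dot_simps algebra_simps)

lemma pr_scl_right: "pr y (c *c x) = c * pr y x"
  by (cases x; cases y) (simp add: dot_simps algebra_simps)

lemma pr_scl_left: "pr (c *c y) x = c * pr y x"
  by (simp add: pr_commute[of _ x] pr_scl_right)

lemma pr_minus_right: "pr y (- x) = - pr y x"
  using pr_scl_right[of y "-1" x] by (simp add: scl_minus_left)

lemma pr_zero_right [simp]: "pr y 0 = 0"
  using pr_scl_right[of y 0 0] by simp

lemma pr_nondegenerate:
  fixes y :: "'a::compalg jordan"
  assumes "\<And>x. pr y x = 0" shows "y = 0"
proof -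
  obtain s0 s1 s2 c0 c1 c2 where [simp]: "y = (s0, s1, s2, c0, c1, c2)" by (cases y)
  have "dot z c0 = 0" "dot z c1 = 0" "dot z c2 = 0" for z
    using assms[of "(0, 0, 0, z, 0, 0)"] assms[of "(0, 0, 0, 0, z, 0)"]
      assms[of "(0, 0, 0, 0, 0, z)"] by (simp_all add: dot_commute)
  then have "c0 = 0" "c1 = 0" "c2 = 0" by (blast intro: dot_nondegenerate)+
  then show ?thesis
    using assms[of "(1, 0, 0, 0, 0, 0)"] assms[of "(0, 1, 0, 0, 0, 0)"]
      assms[of "(0, 0, 1, 0, 0, 0)"] by (simp add: zero_prod_def)
qed

lemma Nrm_add: "Nrm (x + v) = Nrm x + pr (sharp x) v + pr (sharp v) x + Nrm v"
proof -
  obtain r0 r1 r2 a0 a1 a2 where [simp]: "x = (r0, r1, r2, a0, a1, a2)" by (cases x)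
  obtain s0 s1 s2 c0 c1 c2 where [simp]: "v = (s0, s1, s2, c0, c1, c2)" by (cases v)
  have e: "dot (a1 \<star> a2) c0 = dot (c0 \<star> a1) a2" "dot (a2 \<star> a0) c1 = dot (a0 \<star> c1) a2"
    "dot (c1 \<star> c2) a0 = dot (a0 \<star> c1) c2" "dot (c2 \<star> c0) a1 = dot (c0 \<star> a1) c2"
    by (metis dot_star_cyclic)+
  show ?thesis
    by (simp add: dot_simps star_simps e dot_commute[of c0 a0] dot_commute[of c1 a1]
        dot_commute[of c2 a2] algebra_simps)
qed

lemma Nrm_scl: "Nrm (c *c x) = c ^ 3 * Nrm x"
  by (cases x) (simp add: dot_simps star_simps power3_eq_cube algebra_simps)

lemma sharp_scl: "sharp (c *c x) = c\<^sup>2 *c sharp x"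
  by (cases x) (simp add: dot_simps star_simps power2_eq_square scl_diff_right scl_scl algebra_simps)

lemma Nrm_uminus: "Nrm (- x) = - Nrm x" and sharp_uminus: "sharp (- x) = sharp x"
  using Nrm_scl[of "-1" x] sharp_scl[of "-1" x] by (simp_all add: scl_minus_left)

lemma cross_commute: "cross x v = cross v x"
  by (simp add: cross_def algebra_simps)

lemma cross_scl_right: "cross x (c *c v) = c *c cross x v"
  by (cases x; cases v) (simp add: dot_simps star_simps scl_diff_right scl_add_right scl_scl algebra_simps)

lemma cross_add_right: "cross x (v + w) = cross x v + cross x w"
  by (cases x; cases v; cases w)
    (simp add: dot_simps star_simps scl_add_left scl_add_right algebra_simps)

lemma sharp_add: "sharp (x + v) = sharp x + cross x v + sharp v"
  by (simp add: cross_def)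

text \<open>The odd part in \<open>v\<close> of the Taylor expansion isolates the gradient. Written
  through values of \<open>Nrm\<close> alone, it is carried along by every linear map that preserves
  \<open>Nrm\<close>.\<close>

lemma pr_sharp: "2 * pr (sharp x) v = Nrm (x + v) - Nrm (x + - v) - 2 * Nrm v"
  by (simp only: Nrm_add Nrm_uminus sharp_uminus pr_minus_right) simp

section \<open>Linear isometries of the cubic form\<close>

definition GJ :: "('a::compalg jordan \<Rightarrow> 'a jordan) set" where
  "GJ = {f. lin f \<and> (\<forall>x. Nrm (f x) = Nrm x) \<and> (\<exists>g. \<forall>x. g (f x) = x \<and> f (g x) = x)}"

lemma GJ_lin: "f \<in> GJ \<Longrightarrow> lin f"
  and GJ_Nrm: "f \<in> GJ \<Longrightarrow> Nrm (f x) = Nrm x"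
  by (simp_all add: GJ_def)

lemma GJI:
  assumes "lin f" "\<And>x. Nrm (f x) = Nrm x" "\<And>x. g (f x) = x" "\<And>x. f (g x) = x"
  shows "f \<in> GJ"
  unfolding GJ_def using assms by blast

lemma GJ_comp: assumes "f \<in> GJ" "g \<in> GJ" shows "(\<lambda>x. f (g x)) \<in> GJ"
proof -
  obtain f' g' where "\<forall>x. f' (f x) = x \<and> f (f' x) = x" "\<forall>x. g' (g x) = x \<and> g (g' x) = x"
    using assms by (auto simp: GJ_def)
  then show ?thesis
    by (intro GJI[where g="\<lambda>x. g' (f' x)"]) (simp_all only: lin_comp GJ_lin GJ_Nrm assms)
qed

lemma GJ_inverse:
  assumes "f \<in> GJ" obtains g where "g \<in> GJ" "\<And>x. g (f x) = x" "\<And>x. f (g x) = x"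
proof -
  obtain g where g: "\<And>x. g (f x) = x" "\<And>x. f (g x) = x" using assms by (auto simp: GJ_def)
  have "lin g" using lin_inverse[OF GJ_lin[OF assms] g] .
  moreover have "Nrm (g x) = Nrm x" for x using GJ_Nrm[OF assms, of "g x"] g by simp
  ultimately have "g \<in> GJ" using g by (intro GJI)
  then show ?thesis using that g by blast
qed

lemma GJ_eq_0_iff: "f \<in> GJ \<Longrightarrow> f x = 0 \<longleftrightarrow> x = 0"
  by (metis GJ_inverse GJ_lin lin_zero)

definition rk1 :: "'a::compalg jordan \<Rightarrow> bool" where
  "rk1 x \<longleftrightarrow> x \<noteq> 0 \<and> sharp x = 0"

lemma GJ_pr_sharp: assumes "f \<in> GJ" shows "pr (sharp (f x)) (f v) = pr (sharp x) v"
proof -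
  have "2 * pr (sharp (f x)) (f v) = 2 * pr (sharp x) v"
    unfolding pr_sharp
    by (simp only: lin_add[OF GJ_lin[OF assms], symmetric] lin_minus[OF GJ_lin[OF assms], symmetric]
        GJ_Nrm[OF assms])
  then show ?thesis by simp
qed

text \<open>An isometry need not commute with \<open>sharp\<close>, but \<open>sharp x = 0\<close>
  says that \<open>Nrm\<close> is critical at \<open>x\<close>, and this is an invariant
  condition.\<close>

lemma GJ_rk1: assumes "f \<in> GJ" shows "rk1 (f x) \<longleftrightarrow> rk1 x"
proof -
  obtain g where g: "\<And>x. f (g x) = x" using assms by (metis GJ_inverse)
  have "sharp (f x) = 0 \<longleftrightarrow> (\<forall>v. pr (sharp (f x)) v = 0)"
    by (metis pr_nondegenerate pr_commute pr_zero_right)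
  also have "\<dots> \<longleftrightarrow> (\<forall>v. pr (sharp (f x)) (f v) = 0)" by (metis g)
  also have "\<dots> \<longleftrightarrow> (\<forall>v. pr (sharp x) v = 0)" by (simp add: GJ_pr_sharp[OF assms])
  also have "\<dots> \<longleftrightarrow> sharp x = 0" by (metis pr_nondegenerate pr_commute pr_zero_right)
  finally show ?thesis by (simp add: rk1_def GJ_eq_0_iff[OF assms])
qed

lemma rk1_scl: "c \<noteq> 0 \<Longrightarrow> rk1 (c *c x) \<longleftrightarrow> rk1 x"
  by (simp add: rk1_def sharp_scl)

text \<open>\<open>E01 u\<close> is \<open>x \<mapsto> (1 + u e\<^sub>0\<^sub>1) x (1 + u e\<^sub>0\<^sub>1)\<^sup>*\<close> for the matrix unit \<open>e\<^sub>0\<^sub>1\<close>, and similarly for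
  the other indices.\<close>

definition E01 :: "'a::compalg \<Rightarrow> 'a jordan \<Rightarrow> 'a jordan" where
  "E01 u = (\<lambda>(r0, r1, r2, a0, a1, a2).
     (r0 + 2 * dot u a2 + dot u u * r1, r1, r2, a0, a1 + u \<star> a0, a2 + r1 *c u))"

definition E10 :: "'a::compalg \<Rightarrow> 'a jordan \<Rightarrow> 'a jordan" where
  "E10 u = (\<lambda>(r0, r1, r2, a0, a1, a2).
     (r0, r1 + 2 * dot u a2 + dot u u * r0, r2, a0 + a1 \<star> u, a1, a2 + r0 *c u))"

text \<open>Thanks to this symmetry, the elementary maps need to be examined for one pair of indices
  only.\<close>

definition rot :: "'a::compalg jordan \<Rightarrow> 'a jordan" where
  "rot = (\<lambda>(r0, r1, r2, a0, a1, a2). (r1, r2, r0, a1, a2, a0))"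

definition "E12 u x = rot (rot (E01 u (rot x)))"
definition "E20 u x = rot (E01 u (rot (rot x)))"
definition "E21 u x = rot (rot (E10 u (rot x)))"
definition "E02 u x = rot (E10 u (rot (rot x)))"

text \<open>This is \<open>x\<close> multiplied from both sides by the diagonal matrix with entries
  \<open>t0, t1, t2\<close>, so \<open>Nrm\<close> is scaled by the square of their product.\<close>

definition tor :: "complex \<Rightarrow> complex \<Rightarrow> complex \<Rightarrow> 'a::compalg jordan \<Rightarrow> 'a jordan" where
  "tor t0 t1 t2 = (\<lambda>(r0, r1, r2, a0, a1, a2).
     (t0\<^sup>2 * r0, t1\<^sup>2 * r1, t2\<^sup>2 * r2, (t1 * t2) *c a0, (t2 * t0) *c a1, (t0 * t1) *c a2))"

lemma E_tuple [simp]: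
  "E01 u (r0, r1, r2, a0, a1, a2) =
     (r0 + 2 * dot u a2 + dot u u * r1, r1, r2, a0, a1 + u \<star> a0, a2 + r1 *c u)"
  "E10 u (r0, r1, r2, a0, a1, a2) =
     (r0, r1 + 2 * dot u a2 + dot u u * r0, r2, a0 + a1 \<star> u, a1, a2 + r0 *c u)"
  "rot (r0, r1, r2, a0, a1, a2) = (r1, r2, r0, a1, a2, a0)"
  "E12 u (r0, r1, r2, a0, a1, a2) =
     (r0, r1 + 2 * dot u a0 + dot u u * r2, r2, a0 + r2 *c u, a1, a2 + u \<star> a1)"
  "E20 u (r0, r1, r2, a0, a1, a2) =
     (r0, r1, r2 + 2 * dot u a1 + dot u u * r0, a0 + u \<star> a2, a1 + r0 *c u, a2)"
  "E21 u (r0, r1, r2, a0, a1, a2) =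
     (r0, r1, r2 + 2 * dot u a0 + dot u u * r1, a0 + r1 *c u, a1 + a2 \<star> u, a2)"
  "E02 u (r0, r1, r2, a0, a1, a2) =
     (r0 + 2 * dot u a1 + dot u u * r2, r1, r2, a0, a1 + r2 *c u, a2 + a0 \<star> u)"
  "tor t0 t1 t2 (r0, r1, r2, a0, a1, a2) =
     (t0\<^sup>2 * r0, t1\<^sup>2 * r1, t2\<^sup>2 * r2, (t1 * t2) *c a0, (t2 * t0) *c a1, (t0 * t1) *c a2)"
  by (simp_all add: E01_def E10_def rot_def E12_def E20_def E21_def E02_def tor_def)

lemma rot_rot_rot [simp]: "rot (rot (rot x)) = x"
  by (cases x) simp

lemma E_uminus [simp]:
  "E01 (- u) (E01 u x) = x" "E10 (- u) (E10 u x) = x"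
  "E01 u (E01 (- u) x) = x" "E10 u (E10 (- u) x) = x"
  by (cases x; simp add: dot_simps star_simps scl_minus_right algebra_simps)+

lemma E_uminus' [simp]:
  "E12 (- u) (E12 u x) = x" "E12 u (E12 (- u) x) = x"
  "E02 (- u) (E02 u x) = x" "E02 u (E02 (- u) x) = x"
  by (simp_all add: E12_def E02_def)

text \<open>The terms linear and quadratic in \<open>u\<close> cancel by cyclicity, by
  \<open>a0 \<star> (u \<star> a0) = dot a0 a0 *c u\<close> and by the composition law.\<close>

lemma Nrm_E01: "Nrm (E01 u x) = Nrm x"
proof -
  obtain r0 r1 r2 a0 a1 a2 where [simp]: "x = (r0, r1, r2, a0, a1, a2)" by (cases x)
  have e: "dot (a0 \<star> a1) u = dot (u \<star> a0) a1"
    by (metis dot_star_cyclic)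
  show ?thesis
    by (simp add: dot_simps star_simps star_star_right dot_star_star_same e
        dot_commute[of a1 "u \<star> a0"] dot_commute[of a2 u] dot_commute[of a0 u] algebra_simps)
qed

lemma Nrm_E10: "Nrm (E10 u x) = Nrm x"
proof -
  obtain r0 r1 r2 a0 a1 a2 where [simp]: "x = (r0, r1, r2, a0, a1, a2)" by (cases x)
  have e: "dot (a0 \<star> a1) u = dot a0 (a1 \<star> u)"
    by (metis dot_star_cyclic dot_commute)
  show ?thesis
    by (simp add: dot_simps star_simps star_star_left dot_star_star_same e
        dot_commute[of "a1 \<star> u" a0] dot_commute[of a2 u] dot_commute[of a1 u] algebra_simps)
qed

lemma Nrm_rot: "Nrm (rot x) = Nrm x"
  by (cases x) (simp add: dot_star_cyclic[symmetric] algebra_simps)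

lemma E01_GJ: "E01 u \<in> GJ"
proof -
  have "lin (E01 u)"
    by (rule linI; clarsimp simp: dot_simps star_simps scl_add_left scl_add_right scl_scl algebra_simps)
  then show ?thesis by (rule GJI) (rule Nrm_E01 E_uminus)+
qed

lemma E10_GJ: "E10 u \<in> GJ"
proof -
  have "lin (E10 u)"
    by (rule linI; clarsimp simp: dot_simps star_simps scl_add_left scl_add_right scl_scl algebra_simps)
  then show ?thesis by (rule GJI) (rule Nrm_E10 E_uminus)+
qed

lemma rot_GJ: "rot \<in> GJ"
proof -
  have "lin rot" by (rule linI; clarsimp)
  then show ?thesis by (rule GJI) (rule Nrm_rot rot_rot_rot)+
qed

lemma tor_GJ: assumes "(t0 * t1 * t2)\<^sup>2 = 1" shows "tor t0 t1 t2 \<in> GJ"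
proof -
  have l: "lin (tor t0 t1 t2)"
    by (rule linI; clarsimp simp: scl_add_right scl_scl algebra_simps)
  have nz: "t0 \<noteq> 0" "t1 \<noteq> 0" "t2 \<noteq> 0" using assms by auto
  have p: "t0\<^sup>2 * t1\<^sup>2 * t2\<^sup>2 = 1" using assms by (simp add: power_mult_distrib)
  have n: "Nrm (tor t0 t1 t2 x) = Nrm x" for x :: "'a jordan"
  proof -
    obtain r0 r1 r2 a0 a1 a2 where [simp]: "x = (r0, r1, r2, a0, a1, a2)" by (cases x)
    have "Nrm (tor t0 t1 t2 x) = (t0\<^sup>2 * t1\<^sup>2 * t2\<^sup>2) * Nrm x"
      by (simp add: dot_simps star_simps power2_eq_square algebra_simps)
    then show ?thesis by (simp add: p)
  qed
  have "tor (inverse t0) (inverse t1) (inverse t2) (tor t0 t1 t2 x) = x"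
    "tor t0 t1 t2 (tor (inverse t0) (inverse t1) (inverse t2) x) = x" for x :: "'a jordan"
    using nz by (cases x; simp add: scl_scl power2_eq_square field_simps)+
  then show ?thesis using l n by (intro GJI)
qed

text \<open>\<open>f\<close> moves points and its adjoint \<open>f'\<close> moves linear forms
  \<open>pr y\<close>. Requiring both to preserve \<open>Nrm\<close> lets one elimination argument
  serve points and forms; it is verified on generators and passes to composites and
  inverses.\<close>

definition dual_pair ::
  "('a::compalg jordan \<Rightarrow> 'a jordan) \<Rightarrow> ('a jordan \<Rightarrow> 'a jordan) \<Rightarrow> bool" where
  "dual_pair f f' \<longleftrightarrow> f \<in> GJ \<and> f' \<in> GJ \<and> (\<forall>x y. pr (f' y) x = pr y (f x))"

lemma dual_pair_sym: "dual_pair f f' \<Longrightarrow> dual_pair f' f"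
  by (simp add: dual_pair_def) (metis pr_commute)

lemma dual_pair_comp:
  "dual_pair f f' \<Longrightarrow> dual_pair g g' \<Longrightarrow> dual_pair (\<lambda>x. f (g x)) (\<lambda>x. g' (f' x))"
  by (simp add: dual_pair_def GJ_comp)

lemma dual_pair_inverse:
  assumes "dual_pair f f'"
  obtains g g' where "dual_pair g g'" "\<And>x. g' (f' x) = x"
proof -
  have f: "f \<in> GJ" "f' \<in> GJ" "\<And>x y. pr (f' y) x = pr y (f x)"
    using assms by (auto simp: dual_pair_def)
  obtain g where g: "g \<in> GJ" "\<And>x. g (f x) = x" "\<And>x. f (g x) = x" using f(1) by (metis GJ_inverse)
  obtain g' where g': "g' \<in> GJ" "\<And>x. g' (f' x) = x" "\<And>x. f' (g' x) = x"
    using f(2) by (metis GJ_inverse)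
  have "pr (g' y) x = pr y (g x)" for x y using f(3)[of "g' y" "g x"] by (simp add: g g')
  then have "dual_pair g g'" using g(1) g'(1) by (simp only: dual_pair_def) blast
  then show ?thesis using that g'(2) by blast
qed

lemma dual_pair_E01: "dual_pair (E01 u) (E10 u)"
proof -
  have "pr (E10 u y) x = pr y (E01 u x)" for x y
  proof -
    obtain r0 r1 r2 a0 a1 a2 where [simp]: "x = (r0, r1, r2, a0, a1, a2)" by (cases x)
    obtain s0 s1 s2 c0 c1 c2 where [simp]: "y = (s0, s1, s2, c0, c1, c2)" by (cases y)
    have e: "dot c1 (u \<star> a0) = dot (c1 \<star> u) a0"
      by (metis dot_star_cyclic dot_commute)
    show ?thesis by (simp add: dot_simps e dot_commute[of c2 u] algebra_simps)
  qed
  then show ?thesis by (simp add: dual_pair_def E01_GJ E10_GJ)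
qed

lemma dual_pair_rot: "dual_pair rot (\<lambda>x. rot (rot x))"
proof -
  have "pr (rot (rot y)) x = pr y (rot x)" for x y :: "'a jordan"
    by (cases x; cases y) simp
  then show ?thesis by (simp add: dual_pair_def rot_GJ GJ_comp)
qed

lemma dual_pair_tor: 
  assumes "(t0 * t1 * t2)\<^sup>2 = 1" shows "dual_pair (tor t0 t1 t2) (tor t0 t1 t2)"
proof -
  have "pr (tor t0 t1 t2 y) x = pr y (tor t0 t1 t2 x)" for x y :: "'a jordan"
    by (cases x; cases y) (simp add: dot_simps algebra_simps)
  then show ?thesis by (simp add: dual_pair_def tor_GJ[OF assms])
qed

section \<open>Equivalence of elements and Gaussian elimination\<close>

definition equiv_rel :: "'a::compalg jordan \<Rightarrow> 'a jordan \<Rightarrow> bool"  (infix \<open>\<simeq>\<close> 50) where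
  "x \<simeq> y \<longleftrightarrow> (\<exists>f f'. dual_pair f f' \<and> f' x = y)"

lemma equivI: "dual_pair f f' \<Longrightarrow> f' x = y \<Longrightarrow> x \<simeq> y"
  by (auto simp: equiv_rel_def)

lemma equiv_trans [trans]: "x \<simeq> y \<Longrightarrow> y \<simeq> z \<Longrightarrow> x \<simeq> z"
proof -
  assume "x \<simeq> y" "y \<simeq> z"
  then obtain f f' g g' where "dual_pair f f'" "f' x = y" "dual_pair g g'" "g' y = z"
    by (auto simp: equiv_rel_def)
  then show ?thesis by (intro equivI[OF dual_pair_comp[of f f' g g']]) simp_all
qed

lemma equiv_sym: "x \<simeq> y \<Longrightarrow> y \<simeq> x"
proof -
  assume "x \<simeq> y"
  then obtain f f' where f: "dual_pair f f'" "f' x = y" by (auto simp: equiv_rel_def)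
  obtain g g' where g: "dual_pair g g'" "\<And>x. g' (f' x) = x" using dual_pair_inverse[OF f(1)] by metis
  have "g' y = x" using g(2)[of x] f(2) by simp
  then show ?thesis using g(1) by (intro equivI)
qed

lemma equiv_E: "x \<simeq> E01 u x" "x \<simeq> E10 u x" "x \<simeq> rot x"
  using dual_pair_E01 dual_pair_sym dual_pair_rot unfolding equiv_rel_def by blast+

lemma equiv_E': "x \<simeq> E12 u x" "x \<simeq> E20 u x" "x \<simeq> E21 u x"
  unfolding E12_def E20_def E21_def by (meson equiv_E equiv_trans)+

lemma equiv_tor: "(t0 * t1 * t2)\<^sup>2 = 1 \<Longrightarrow> x \<simeq> tor t0 t1 t2 x"
  using dual_pair_tor unfolding equiv_rel_def by blast

lemma equiv_refl: "x \<simeq> x"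
  by (meson equiv_E equiv_sym equiv_trans)

lemma equiv_GJ: "x \<simeq> y \<Longrightarrow> \<exists>f\<in>GJ. f x = y"
  by (auto simp: equiv_rel_def dual_pair_def)

lemma equiv_Nrm: "x \<simeq> y \<Longrightarrow> Nrm x = Nrm y"
  using equiv_GJ GJ_Nrm by metis

lemma equiv_rk1: "x \<simeq> y \<Longrightarrow> rk1 x = rk1 y"
  using equiv_GJ GJ_rk1 by metis

text \<open>A nonzero diagonal entry can be rotated into the corner. If the diagonal vanishes, an
  elementary map creates the corner entry \<open>2 * dot u b2\<close> from a nonzero off-diagonal
  entry, and nondegeneracy provides a suitable \<open>u\<close>.\<close>

lemma equiv_nonzero_corner:
  fixes x :: "'a::compalg jordan"
  assumes "x \<noteq> 0" shows "\<exists>r0 r1 r2 a0 a1 a2. x \<simeq> (r0, r1, r2, a0, a1, a2) \<and> r0 \<noteq> 0"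
proof -
  obtain r0 r1 r2 a0 a1 a2 where x: "x = (r0, r1, r2, a0, a1, a2)" by (cases x)
  have *: ?thesis if "x \<simeq> (0, 0, 0, b0, b1, b2)" "b2 \<noteq> 0" for b0 b1 b2 :: 'a
  proof -
    obtain u where u: "dot u b2 \<noteq> 0" using \<open>b2 \<noteq> 0\<close> dot_nondegenerate[of b2] by auto
    have "x \<simeq> (2 * dot u b2, 0, 0, b0, b1 + u \<star> b0, b2)"
      using equiv_trans[OF that(1) equiv_E(1)[of _ u]] by simp
    then show ?thesis by (intro exI conjI) (assumption, simp add: u)
  qed
  note rot1 = equiv_E(3)[of x] and rot2 = equiv_trans[OF equiv_E(3)[of x] equiv_E(3)]
  consider "r0 \<noteq> 0" | "r1 \<noteq> 0" | "r2 \<noteq> 0" | "r0 = 0" "r1 = 0" "r2 = 0" "a2 \<noteq> 0"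
    | "r0 = 0" "r1 = 0" "r2 = 0" "a0 \<noteq> 0" | "r0 = 0" "r1 = 0" "r2 = 0" "a1 \<noteq> 0"
    using assms x by (auto simp: zero_prod_def)
  then show ?thesis
  proof cases
    case 1 then show ?thesis using equiv_refl[of x] x by blast
  next
    case 2 then show ?thesis using rot1 unfolding x E_tuple by blast
  next
    case 3 then show ?thesis using rot2 unfolding x E_tuple by blast
  next
    case 4 then show ?thesis using *[of a0 a1 a2] equiv_refl[of x] x by blast
  next
    case 5 then show ?thesis using *[of a1 a2 a0] rot1 unfolding x E_tuple by blast
  next
    case 6 then show ?thesis using *[of a2 a0 a1] rot2 unfolding x E_tuple by blast
  qed
qed

lemma equiv_block:
  fixes x :: "'a::compalg jordan"
  assumes "x \<noteq> 0" shows "\<exists>r0 r1 r2 a0. x \<simeq> (r0, r1, r2, a0, 0, 0) \<and> r0 \<noteq> 0"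
proof -
  obtain r0 r1 r2 a0 a1 a2 where x: "x \<simeq> (r0, r1, r2, a0, a1, a2)" and r0: "r0 \<noteq> 0"
    using equiv_nonzero_corner[OF assms] by blast
  \<comment> \<open>With pivot \<open>r0\<close>, \<open>E10\<close> clears \<open>a2\<close> and
    leaves \<open>a1\<close> alone; then \<open>E20\<close> clears \<open>a1\<close>, and its
    contribution to \<open>a0\<close> vanishes because \<open>a2\<close> is already zero.\<close>
  have "x \<simeq> E20 (- (inverse r0 *c a1)) (E10 (- (inverse r0 *c a2)) (r0, r1, r2, a0, a1, a2))"
    by (meson x equiv_E(2) equiv_E'(2) equiv_trans)
  then show ?thesis
    using r0 by (auto simp: scl_minus_right scl_scl)
qed

text \<open>The same elimination in the remaining 2 x 2 block, with pivot \<open>r1\<close> or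
  \<open>r2\<close>; if both vanish and \<open>a0\<close> does not, \<open>E12\<close> first
  produces a pivot in the place of \<open>r1\<close>.\<close>

lemma equiv_diag:
  fixes x :: "'a::compalg jordan"
  assumes "x \<noteq> 0" shows "\<exists>r0 r1 r2. x \<simeq> (r0, r1, r2, 0, 0, 0) \<and> r0 \<noteq> 0"
proof -
  obtain r0 r1 r2 a0 where x: "x \<simeq> (r0, r1, r2, a0, 0, 0)" and r0: "r0 \<noteq> 0"
    using equiv_block[OF assms] by blast
  have *: ?thesis if "x \<simeq> (r0, s1, s2, c0, 0, 0)" "s1 \<noteq> 0" for s1 s2 c0
  proof -
    from equiv_trans[OF that(1) equiv_E'(3)[of _ "- (inverse s1 *c c0)"]] that(2) r0
    show ?thesis by (auto simp: scl_minus_right scl_scl)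
  qed
  consider "r1 \<noteq> 0" | "r2 \<noteq> 0" | "r1 = 0" "r2 = 0" "a0 = 0" | "r1 = 0" "r2 = 0" "a0 \<noteq> 0"
    by blast
  then show ?thesis
  proof cases
    case 1 then show ?thesis using * x by blast
  next
    case 2
    from equiv_trans[OF x equiv_E'(1)[of _ "- (inverse r2 *c a0)"]] 2 r0
    show ?thesis by (auto simp: scl_minus_right scl_scl)
  next
    case 3 then show ?thesis using x r0 by auto
  next
    case 4
    obtain u where "dot u a0 \<noteq> 0" using 4(3) dot_nondegenerate[of a0] by auto
    then have "2 * dot u a0 \<noteq> 0" by simp
    moreover have "x \<simeq> (r0, 2 * dot u a0, 0, a0, 0, 0)"
      using equiv_trans[OF x equiv_E'(1)[of _ u]] 4 by simp
    ultimately show ?thesis by (intro *)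
  qed
qed

lemma rk1_equiv:
  assumes "rk1 x" shows "\<exists>c. c \<noteq> 0 \<and> x \<simeq> (c, 0, 0, 0, 0, 0)"
proof -
  obtain r0 r1 r2 where *: "x \<simeq> (r0, r1, r2, 0, 0, 0)" "r0 \<noteq> 0"
    using equiv_diag[of x] assms unfolding rk1_def by blast
  moreover have "rk1 (r0, r1, r2, 0, 0, 0 :: 'a)" using assms * equiv_rk1 by blast
  ultimately show ?thesis by (auto simp: rk1_def zero_prod_def)
qed

lemma csqrt_inverse_power2: "c \<noteq> 0 \<Longrightarrow> (inverse (csqrt c))\<^sup>2 * c = 1"
  by (simp add: power_inverse)

text \<open>The torus rescales the diagonal subject to one condition on the product of its
  parameters. Below full rank a parameter belonging to a zero entry absorbs this condition; in full
  rank the invariant \<open>Nrm\<close> remains, whence the constant \<open>c\<close>.\<close>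

lemma equiv_normal_form:
  fixes y :: "'a::compalg jordan"
  assumes "y \<noteq> 0"
  shows "(\<exists>c. c \<noteq> 0 \<and> y \<simeq> (c, c, c, 0, 0, 0)) \<or> y \<simeq> (1, 1, 0, 0, 0, 0) \<or> y \<simeq> (1, 0, 0, 0, 0, 0)"
proof -
  obtain r0 r1 r2 where y: "y \<simeq> (r0, r1, r2, 0, 0, 0)" and r0: "r0 \<noteq> 0"
    using equiv_diag[OF assms] by blast
  let ?i = "\<lambda>c. inverse (csqrt c)"
  have two: "y \<simeq> (1, 1, 0, 0, 0, 0)" if s: "y \<simeq> (s0, s1, 0, 0, 0, 0)" "s0 \<noteq> 0" "s1 \<noteq> 0" for s0 s1
  proof -
    have "(?i s0 * ?i s1 * (csqrt s0 * csqrt s1))\<^sup>2 = 1"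
      using s by (simp add: field_simps)
    from equiv_trans[OF s(1) equiv_tor[OF this]] show ?thesis
      using s by (simp add: csqrt_inverse_power2)
  qed
  consider "r1 = 0" "r2 = 0" | "r1 \<noteq> 0" "r2 = 0" | "r1 = 0" "r2 \<noteq> 0" | "r1 \<noteq> 0" "r2 \<noteq> 0" by blast
  then show ?thesis
  proof cases
    case 1
    \<comment> \<open>The second parameter acts on a zero entry and serves only to make the product
      1.\<close>
    have "(?i r0 * csqrt r0 * 1)\<^sup>2 = 1" using r0 by simp
    from equiv_trans[OF y equiv_tor[OF this]] show ?thesis
      using 1 r0 by (simp add: csqrt_inverse_power2)
  next
    case 2 then show ?thesis using two y r0 by blast
  next
    case 3
    have "y \<simeq> rot (rot (r0, r1, r2, 0, 0, 0))" by (meson y equiv_E(3) equiv_trans)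
    then show ?thesis using 3 two r0 by auto
  next
    case 4
    \<comment> \<open>All entries are to become equal to some \<open>c\<close>, and invariance of
      \<open>Nrm\<close> forces \<open>c ^ 3 = P\<close>. A cube root is taken in polar
      form.\<close>
    define P where "P = r0 * r1 * r2"
    have "P \<noteq> 0" using r0 4 by (simp add: P_def)
    obtain r a where ra: "P = rcis r a" using rcis_Ex by blast
    obtain c where c: "c ^ 3 = P"
    proof
      show "rcis (root 3 r) (a / 3) ^ 3 = P" by (simp add: DeMoivre2 odd_real_root_pow ra)
    qed
    have c0: "c \<noteq> 0" using c \<open>P \<noteq> 0\<close> by auto
    \<comment> \<open>The torus multiplies an entry \<open>r\<close> by the square of its parameter,
      which turns \<open>r\<close> into \<open>c\<close>.\<close>
    define t where "t r = csqrt (c / r)" for r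
    have t: "(t r)\<^sup>2 = c / r" for r by (simp add: t_def)
    have "(t r0 * t r1 * t r2)\<^sup>2 = c ^ 3 / P"
      by (simp add: power_mult_distrib t P_def power3_eq_cube)
    then have "(t r0 * t r1 * t r2)\<^sup>2 = 1" using c \<open>P \<noteq> 0\<close> by simp
    from equiv_trans[OF y equiv_tor[OF this]] show ?thesis
      using r0 4 c0 by (auto simp: t)
  qed
qed

section \<open>Polynomial maps\<close>

lemma poly_funs_sum:
  "(\<And>i. i \<in> I \<Longrightarrow> f i \<in> poly_funs C) \<Longrightarrow> (\<lambda>x. \<Sum>i\<in>I. f i x) \<in> poly_funs C"
  by (induction I rule: infinite_finite_induct) (auto intro: poly_funs.intros)

lemma poly_funs_diff:
  assumes "p \<in> poly_funs C" "q \<in> poly_funs C" shows "(\<lambda>x. p x - q x) \<in> poly_funs C"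
  using poly_funs.add[OF assms(1) poly_funs.mult[OF poly_funs.const[of "-1"] assms(2)]] by simp

lemma poly_funs_coord: "i < n \<Longrightarrow> (\<lambda>z. z $ i) \<in> poly_funs (vec_coords n)"
  by (rule poly_funs.coord) (auto simp: vec_coords_def)

lemma poly_funs_mat_coord:
  "i < n \<Longrightarrow> j < n \<Longrightarrow> (\<lambda>g. g $$ (i, j)) \<in> poly_funs (mat_coords n)"
  by (rule poly_funs.coord) (auto simp: mat_coords_def)

lemma poly_funs_subst:
  assumes "p \<in> poly_funs (vec_coords n)" "\<And>i. i < n \<Longrightarrow> F i \<in> poly_funs C"
  shows "(\<lambda>s. p (vec n (\<lambda>i. F i s))) \<in> poly_funs C"
  using assms(1)
proof induction
  case (coord f)
  then obtain i where "i < n" "f = (\<lambda>x. x $ i)" by (auto simp: vec_coords_def)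
  then show ?case using assms(2)[of i] by simp
qed (auto intro: poly_funs.intros)

text \<open>Passing to formal polynomials makes available that they form an integral domain and are
  determined by their values.\<close>

lemma poly_funs_id_poly:
  assumes "p \<in> poly_funs {\<lambda>t::complex. t}" shows "\<exists>P. \<forall>t. p t = poly P t"
  using assms
proof induction
  case (const c) show ?case by (rule exI[of _ "pCons c 0"]) simp
next
  case (coord f) then show ?case by (intro exI[of _ "pCons 0 (pCons 1 0)"]) simp
next
  case (add p q) then show ?case by (metis poly_add)
next
  case (mult p q) then show ?case by (metis poly_mult)
qed

text \<open>Maps into a vector space whose coordinates lie in \<open>poly_funs C\<close>, without choosing a basis.\<close>

inductive polymap :: "('s \<Rightarrow> complex) set \<Rightarrow> ('s \<Rightarrow> 'v::cspace) \<Rightarrow> bool"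
  for C :: "('s \<Rightarrow> complex) set" where
  const: "polymap C (\<lambda>_. x)"
| add: "polymap C f \<Longrightarrow> polymap C g \<Longrightarrow> polymap C (\<lambda>s. f s + g s)"
| scl: "r \<in> poly_funs C \<Longrightarrow> polymap C f \<Longrightarrow> polymap C (\<lambda>s. r s *c f s)"

lemma polymap_lin:
  assumes "polymap C f" "lin L" shows "polymap C (\<lambda>s. L (f s))"
  using assms(1) by induction (simp_all add: lin_add[OF assms(2)] lin_scl[OF assms(2)] polymap.intros)

lemma polymap_bilin:
  assumes "polymap C f" "polymap C g" "\<And>y. lin (\<lambda>x. B x y)" "\<And>x. lin (B x)"
  shows "polymap C (\<lambda>s. B (f s) (g s))"
  using assms(1)
  by induction
    (simp_all add: lin_add[OF assms(3)] lin_scl[OF assms(3)] polymap.intros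
      polymap_lin[OF assms(2,4)])

lemma polymap_sum:
  "(\<And>i. i \<in> I \<Longrightarrow> polymap C (f i)) \<Longrightarrow> polymap C (\<lambda>s. \<Sum>i\<in>I. f i s)"
  by (induction I rule: infinite_finite_induct) (auto intro: polymap.intros)

lemma polymap_complex: "polymap C (f :: _ \<Rightarrow> complex) \<longleftrightarrow> f \<in> poly_funs C"
proof
  show "polymap C f \<Longrightarrow> f \<in> poly_funs C"
    by (induction rule: polymap.induct) (auto intro: poly_funs.intros)
  show "polymap C f" if "f \<in> poly_funs C"
    using polymap.scl[OF that polymap.const[of C "1::complex"]] by simp
qed

lemma polymap_Pair:
  assumes "polymap C f" "polymap C g" shows "polymap C (\<lambda>s. (f s, g s))"
proof -
  have "polymap C (\<lambda>s. (f s, 0) + (0, g s))"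
    by (intro polymap.add polymap_lin[OF assms(1)] polymap_lin[OF assms(2)] linI)
      (simp_all add: prod_eq_iff)
  then show ?thesis by simp
qed

lemma polymap_cong_scl:
  "polymap C r \<Longrightarrow> polymap C f \<Longrightarrow> polymap C (\<lambda>s. (r s :: complex) *c f s)"
  by (simp add: polymap_complex polymap.scl)

lemma lin_dot: "lin (dot y)" and lin_dot': "lin (\<lambda>x. dot x y)"
  by (simp_all add: linI dot_simps)

lemma lin_star: "lin (\<lambda>x. x \<star> y)" "lin (\<lambda>x. y \<star> x)"
  by (simp_all add: linI star_simps)

lemma lin_pr: "lin (pr y)" "lin (\<lambda>x. pr x y)"
  by (simp_all add: linI pr_add_right pr_scl_right pr_commute[of _ y])

lemma lin_cross: "lin (cross x)" "lin (\<lambda>v. cross v x)"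
  by (simp_all add: linI cross_add_right cross_scl_right cross_commute[of _ x])

lemma polymap_cross:
  "polymap C f \<Longrightarrow> polymap C g \<Longrightarrow> polymap C (\<lambda>s. cross (f s) (g s))"
  by (rule polymap_bilin[OF _ _ lin_cross(2,1)])

lemma polymap_pr: "polymap C f \<Longrightarrow> polymap C g \<Longrightarrow> polymap C (\<lambda>s. pr (f s) (g s))"
  by (rule polymap_bilin[OF _ _ lin_pr(2,1)])

lemma cross_self: "cross x x = 2 *c sharp x"
proof -
  have "x + x = 2 *c x" using scl_add_left[of 1 1 x] by simp
  then have "cross x x = 4 *c sharp x - 1 *c sharp x - 1 *c sharp x"
    by (simp add: cross_def sharp_scl)
  then show ?thesis by (simp only: scl_diff_left[symmetric]) simp
qed

lemma sharp_cross: "sharp x = (1 / 2) *c cross x x"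
  by (simp add: cross_self scl_scl)

text \<open>Euler's identity for a cubic form, read off from the expansion of
  \<open>Nrm (x + x)\<close>. With \<open>sharp\<close> written through the bilinear
  \<open>cross\<close>, it shows that \<open>Nrm\<close> is polynomial without expanding
  coordinates.\<close>

lemma Nrm_pr_sharp: "Nrm x = (1 / 3) * pr (sharp x) x"
proof -
  have "x + x = 2 *c x" using scl_add_left[of 1 1 x] by simp
  then have "8 * Nrm x = 2 * Nrm x + 2 * pr (sharp x) x"
    using Nrm_add[of x x] Nrm_scl[of 2 x] by simp
  then show ?thesis by (simp add: field_simps)
qed

lemma polymap_sharp: "polymap C f \<Longrightarrow> polymap C (\<lambda>s. sharp (f s))"
  unfolding sharp_cross by (intro polymap.scl poly_funs.const polymap_cross)

lemma poly_funs_Nrm: "polymap C f \<Longrightarrow> (\<lambda>s. Nrm (f s)) \<in> poly_funs C"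
  unfolding Nrm_pr_sharp
  by (intro poly_funs.mult poly_funs.const polymap_complex[THEN iffD1] polymap_pr polymap_sharp)

lemma poly_funs_pr: "polymap C f \<Longrightarrow> (\<lambda>s. pr y (f s)) \<in> poly_funs C"
  by (intro polymap_complex[THEN iffD1] polymap_pr polymap.const)

context coordspace
begin

lemma coords_index: "i < cdim TYPE('a) \<Longrightarrow> coords x $ i = dot (bas i) x"
  by (simp add: dot_bas)

text \<open>The inverse of \<open>coords\<close>, written as an explicit sum so that it is a
  polynomial map by construction.\<close>

definition uncoords :: "complex vec \<Rightarrow> 'a" where
  "uncoords z = (\<Sum>i<cdim TYPE('a). z $ i *c bas i)"

end

lemma coords_uncoords:
  assumes "z \<in> carrier_vec (cdim TYPE('a))" shows "coords (uncoords z :: 'a::coordspace) = z"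
proof -
  have "coords (uncoords z :: 'a) $ j = z $ j" if j: "j < cdim TYPE('a)" for j
  proof -
    have "coords (uncoords z :: 'a) $ j = (\<Sum>i<cdim TYPE('a). z $ i * dot (bas j) (bas i :: 'a))"
      by (simp only: coords_index[OF j] uncoords_def lin_sum[OF lin_dot] dot_scl_right)
    also have "\<dots> = (\<Sum>i<cdim TYPE('a). if i = j then z $ i else 0)"
      by (rule sum.cong[OF refl]) (use j in \<open>auto simp: dot_bas\<close>)
    finally show ?thesis using j by simp
  qed
  then show ?thesis using assms by (auto simp: vec_eq_iff)
qed

lemma uncoords_coords [simp]: "uncoords (coords x) = (x :: 'a::coordspace)"
  by (rule coords_inj) (simp add: coords_uncoords)

lemma lin_coords_index: "i < cdim TYPE('a) \<Longrightarrow> lin (\<lambda>x::'a::coordspace. coords x $ i)"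
  by (simp add: linI coords_add coords_scl)

lemma coords_expand: "(x::'a::coordspace) = (\<Sum>i<cdim TYPE('a). coords x $ i *c bas i)"
  by (metis uncoords_coords uncoords_def)

lemma polymap_uncoords:
  assumes "\<And>i. i < cdim TYPE('a) \<Longrightarrow> (\<lambda>s. F s $ i) \<in> poly_funs C"
  shows "polymap C (\<lambda>s. uncoords (F s) :: 'a::coordspace)"
  unfolding uncoords_def using assms by (intro polymap_sum polymap.intros) simp

lemma polymap_uncoords_id: "polymap (vec_coords (cdim TYPE('a))) (uncoords :: _ \<Rightarrow> 'a::coordspace)"
  by (intro polymap_uncoords poly_funs_coord)

lemma poly_funs_coords:
  "polymap C (f :: _ \<Rightarrow> 'a::coordspace) \<Longrightarrow> i < cdim TYPE('a) \<Longrightarrow> (\<lambda>s. coords (f s) $ i) \<in> poly_funs C"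
  using polymap_lin[OF _ lin_coords_index] polymap_complex by blast


section \<open>Matrices of linear maps\<close>

definition matf :: "('a::coordspace \<Rightarrow> 'b::coordspace) \<Rightarrow> complex mat" where
  "matf f = mat (cdim TYPE('b)) (cdim TYPE('a)) (\<lambda>(i, j). coords (f (bas j)) $ i)"

lemma matf_carrier [simp]:
  "matf (f :: 'a::coordspace \<Rightarrow> 'b::coordspace) \<in> carrier_mat (cdim TYPE('b)) (cdim TYPE('a))"
  by (simp add: matf_def)

lemma matf_coords:
  fixes f :: "'a::coordspace \<Rightarrow> 'b::coordspace"
  assumes "lin f" shows "matf f *\<^sub>v coords x = coords (f x)"
proof -
  have "(matf f *\<^sub>v coords x) $ i = coords (f x) $ i" if i: "i < cdim TYPE('b)" for i
  proof -
    have l: "lin (\<lambda>x. coords (f x) $ i)" by (rule lin_comp[OF lin_coords_index[OF i] assms])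
    have "coords (f x) $ i = coords (f (\<Sum>j<cdim TYPE('a). coords x $ j *c bas j)) $ i"
      by (simp only: coords_expand[symmetric])
    also have "\<dots> = (\<Sum>j<cdim TYPE('a). coords x $ j * coords (f (bas j)) $ i)"
      using lin_sum[OF l, of "\<lambda>j. coords x $ j *c bas j" "{..<cdim TYPE('a)}"]
      by (simp add: lin_scl[OF l])
    also have "\<dots> = (matf f *\<^sub>v coords x) $ i"
      using i by (simp add: matf_def scalar_prod_def lessThan_atLeast0 mult.commute)
    finally show ?thesis ..
  qed
  then show ?thesis by (auto simp: vec_eq_iff matf_def)
qed

lemma mat_eq_by_vec:
  fixes A B :: "'x::semiring_1 mat"
  assumes "A \<in> carrier_mat n m" "B \<in> carrier_mat n m"
    and "\<And>v. v \<in> carrier_vec m \<Longrightarrow> A *\<^sub>v v = B *\<^sub>v v"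
  shows "A = B"
proof (rule eq_matI)
  fix i j assume ij: "i < dim_row B" "j < dim_col B"
  have "(A *\<^sub>v unit_vec m j) $ i = (B *\<^sub>v unit_vec m j) $ i" using assms(3) by simp
  then show "A $$ (i, j) = B $$ (i, j)" using ij assms(1,2) by simp
qed (use assms in auto)

lemma matf_comp:
  fixes f :: "'b::coordspace \<Rightarrow> 'c::coordspace" and g :: "'a::coordspace \<Rightarrow> 'b"
  assumes "lin f" "lin g" shows "matf f * matf g = matf (\<lambda>x. f (g x))"
proof (rule mat_eq_by_vec)
  show "matf f * matf g \<in> carrier_mat (cdim TYPE('c)) (cdim TYPE('a))"
    by (rule mult_carrier_mat[OF matf_carrier matf_carrier])
  fix v :: "complex vec" assume "v \<in> carrier_vec (cdim TYPE('a))"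
  then obtain x :: 'a where v: "v = coords x" using coords_surj by metis
  show "matf f * matf g *\<^sub>v v = matf (\<lambda>x. f (g x)) *\<^sub>v v"
    by (simp add: v matf_coords assms lin_comp[OF assms]
        assoc_mult_mat_vec[OF matf_carrier matf_carrier coords_carrier])
qed simp

lemma matf_id: "matf (\<lambda>x::'a::coordspace. x) = 1\<^sub>m (cdim TYPE('a))"
  by (rule eq_matI) (auto simp: matf_def unit_vec_def)

lemma matf_inverse:
  fixes f :: "'a::coordspace \<Rightarrow> 'b::coordspace"
  assumes "lin f" "lin g" "\<And>x. f (g x) = x"
  shows "matf f * matf g = 1\<^sub>m (cdim TYPE('b))"
  using matf_comp[OF assms(1,2)] by (simp add: assms(3) matf_id)

lemma matf_invertible:
  fixes f g :: "'a::coordspace \<Rightarrow> 'a"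
  assumes "lin f" "lin g" "\<And>x. f (g x) = x" "\<And>x. g (f x) = x"
  shows "invertible_mat (matf f)"
  using matf_inverse[OF assms(1-3)] matf_inverse[OF assms(2,1,4)] matf_carrier[of f] matf_carrier[of g]
  by (auto simp: invertible_mat_def inverts_mat_def matf_def intro!: exI[of _ "matf g"])

lemma lin_of_mat:
  assumes "g \<in> carrier_mat (cdim TYPE('a)) (cdim TYPE('a))"
  shows "lin (\<lambda>x::'a::coordspace. uncoords (g *\<^sub>v coords x) :: 'a)"
proof (rule linI)
  have c: "g *\<^sub>v coords x \<in> carrier_vec (cdim TYPE('a))" for x :: 'a using assms by auto
  show "uncoords (g *\<^sub>v coords (x + y)) = (uncoords (g *\<^sub>v coords x) + uncoords (g *\<^sub>v coords y) :: 'a)" for x y :: 'a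
    by (rule coords_inj)
      (simp add: coords_uncoords c coords_add mult_add_distrib_mat_vec[OF assms coords_carrier coords_carrier])
  show "uncoords (g *\<^sub>v coords (a *c x)) = (a *c uncoords (g *\<^sub>v coords x) :: 'a)" for a and x :: 'a
    by (rule coords_inj)
      (simp add: coords_uncoords c coords_scl mult_mat_vec[OF assms coords_carrier])
qed

section \<open>The Severi variety as the set of rank one elements\<close>

lemma cdim_jordan: "cdim TYPE('a::cdalg jordan) = 3 * 2 ^ level TYPE('a) + 3"
  by (simp add: cdim_prod_def cdim_complex_def cdim_level)

lemma jordan_det_coords:
  fixes x :: "'a::compalg jordan"
  shows "jordan_det (level TYPE('a)) (coords x) = Nrm x"
proof -
  obtain r0 r1 r2 and a0 a1 a2 :: 'a where x: "x = (r0, r1, r2, a0, a1, a2)" by (cases x)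
  let ?k = "level TYPE('a)"
  have [simp]: "dim_vec (coords v) = 2 ^ ?k" for v :: 'a by (simp add: cdim_level)
  have [simp]: "dim_vec (coords (c::complex)) = 1" "coords c $ 0 = c" for c
    by (simp_all add: cdim_complex_def coords_complex_def)
  have r: "coords x $ 0 = r0" "coords x $ Suc 0 = r1" "coords x $ 2 = r2"
    by (simp_all add: x coords_Pair cdim_complex_def cdim_level)
  have o: "off_diag ?k (coords x) 0 = coords a0" "off_diag ?k (coords x) (Suc 0) = coords a1"
    "off_diag ?k (coords x) 2 = coords a2"
    by (auto simp: vec_eq_iff off_diag_def x coords_Pair cdim_complex_def cdim_level)
  have n: "cd_norm ?k (coords v) = dot v v" for v :: 'a
    by (simp add: cd_norm_def coords_bar[symmetric] coords_mul[symmetric] re_def[symmetric] re_mul_bar)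
  have t: "cd_trace ?k (coords v) = 2 * re v" for v :: 'a
    using re_add[of v "bar v"]
    by (simp add: cd_trace_def coords_bar[symmetric] coords_add[symmetric] re_def[symmetric])
  have "{..<3::nat} = {0, Suc 0, 2}" by auto
  then show ?thesis
    by (simp add: jordan_det_def r[unfolded x] o[unfolded x] n t coords_mul[symmetric] dot_star x)
qed

lemma matf_SL3:
  fixes f :: "'a::compalg jordan \<Rightarrow> 'a jordan"
  assumes "f \<in> GJ" shows "matf f \<in> SL3_group (level TYPE('a))"
proof -
  obtain g where g: "g \<in> GJ" "\<And>x. g (f x) = x" "\<And>x. f (g x) = x"
    using assms by (metis GJ_inverse)
  have "jordan_det (level TYPE('a)) (matf f *\<^sub>v v) = jordan_det (level TYPE('a)) v"
    if v: "v \<in> carrier_vec (3 * 2 ^ level TYPE('a) + 3)" for v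
  proof -
    obtain x :: "'a jordan" where "v = coords x"
      using coords_surj[of v, where 'a="'a jordan"] v by (auto simp: cdim_jordan)
    then show ?thesis
      by (simp add: matf_coords GJ_lin[OF assms] jordan_det_coords GJ_Nrm[OF assms])
  qed
  moreover have "invertible_mat (matf f)"
    by (rule matf_invertible[OF GJ_lin[OF assms] GJ_lin[OF g(1)] g(3,2)])
  ultimately show ?thesis
    using matf_carrier[of f] by (simp add: SL3_group_def cdim_jordan)
qed

lemma SL3_GJ:
  assumes "g \<in> SL3_group (level TYPE('a::compalg))"
  obtains f :: "'a::compalg jordan \<Rightarrow> 'a jordan" where "f \<in> GJ" "g = matf f"
proof -
  let ?k = "level TYPE('a)" and ?n = "cdim TYPE('a jordan)"
  define f :: "'a jordan \<Rightarrow> 'a jordan" where "f = (\<lambda>x. uncoords (g *\<^sub>v coords x))"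
  have g: "g \<in> carrier_mat ?n ?n" "invertible_mat g"
    and d: "\<And>v. v \<in> carrier_vec ?n \<Longrightarrow> jordan_det ?k (g *\<^sub>v v) = jordan_det ?k v"
    using assms by (auto simp: SL3_group_def cdim_jordan)
  obtain h where h: "g * h = 1\<^sub>m ?n" "h * g = 1\<^sub>m (dim_row h)"
    using g by (auto simp: invertible_mat_def inverts_mat_def)
  have "dim_col h = ?n" using arg_cong[OF h(1), of dim_col] by simp
  moreover have "dim_row h = ?n" using arg_cong[OF h(2), of dim_col] g(1) by simp
  ultimately have hc: "h \<in> carrier_mat ?n ?n" by auto
  have lf: "lin f" unfolding f_def by (rule lin_of_mat[OF g(1)])
  have f: "coords (f x) = g *\<^sub>v coords x" for x
    using g(1) coords_uncoords[of "g *\<^sub>v coords x", where 'a="'a jordan"] by (simp add: f_def)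
  let ?h = "\<lambda>x. uncoords (h *\<^sub>v coords x) :: 'a jordan"
  have hh: "coords (?h x) = h *\<^sub>v coords x" for x :: "'a jordan"
    using hc coords_uncoords[of "h *\<^sub>v coords x", where 'a="'a jordan"] by simp
  have "f (?h x) = x" for x
    using h(1) assoc_mult_mat_vec[OF g(1) hc coords_carrier[of x]]
    by (intro coords_inj) (simp add: f hh)
  moreover have "?h (f x) = x" for x
    using h(2) hc assoc_mult_mat_vec[OF hc g(1) coords_carrier[of x]]
    by (intro coords_inj) (simp add: f hh)
  moreover have "Nrm (f x) = Nrm x" for x
    using d[OF coords_carrier[of x]] by (simp only: f[symmetric] jordan_det_coords)
  ultimately have "f \<in> GJ" using lf by (intro GJI)
  moreover have "g = matf f"
  proof (rule mat_eq_by_vec[OF g(1) matf_carrier])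
    fix v :: "complex vec" assume "v \<in> carrier_vec ?n"
    then obtain x :: "'a jordan" where "v = coords x" using coords_surj by metis
    then show "g *\<^sub>v v = matf f *\<^sub>v v" by (simp add: f matf_coords lf)
  qed
  ultimately show ?thesis using that by blast
qed

abbreviation e0 :: "'a::compalg jordan" where "e0 \<equiv> (1, 0, 0, 0, 0, 0)"

lemma rk1_e0: "rk1 e0"
  by (simp add: rk1_def zero_prod_def)

lemma coords_e0: "coords (e0 :: 'a::compalg jordan) = unit_vec (cdim TYPE('a jordan)) 0"
proof -
  have "(e0 :: 'a jordan) = bas 0"
  proof (rule dot_eqI)
    fix z :: "'a jordan"
    have "0 < cdim TYPE('a jordan)" by (simp add: cdim_jordan)
    then have "dot (bas 0) z = coords z $ 0" by (rule dot_bas)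
    also have "\<dots> = dot e0 z"
      by (cases z) (simp add: coords_Pair cdim_complex_def coords_complex_def)
    finally show "dot e0 z = dot (bas 0) z" ..
  qed
  then show ?thesis by simp
qed

text \<open>Rank one is invariant, which gives one inclusion; elimination brings each rank one
  element to a multiple of \<open>e0\<close>, which gives the other. The orbit is thereby replaced
  by quadratic equations.\<close>

lemma severi_eq: "severi (level TYPE('a::compalg)) = coords ` {x :: 'a jordan. rk1 x}"
proof (intro equalityI subsetI)
  fix v assume "v \<in> severi (level TYPE('a))"
  then obtain c g where v: "v = c \<cdot>\<^sub>v (g *\<^sub>v coords (e0 :: 'a jordan))" and "c \<noteq> 0"
    and g: "g \<in> SL3_group (level TYPE('a))"
    by (auto simp: severi_def coords_e0 cdim_jordan)
  obtain f :: "'a jordan \<Rightarrow> 'a jordan" where f: "f \<in> GJ" "g = matf f" using SL3_GJ[OF g] by metis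
  have "v = coords (c *c f e0)" by (simp add: v f matf_coords GJ_lin coords_scl)
  moreover have "rk1 (c *c f e0)" using \<open>c \<noteq> 0\<close> by (simp add: rk1_scl GJ_rk1[OF f(1)] rk1_e0)
  ultimately show "v \<in> coords ` {x :: 'a jordan. rk1 x}" by blast
next
  fix v assume "v \<in> coords ` {x :: 'a jordan. rk1 x}"
  then obtain x :: "'a jordan" where v: "v = coords x" and x: "rk1 x" by blast
  obtain c where c: "c \<noteq> 0" "x \<simeq> (c, 0, 0, 0, 0, 0)" using rk1_equiv[OF x] by metis
  then obtain f where f: "f \<in> GJ" "f (c, 0, 0, 0, 0, 0) = x"
    using equiv_GJ[OF equiv_sym[OF c(2)]] by blast
  have "x = c *c f e0" using f lin_scl[OF GJ_lin[OF f(1)], of c e0] by simp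
  then have "v = c \<cdot>\<^sub>v (matf f *\<^sub>v unit_vec (3 * 2 ^ level TYPE('a) + 3) 0)"
    using f(1)
    by (simp add: v coords_scl matf_coords GJ_lin coords_e0[where 'a='a, symmetric, unfolded cdim_jordan])
  then show "v \<in> severi (level TYPE('a))"
    unfolding severi_def using c(1) matf_SL3[OF f(1)] by blast
qed

section \<open>Tangent spaces and singular loci\<close>

text \<open>The coordinate vector of the form \<open>pr y\<close>. Hyperplanes are defined by the
  standard bilinear form, so the factor 2 of \<open>pr\<close> moves into the vector.\<close>

definition hf :: "'a::compalg jordan \<Rightarrow> complex vec" where
  "hf = (\<lambda>(s0, s1, s2, c0, c1, c2). coords (s0, s1, s2, 2 *c c0, 2 *c c1, 2 *c c2))"

lemma hf_carrier [simp]: "hf (y :: 'a::compalg jordan) \<in> carrier_vec (cdim TYPE('a jordan))"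
  by (simp add: hf_def split: prod.split)

lemma hf_coords: "hf y \<bullet> coords x = pr y x"
  by (cases y; cases x) (simp add: hf_def dot_def[symmetric] dot_simps algebra_simps)

lemma hf_surj:
  assumes "h \<in> carrier_vec (cdim TYPE('a::compalg jordan))"
  shows "\<exists>y :: 'a jordan. hf y = h"
proof -
  obtain x :: "'a jordan" where x: "coords x = h" using coords_surj[OF assms] by blast
  obtain s0 s1 s2 c0 c1 c2 where "x = (s0, s1, s2, c0, c1, c2)" by (cases x)
  then have "hf (s0, s1, s2, (1/2) *c c0, (1/2) *c c1, (1/2) *c c2) = h"
    using x by (simp add: hf_def scl_scl)
  then show ?thesis by blast
qed

lemma hf_eq_0_iff: "hf (y :: 'a::compalg jordan) = 0\<^sub>v (cdim TYPE('a jordan)) \<longleftrightarrow> y = 0"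
  by (cases y) (auto simp: hf_def coords_eq_0_iff zero_prod_def)

lemma hyperplane_section_eq:
  fixes y :: "'a::compalg jordan"
  shows "hyperplane_section (severi (level TYPE('a))) (hf y) = coords ` {x. rk1 x \<and> pr y x = 0}"
  by (auto simp: hyperplane_section_def severi_eq hf_coords)

lemma dir_derivI: "((\<lambda>t. p (x + t \<cdot>\<^sub>v v)) has_field_derivative D) (at 0) \<Longrightarrow> dir_deriv p x v = D"
  unfolding dir_deriv_def by (rule the_equality) (auto intro: DERIV_unique)

lemma coords_line: "coords x + t \<cdot>\<^sub>v coords v = coords (x + t *c v)"
  by (simp add: coords_add coords_scl)

lemma dir_deriv_coordsI:
  "((\<lambda>t. p (coords (x + t *c v))) has_field_derivative D) (at 0) \<Longrightarrow>
   dir_deriv p (coords x) (coords v) = D"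
  by (rule dir_derivI) (simp only: coords_line)

text \<open>The quadratic term does not affect the derivative at 0. The elementary maps move a point
  along parabolas, so tangent vectors can be read off from them; existence of the derivative also
  gives \<open>THE\<close> in \<open>dir_deriv\<close> its meaning.\<close>

lemma poly_funs_deriv:
  fixes x v w :: "'a::coordspace"
  assumes "p \<in> poly_funs (vec_coords (cdim TYPE('a)))"
  shows "\<exists>D. ((\<lambda>t. p (coords (x + t *c v))) has_field_derivative D) (at 0) \<and>
    ((\<lambda>t. p (coords (x + t *c v + t\<^sup>2 *c w))) has_field_derivative D) (at 0)"
  using assms
proof induction
  case (const c)
  show ?case by (rule exI[of _ 0]) simp
next
  case (coord f)
  then obtain i where i: "i < cdim TYPE('a)" "f = (\<lambda>x. x $ i)" by (auto simp: vec_coords_def)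
  note l = lin_coords_index[OF i(1)]
  show ?case
    by (rule exI[of _ "coords v $ i"])
      (auto simp: i(2) lin_add[OF l] lin_scl[OF l] intro!: derivative_eq_intros)
next
  case (add p q)
  then obtain D E where
    D: "((\<lambda>t. p (coords (x + t *c v))) has_field_derivative D) (at 0)"
      "((\<lambda>t. p (coords (x + t *c v + t\<^sup>2 *c w))) has_field_derivative D) (at 0)"
    and E: "((\<lambda>t. q (coords (x + t *c v))) has_field_derivative E) (at 0)"
      "((\<lambda>t. q (coords (x + t *c v + t\<^sup>2 *c w))) has_field_derivative E) (at 0)" by blast
  show ?case using DERIV_add[OF D(1) E(1)] DERIV_add[OF D(2) E(2)] by blast
next
  case (mult p q)
  then obtain D E where
    D: "((\<lambda>t. p (coords (x + t *c v))) has_field_derivative D) (at 0)"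
      "((\<lambda>t. p (coords (x + t *c v + t\<^sup>2 *c w))) has_field_derivative D) (at 0)"
    and E: "((\<lambda>t. q (coords (x + t *c v))) has_field_derivative E) (at 0)"
      "((\<lambda>t. q (coords (x + t *c v + t\<^sup>2 *c w))) has_field_derivative E) (at 0)" by blast
  show ?case using DERIV_mult[OF D(1) E(1)] DERIV_mult[OF D(2) E(2)] by auto
qed

section \<open>The vanishing ideal and its tangent spaces\<close>

definition ideal :: "'a::compalg itself \<Rightarrow> (complex vec \<Rightarrow> complex) set" where
  "ideal (_ :: 'a itself) = vanishing_ideal (cdim TYPE('a jordan)) (severi (level TYPE('a)))"

lemma ideal_iff: "p \<in> ideal TYPE('a::compalg) \<longleftrightarrow>
    p \<in> poly_funs (vec_coords (cdim TYPE('a jordan))) \<and> (\<forall>x::'a jordan. rk1 x \<longrightarrow> p (coords x) = 0)"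
  unfolding ideal_def vanishing_ideal_def severi_eq by blast

lemma idealD: "p \<in> ideal TYPE('a::compalg) \<Longrightarrow> rk1 (x :: 'a jordan) \<Longrightarrow> p (coords x) = 0"
  unfolding ideal_iff by blast

lemma ideal_sharp:
  fixes u :: "'a::compalg jordan"
  shows "(\<lambda>z. pr u (sharp (uncoords z))) \<in> ideal TYPE('a)"
  unfolding ideal_iff
  by (intro conjI poly_funs_pr polymap_sharp polymap_uncoords_id) (simp add: rk1_def)

lemma poly_funs_comp:
  fixes f :: "'s \<Rightarrow> 'a::coordspace"
  assumes "p \<in> poly_funs (vec_coords (cdim TYPE('a)))" "polymap C f"
  shows "(\<lambda>z. p (coords (f z))) \<in> poly_funs C"
proof -
  have "(\<lambda>z. p (vec (cdim TYPE('a)) (\<lambda>i. coords (f z) $ i))) \<in> poly_funs C"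
    by (rule poly_funs_subst[OF assms(1)]) (rule poly_funs_coords[OF assms(2)])
  moreover have "vec (cdim TYPE('a)) (\<lambda>i. coords (f z) $ i) = coords (f z)" for z
    by (auto simp: vec_eq_iff)
  ultimately show ?thesis by simp
qed

lemma ideal_GJ:
  fixes f :: "'a::compalg jordan \<Rightarrow> 'a jordan"
  assumes "p \<in> ideal TYPE('a)" "f \<in> GJ"
  shows "(\<lambda>z. p (coords (f (uncoords z)))) \<in> ideal TYPE('a)"
proof -
  have "p \<in> poly_funs (vec_coords (cdim TYPE('a jordan)))"
    using assms(1) by (simp only: ideal_iff)
  then have "(\<lambda>z. p (coords (f (uncoords z)))) \<in> poly_funs (vec_coords (cdim TYPE('a jordan)))"
    by (rule poly_funs_comp) (rule polymap_lin[OF polymap_uncoords_id GJ_lin[OF assms(2)]])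
  moreover have "p (coords (f x)) = 0" if "rk1 x" for x
    using idealD[OF assms(1)] that GJ_rk1[OF assms(2)] by blast
  ultimately show ?thesis unfolding ideal_iff uncoords_coords by blast
qed

definition Tan :: "'a::compalg jordan \<Rightarrow> 'a jordan set" where
  "Tan x = {v. coords v \<in> tangent_space (cdim TYPE('a jordan)) (severi (level TYPE('a))) (coords x)}"

lemma Tan_iff:
  "v \<in> Tan x \<longleftrightarrow> (\<forall>p \<in> ideal TYPE('a::compalg). dir_deriv p (coords (x :: 'a jordan)) (coords v) = 0)"
  by (simp add: Tan_def tangent_space_def ideal_def)

lemma tangent_space_eq:
  fixes x :: "'a::compalg jordan"
  shows "tangent_space (cdim TYPE('a jordan)) (severi (level TYPE('a))) (coords x) = coords ` Tan x"
proof -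
  have "\<exists>w::'a jordan. v = coords w"
    if "v \<in> tangent_space (cdim TYPE('a jordan)) (severi (level TYPE('a))) (coords x)" for v
    using coords_surj[of v, where 'a="'a jordan"] that unfolding tangent_space_def by blast
  then show ?thesis unfolding Tan_def by blast
qed

text \<open>Rank one near \<open>t = 0\<close> suffices, which matters for parametrizations that hit
  the origin at some other parameter.\<close>

lemma TanI:
  fixes x v w :: "'a::compalg jordan"
  assumes "\<forall>\<^sub>F t in nhds 0. rk1 (x + t *c v + t\<^sup>2 *c w)"
  shows "v \<in> Tan x"
  unfolding Tan_iff
proof
  fix p assume p: "p \<in> ideal TYPE('a)"
  then have "p \<in> poly_funs (vec_coords (cdim TYPE('a jordan)))"
    by (simp only: ideal_iff)
  from poly_funs_deriv[OF this, of x v w] obtain D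
    where D: "((\<lambda>t. p (coords (x + t *c v))) has_field_derivative D) (at 0)"
      "((\<lambda>t. p (coords (x + t *c v + t\<^sup>2 *c w))) has_field_derivative D) (at 0)" by blast
  have "\<forall>\<^sub>F t in nhds 0. p (coords (x + t *c v + t\<^sup>2 *c w)) = 0"
    using assms by (rule eventually_mono) (rule idealD[OF p])
  then have "((\<lambda>t. 0) has_field_derivative D) (at (0::complex))"
    using D(2) DERIV_cong_ev[OF refl _ refl, of "\<lambda>t. p (coords (x + t *c v + t\<^sup>2 *c w))" "\<lambda>t. 0"]
    by simp
  then have "D = 0" using DERIV_unique DERIV_const by blast
  then show "dir_deriv p (coords x) (coords v) = 0" using dir_deriv_coordsI[of p, OF D(1)] by simp
qed

text \<open>The upper bound for the tangent space: differentiate the quadrics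
  \<open>pr u (sharp x)\<close>, for every \<open>u\<close>.\<close>

lemma Tan_cross:
  assumes "v \<in> Tan x" shows "cross x v = 0"
proof (rule pr_nondegenerate)
  fix u :: "'a jordan"
  let ?p = "\<lambda>z. pr u (sharp (uncoords z))"
  have "sharp (x + t *c v) = sharp x + t *c cross x v + t\<^sup>2 *c sharp v" for t
    by (simp add: sharp_add cross_scl_right sharp_scl)
  then have "((\<lambda>t. ?p (coords (x + t *c v))) has_field_derivative pr u (cross x v)) (at 0)"
    by (auto simp: pr_add_right pr_scl_right intro!: derivative_eq_intros)
  then have "dir_deriv ?p (coords x) (coords v) = pr u (cross x v)" by (rule dir_deriv_coordsI)
  then show "pr (cross x v) u = 0"
    using assms ideal_sharp[of u] by (simp add: Tan_iff pr_commute[of u])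
qed

lemma GJ_line: "f \<in> GJ \<Longrightarrow> f (x + t *c v) = f x + t *c f v"
  by (simp add: GJ_lin lin_add lin_scl)

lemma dir_deriv_GJ:
  assumes "f \<in> GJ"
  shows "dir_deriv (\<lambda>z. p (coords (f (uncoords z)))) (coords x) (coords v) =
    dir_deriv p (coords (f x)) (coords (f v))"
  by (simp add: dir_deriv_def coords_line GJ_line[OF assms])

lemma Tan_GJ: "f \<in> GJ \<Longrightarrow> v \<in> Tan x \<Longrightarrow> f v \<in> Tan (f x)"
  unfolding Tan_iff using dir_deriv_GJ ideal_GJ by metis

lemma Tan_GJ_iff: assumes "f \<in> GJ" shows "f v \<in> Tan (f x) \<longleftrightarrow> v \<in> Tan x"
proof -
  obtain g where "g \<in> GJ" "\<And>x. g (f x) = x" using assms by (metis GJ_inverse)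
  then show ?thesis using Tan_GJ[OF assms] Tan_GJ[of g "f v" "f x"] by metis
qed

definition sing :: "'a::compalg jordan \<Rightarrow> 'a jordan set" where
  "sing y = {x. rk1 x \<and> pr y x = 0 \<and> (\<forall>v\<in>Tan x. pr y v = 0)}"

lemma singular_locus_eq:
  fixes y :: "'a::compalg jordan"
  shows "singular_locus (cdim TYPE('a jordan)) (severi (level TYPE('a))) (hf y) = coords ` sing y"
  by (auto simp: singular_locus_def hyperplane_section_eq tangent_space_eq sing_def hf_coords)

lemma sing_dual_pair:
  assumes "dual_pair f f'" shows "x \<in> sing (f' y) \<longleftrightarrow> f x \<in> sing y"
proof -
  have f: "f \<in> GJ" "\<And>x y. pr (f' y) x = pr y (f x)" using assms by (auto simp: dual_pair_def)
  obtain g where g: "\<And>x. f (g x) = x" using f by (metis GJ_inverse)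
  have "pr y v = 0" if "\<forall>v\<in>Tan x. pr y (f v) = 0" "v \<in> Tan (f x)" for v
    using that Tan_GJ_iff[OF f(1), of "g v" x] g[of v] by metis
  then have "(\<forall>v\<in>Tan x. pr y (f v) = 0) \<longleftrightarrow> (\<forall>v\<in>Tan (f x). pr y v = 0)"
    using Tan_GJ_iff[OF f(1)] by blast
  then show ?thesis by (simp add: sing_def f GJ_rk1)
qed

lemma E_GJ: "E12 u \<in> GJ" "E20 u \<in> GJ" "E21 u \<in> GJ" "E02 u \<in> GJ"
proof -
  show "E12 u \<in> GJ" "E21 u \<in> GJ"
    unfolding E12_def[abs_def] E21_def[abs_def]
    by (rule GJ_comp[OF rot_GJ GJ_comp[OF rot_GJ GJ_comp[OF E01_GJ rot_GJ]]]
        GJ_comp[OF rot_GJ GJ_comp[OF rot_GJ GJ_comp[OF E10_GJ rot_GJ]]])+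
  show "E20 u \<in> GJ" "E02 u \<in> GJ"
    unfolding E20_def[abs_def] E02_def[abs_def]
    by (rule GJ_comp[OF rot_GJ GJ_comp[OF E01_GJ GJ_comp[OF rot_GJ rot_GJ]]]
        GJ_comp[OF rot_GJ GJ_comp[OF E10_GJ GJ_comp[OF rot_GJ rot_GJ]]])+
qed

lemma Tan_path:
  assumes "\<And>t. F t \<in> GJ" "\<And>t. F t x = x + t *c v + t\<^sup>2 *c w" "rk1 x"
  shows "v \<in> Tan x"
  using assms by (intro TanI[where w=w] always_eventually allI) (metis GJ_rk1)

text \<open>At a singular point the form kills the velocity of each of the six elementary paths. For
  a diagonal form this value is \<open>s_i\<close> times \<open>2 * dot u a_j\<close> with
  \<open>i\<close> different from \<open>j\<close>; as \<open>u\<close> is arbitrary, one of the two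
  factors vanishes.\<close>

lemma sing_diag:
  assumes "(r0, r1, r2, a0, a1, a2) \<in> sing (s0, s1, s2, 0, 0, 0)"
  shows "s0 = 0 \<or> a1 = 0" "s0 = 0 \<or> a2 = 0" "s1 = 0 \<or> a0 = 0" "s1 = 0 \<or> a2 = 0"
    "s2 = 0 \<or> a0 = 0" "s2 = 0 \<or> a1 = 0"
proof -
  let ?x = "(r0, r1, r2, a0, a1, a2)"
  have x: "rk1 ?x" and T: "\<And>v. v \<in> Tan ?x \<Longrightarrow> pr (s0, s1, s2, 0, 0, 0) v = 0"
    using assms by (auto simp: sing_def)
  have T': "pr (s0, s1, s2, 0, 0, 0) v = 0"
    if "\<And>t. F t \<in> GJ" "\<And>t. F t ?x = ?x + t *c v + t\<^sup>2 *c w" for F v w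
    using that T Tan_path[of F ?x v w] x by blast
  \<comment> \<open>The vectors passed to \<open>T'\<close> are the coefficients of \<open>t\<close>
    and of its square in the action of the elementary map with parameter
    \<open>t *c u\<close>.\<close>
  have "s0 = 0 \<or> dot u a2 = 0" "s1 = 0 \<or> dot u a2 = 0" "s1 = 0 \<or> dot u a0 = 0"
    "s2 = 0 \<or> dot u a1 = 0" "s2 = 0 \<or> dot u a0 = 0" "s0 = 0 \<or> dot u a1 = 0" for u
    using T'[of "\<lambda>t. E01 (t *c u)" "(2 * dot u a2, 0, 0, 0, u \<star> a0, r1 *c u)" "(dot u u * r1, 0, 0, 0, 0, 0)"]
      T'[of "\<lambda>t. E10 (t *c u)" "(0, 2 * dot u a2, 0, a1 \<star> u, 0, r0 *c u)" "(0, dot u u * r0, 0, 0, 0, 0)"]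
      T'[of "\<lambda>t. E12 (t *c u)" "(0, 2 * dot u a0, 0, r2 *c u, 0, u \<star> a1)" "(0, dot u u * r2, 0, 0, 0, 0)"]
      T'[of "\<lambda>t. E20 (t *c u)" "(0, 0, 2 * dot u a1, u \<star> a2, r0 *c u, 0)" "(0, 0, dot u u * r0, 0, 0, 0)"]
      T'[of "\<lambda>t. E21 (t *c u)" "(0, 0, 2 * dot u a0, r1 *c u, a2 \<star> u, 0)" "(0, 0, dot u u * r1, 0, 0, 0)"]
      T'[of "\<lambda>t. E02 (t *c u)" "(2 * dot u a1, 0, 0, 0, r2 *c u, a0 \<star> u)" "(dot u u * r2, 0, 0, 0, 0, 0)"]
    by (simp_all add: E_GJ E01_GJ E10_GJ dot_simps star_simps scl_scl power2_eq_square mult.commute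
        mult.left_commute)
  then show "s0 = 0 \<or> a1 = 0" "s0 = 0 \<or> a2 = 0" "s1 = 0 \<or> a0 = 0" "s1 = 0 \<or> a2 = 0"
    "s2 = 0 \<or> a0 = 0" "s2 = 0 \<or> a1 = 0"
    using dot_nondegenerate by metis+
qed

lemma sing_rank3: assumes "c \<noteq> 0" shows "sing (c, c, c, 0, 0, 0 :: 'a::compalg) = {}"
proof (rule equals0I)
  fix x assume x: "x \<in> sing (c, c, c, 0, 0, 0 :: 'a)"
  obtain r0 r1 r2 a0 a1 a2 where x': "x = (r0, r1, r2, a0, a1, a2)" by (cases x)
  have "a0 = 0" "a1 = 0" "a2 = 0" using sing_diag x assms unfolding x' by metis+
  moreover have "c * (r0 + r1 + r2) = 0" "sharp x = 0" "x \<noteq> 0"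
    using x by (auto simp: x' sing_def rk1_def algebra_simps)
  ultimately show False using assms by (auto simp: x' zero_prod_def)
qed

lemma sing_rank2: "sing (1, 1, 0, 0, 0, 0 :: 'a::compalg) = {(0, 0, c, 0, 0, 0) |c. c \<noteq> 0}"
proof (intro equalityI subsetI)
  fix x assume x: "x \<in> sing (1, 1, 0, 0, 0, 0 :: 'a)"
  obtain r0 r1 r2 a0 a1 a2 where x': "x = (r0, r1, r2, a0, a1, a2)" by (cases x)
  have "a0 = 0" "a1 = 0" "a2 = 0" using sing_diag x unfolding x' by (metis zero_neq_one)+
  moreover have "r0 + r1 = 0" "sharp x = 0" "x \<noteq> 0"
    using x by (auto simp: x' sing_def rk1_def)
  ultimately show "x \<in> {(0, 0, c, 0, 0, 0) |c. c \<noteq> 0}" by (auto simp: x' zero_prod_def)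
next
  fix x :: "'a jordan" assume "x \<in> {(0, 0, c, 0, 0, 0) |c. c \<noteq> 0}"
  then obtain c where c: "c \<noteq> 0" and x: "x = (0, 0, c, 0, 0, 0)" by blast
  have "pr (1, 1, 0, 0, 0, 0) v = 0" if "v \<in> Tan x" for v
    using Tan_cross[OF that] c by (cases v) (auto simp: x zero_prod_def)
  moreover have "rk1 x" using c by (simp add: rk1_def x zero_prod_def)
  ultimately show "x \<in> sing (1, 1, 0, 0, 0, 0)" by (simp add: sing_def) (simp add: x)
qed

text \<open>By \<open>sing_diag\<close> only the block with indices 1 and 2 survives, and rank one
  means that its determinant vanishes. Conversely, the components of \<open>cross x v = 0\<close>
  include the products of the corner entry of \<open>v\<close> with \<open>r1\<close>,
  \<open>r2\<close> and \<open>a0\<close>, which are not all zero; so the corner entry is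
  zero.\<close>

lemma sing_rank1: "sing (1, 0, 0, 0, 0, 0 :: 'a::compalg) =
  {(0, r1, r2, a0, 0, 0) |r1 r2 a0. (r1, r2, a0) \<noteq> 0 \<and> r1 * r2 = dot a0 a0}"
proof (intro equalityI subsetI)
  fix x assume x: "x \<in> sing (1, 0, 0, 0, 0, 0 :: 'a)"
  obtain r0 r1 r2 a0 a1 a2 where x': "x = (r0, r1, r2, a0, a1, a2)" by (cases x)
  have "a1 = 0" "a2 = 0" using sing_diag x unfolding x' by (metis zero_neq_one)+
  moreover have "r0 = 0" "sharp x = 0" "x \<noteq> 0"
    using x by (auto simp: x' sing_def rk1_def)
  ultimately show "x \<in> {(0, r1, r2, a0, 0, 0) |r1 r2 a0. (r1, r2, a0) \<noteq> 0 \<and> r1 * r2 = dot a0 a0}"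
    by (auto simp: x' zero_prod_def)
next
  fix x :: "'a jordan"
  assume "x \<in> {(0, r1, r2, a0, 0, 0) |r1 r2 a0. (r1, r2, a0) \<noteq> 0 \<and> r1 * r2 = dot a0 a0}"
  then obtain r1 r2 a0 where nz: "(r1, r2, a0) \<noteq> 0" and r: "r1 * r2 = dot a0 a0"
    and x: "x = (0, r1, r2, a0, 0, 0)" by blast
  have "pr (1, 0, 0, 0, 0, 0) v = 0" if "v \<in> Tan x" for v
    using Tan_cross[OF that] nz by (cases v) (auto simp: x zero_prod_def)
  moreover have "rk1 x" using nz r by (auto simp: rk1_def x zero_prod_def)
  ultimately show "x \<in> sing (1, 0, 0, 0, 0, 0)" by (simp add: sing_def) (simp add: x)
qed


section \<open>Rank one: a quadric of singular points\<close>

lemma smooth_quadric_image: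
  fixes \<beta> :: "complex \<times> complex \<times> 'a::coordspace \<Rightarrow> 'b::coordspace"
  assumes "lin \<beta>" "inj \<beta>" "cdim TYPE('a) = d"
  shows "smooth_quadric (cdim TYPE('b)) d
    (coords ` \<beta> ` {(r1, r2, a) |r1 r2 a. (r1, r2, a) \<noteq> 0 \<and> r1 * r2 = dot a a})"
proof -
  let ?W = "TYPE(complex \<times> complex \<times> 'a)"
  \<comment> \<open>The Gram map of the quadratic form \<open>r1 * r2 - dot a a\<close>; symmetry of
    its matrix is its self-adjointness for \<open>dot\<close>.\<close>
  define \<Lambda> :: "complex \<times> complex \<times> 'a \<Rightarrow> complex \<times> complex \<times> 'a"
    where "\<Lambda> = (\<lambda>(r1, r2, a). (r2 / 2, r1 / 2, - a))"
  have l: "lin \<Lambda>" "lin (\<lambda>(r1 :: complex, r2 :: complex, a :: 'a). (2 * r2, 2 * r1, - a))"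
    by (auto simp: \<Lambda>_def scl_minus_right add_divide_distrib algebra_simps intro!: linI)
  have inv: "invertible_mat (matf \<Lambda>)"
    by (rule matf_invertible[OF l]) (auto simp: \<Lambda>_def)
  have d: "cdim ?W = d + 2" by (simp add: cdim_prod_def cdim_complex_def assms(3))
  have sym: "transpose_mat (matf \<Lambda>) = matf \<Lambda>"
  proof (rule eq_matI)
    fix i j assume "i < dim_row (matf \<Lambda>)" "j < dim_col (matf \<Lambda>)"
    then have ij: "i < cdim ?W" "j < cdim ?W" by (auto simp: matf_def)
    have "dot x (\<Lambda> y) = dot y (\<Lambda> x)" for x y
      by (cases x; cases y) (simp add: \<Lambda>_def dot_simps dot_commute algebra_simps)
    then have "coords (\<Lambda> (bas i)) $ j = coords (\<Lambda> (bas j)) $ i"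
      using ij by (metis dot_bas)
    then show "transpose_mat (matf \<Lambda>) $$ (i, j) = matf \<Lambda> $$ (i, j)"
      using ij by (simp add: matf_def)
  qed (simp_all add: matf_def)
  have q: "coords w \<bullet> (matf \<Lambda> *\<^sub>v coords w) = (case w of (r1, r2, a) \<Rightarrow> r1 * r2 - dot a a)"
    for w :: "complex \<times> complex \<times> 'a"
    unfolding matf_coords[OF l(1)] dot_def[symmetric]
    by (cases w) (simp add: \<Lambda>_def dot_simps)
  have car: "carrier_vec (d + 2) = range (coords :: complex \<times> complex \<times> 'a \<Rightarrow> _)"
    using coords_surj[where 'a="complex \<times> complex \<times> 'a"] coords_carrier[where 'a="complex \<times> complex \<times> 'a"]
    unfolding d by (blast intro: sym)
  have z: "coords w = 0\<^sub>v (d + 2) \<longleftrightarrow> w = 0" for w :: "complex \<times> complex \<times> 'a"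
    using coords_eq_0_iff[of w] by (simp add: d)
  show ?thesis
    unfolding smooth_quadric_def
  proof (intro bexI conjI ballI impI)
    show "matf \<beta> \<in> carrier_mat (cdim TYPE('b)) (d + 2)"
      and S: "matf \<Lambda> \<in> carrier_mat (d + 2) (d + 2)"
      by (metis d matf_carrier)+
    show "transpose_mat (matf \<Lambda>) = matf \<Lambda>" "invertible_mat (matf \<Lambda>)" by (rule sym inv)+
    fix y assume "y \<in> carrier_vec (d + 2)" "matf \<beta> *\<^sub>v y = 0\<^sub>v (cdim TYPE('b))"
    moreover from this obtain w :: "complex \<times> complex \<times> 'a" where w: "y = coords w"
      using car by blast
    ultimately have "coords (\<beta> w) = 0\<^sub>v (cdim TYPE('b))" by (simp add: matf_coords[OF assms(1)])
    then have "\<beta> w = \<beta> 0" by (simp add: coords_eq_0_iff lin_zero[OF assms(1)])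
    then have "w = 0" using assms(2) by (simp add: inj_eq)
    then show "y = 0\<^sub>v (d + 2)" using w z by simp
  next
    show "coords ` \<beta> ` {(r1, r2, a) |r1 r2 a. (r1, r2, a) \<noteq> 0 \<and> r1 * r2 = dot a a} =
      {matf \<beta> *\<^sub>v y |y. y \<in> carrier_vec (d + 2) \<and> y \<noteq> 0\<^sub>v (d + 2) \<and> y \<bullet> (matf \<Lambda> *\<^sub>v y) = 0}"
      (is "?L = ?R")
    proof -
      have "?R = {matf \<beta> *\<^sub>v coords w |w :: complex \<times> complex \<times> 'a.
          w \<noteq> 0 \<and> coords w \<bullet> (matf \<Lambda> *\<^sub>v coords w) = 0}"
        unfolding car using z by blast
      also have "\<dots> = {coords (\<beta> w) |w. w \<noteq> 0 \<and> (case w of (r1, r2, a) \<Rightarrow> r1 * r2 - dot a a) = 0}"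
        by (simp only: matf_coords[OF assms(1)] q)
      also have "\<dots> = ?L" by (auto intro!: imageI)
      finally show ?thesis ..
    qed
  qed
qed

lemma quadric_section:
  fixes y :: "'a::compalg jordan"
  assumes "y \<simeq> (1, 0, 0, 0, 0, 0)"
  shows "quadric_singular_section (cdim TYPE('a jordan)) (2 ^ level TYPE('a)) (severi (level TYPE('a))) (hf y)"
proof -
  obtain f f' where f: "dual_pair f f'" "f' (1, 0, 0, 0, 0, 0) = y"
    using equiv_sym[OF assms] by (auto simp: equiv_rel_def)
  obtain g where g: "g \<in> GJ" "\<And>x. g (f x) = x" "\<And>x. f (g x) = x"
    using f(1) GJ_inverse by (metis dual_pair_def)
  define \<beta> :: "complex \<times> complex \<times> 'a \<Rightarrow> 'a jordan" where "\<beta> w = g (case w of (r1, r2, a) \<Rightarrow> (0, r1, r2, a, 0, 0))" for w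
  have "lin (\<lambda>(r1, r2, a). (0, r1, r2, a, 0, 0) :: 'a jordan)"
    by (rule linI; clarsimp)
  from lin_comp[OF GJ_lin[OF g(1)] this] have "lin \<beta>"
    unfolding \<beta>_def[abs_def] .
  moreover have "inj \<beta>"
  proof (rule injI)
    fix x y assume "\<beta> x = \<beta> y"
    then have "f (\<beta> x) = f (\<beta> y)" by simp
    then show "x = y" by (cases x; cases y) (simp add: \<beta>_def g)
  qed
  moreover have "sing y = \<beta> ` {(r1, r2, a) |r1 r2 a. (r1, r2, a) \<noteq> 0 \<and> r1 * r2 = dot a a}"
  proof -
    have "sing y = {x. f x \<in> sing (1, 0, 0, 0, 0, 0)}" using sing_dual_pair[OF f(1)] f(2) by blast
    also have "\<dots> = g ` sing (1, 0, 0, 0, 0, 0)" 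
    proof (intro equalityI subsetI)
      fix x assume "x \<in> {x. f x \<in> sing (1, 0, 0, 0, 0, 0)}"
      then show "x \<in> g ` sing (1, 0, 0, 0, 0, 0)" using g(2)[of x] by (intro image_eqI[of _ _ "f x"]) simp_all
    next
      fix x assume "x \<in> g ` sing (1, 0, 0, 0, 0, 0)"
      then obtain z where "x = g z" "z \<in> sing (1, 0, 0, 0, 0, 0)" by blast
      then show "x \<in> {x. f x \<in> sing (1, 0, 0, 0, 0, 0)}" using g(3)[of z] by simp
    qed
    also have "\<dots> = \<beta> ` {(r1, r2, a) |r1 r2 a. (r1, r2, a) \<noteq> 0 \<and> r1 * r2 = dot a a}"
    proof (intro equalityI subsetI)
      fix x assume "x \<in> g ` sing (1, 0, 0, 0, 0, 0)"
      then obtain r1 r2 a where "x = g (0, r1, r2, a, 0, 0)" "(r1, r2, a) \<noteq> 0" "r1 * r2 = dot a a"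
        unfolding sing_rank1 by blast
      then show "x \<in> \<beta> ` {(r1, r2, a) |r1 r2 a. (r1, r2, a) \<noteq> 0 \<and> r1 * r2 = dot a a}"
        by (intro image_eqI[of _ _ "(r1, r2, a)"]) (simp_all add: \<beta>_def)
    next
      fix x assume "x \<in> \<beta> ` {(r1, r2, a) |r1 r2 a. (r1, r2, a) \<noteq> 0 \<and> r1 * r2 = dot a a}"
      then obtain r1 r2 a where "x = g (0, r1, r2, a, 0, 0)" "(r1, r2, a) \<noteq> 0" "r1 * r2 = dot a a"
        unfolding \<beta>_def by auto
      then show "x \<in> g ` sing (1, 0, 0, 0, 0, 0)" unfolding sing_rank1 by blast
    qed
    finally show ?thesis .
  qed
  ultimately show ?thesis
    using smooth_quadric_image[of \<beta> "2 ^ level TYPE('a)"]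
    by (simp add: quadric_singular_section_def singular_locus_eq cdim_level)
qed


section \<open>Rank two: a node\<close>

lemma Tan_e2: "Tan (0, 0, 1, 0, 0, 0 :: 'a::compalg) = {(0, 0, s, c0, c1, 0) |s c0 c1. True}"
proof (intro equalityI subsetI)
  fix v :: "'a jordan" assume "v \<in> Tan (0, 0, 1, 0, 0, 0)"
  from Tan_cross[OF this] show "v \<in> {(0, 0, s, c0, c1, 0) |s c0 c1. True}"
    by (cases v) (auto simp: zero_prod_def)
next
  fix v :: "'a jordan" assume "v \<in> {(0, 0, s, c0, c1, 0) |s c0 c1. True}"
  then obtain s c0 c1 where v: "v = (0, 0, s, c0, c1, 0)" by blast
  let ?e2 = "(0, 0, 1, 0, 0, 0) :: 'a jordan"
  \<comment> \<open>Chosen to complete the square: with \<open>l = 1 + t * s / 2\<close>, the path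
    becomes the Hermitian square of a vector with entries built from \<open>t *c c1\<close>,
    \<open>t *c c0\<close> and \<open>l\<close>, hence has vanishing adjoint.\<close>
  define w where "w = (dot c1 c1, dot c0 c0, s\<^sup>2 / 4, (s / 2) *c c0, (s / 2) *c c1, c0 \<star> c1)"
  \<comment> \<open>The excluded parameter is the zero of \<open>l\<close>. For \<open>s = 0\<close>
    there is none, but the quotient has the default value 0, so this case needs its own
    disjunct.\<close>
  have rk: "rk1 (?e2 + t *c v + t\<^sup>2 *c w)" if "t \<noteq> - 2 / s \<or> s = 0" for t
  proof -
    define l where "l = 1 + t * s / 2"
    have l: "l \<noteq> 0"
    proof
      assume "l = 0"
      moreover have "t * s = 2 * l - 2" by (simp add: l_def)
      ultimately have "t * s = - 2" by simp
      moreover from this have "s \<noteq> 0" by auto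
      ultimately have "t = - 2 / s" by (simp only: eq_divide_eq) simp
      then show False using that \<open>s \<noteq> 0\<close> by simp
    qed
    have "t *c c + t\<^sup>2 *c ((s / 2) *c c) = (t * l) *c c" for c :: 'a
      by (simp add: scl_scl l_def scl_add_left[symmetric] power2_eq_square algebra_simps)
    moreover have "1 + t * s + t\<^sup>2 * (s\<^sup>2 / 4) = l\<^sup>2"
      by (simp add: l_def power2_eq_square algebra_simps)
    ultimately have "?e2 + t *c v + t\<^sup>2 *c w =
      (t\<^sup>2 * dot c1 c1, t\<^sup>2 * dot c0 c0, l\<^sup>2, (t * l) *c c0, (t * l) *c c1, t\<^sup>2 *c (c0 \<star> c1))"
      by (simp add: v w_def)
    then show ?thesis
      using l by (simp add: rk1_def dot_simps star_simps star_star_left star_star_right scl_scl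
          dot_star_star_same power2_eq_square mult_ac zero_prod_def)
  qed
  have "\<forall>\<^sub>F t in nhds 0. t \<noteq> - 2 / s \<or> s = 0"
  proof (cases "s = 0")
    case False
    then have "- 2 / s \<noteq> 0" by simp
    then show ?thesis using t1_space_nhds[of 0 "- 2 / s"] by (auto elim: eventually_mono)
  qed simp
  then have "\<forall>\<^sub>F t in nhds 0. rk1 (?e2 + t *c v + t\<^sup>2 *c w)"
    by (rule eventually_mono) (rule rk)
  then show "v \<in> Tan ?e2" by (rule TanI)
qed

text \<open>The nodal condition on elements instead of vectors, with the singular point named, so
  that it can be transported along a dual pair.\<close>

definition node :: "'a::compalg jordan \<Rightarrow> 'a jordan \<Rightarrow> bool" where
  "node y x \<longleftrightarrow> sing y = {c *c x |c. c \<noteq> 0} \<and>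
     (\<exists>p \<in> ideal TYPE('a).
        (\<forall>v :: 'a jordan. dir_deriv (\<lambda>z. hf y \<bullet> z - p z) (coords x) (coords v) = 0) \<and>
        {v \<in> Tan x. \<forall>w \<in> Tan x. hessian (\<lambda>z. hf y \<bullet> z - p z) (coords x) (coords v) (coords w) = 0}
        = {c *c x |c. True})"

lemma node_nodal:
  fixes y :: "'a::compalg jordan"
  assumes "node y x"
  shows "nodal_section (cdim TYPE('a jordan)) (severi (level TYPE('a))) (hf y)"
proof -
  let ?n = "cdim TYPE('a jordan)" and ?X = "severi (level TYPE('a))"
  obtain p where p: "p \<in> ideal TYPE('a)"
    "\<And>v :: 'a jordan. dir_deriv (\<lambda>z. hf y \<bullet> z - p z) (coords x) (coords v) = 0"
    "{v \<in> Tan x. \<forall>w \<in> Tan x. hessian (\<lambda>z. hf y \<bullet> z - p z) (coords x) (coords v) (coords w) = 0}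
        = {c *c x |c. True}" and s: "sing y = {c *c x |c. c \<noteq> 0}"
    using assms unfolding node_def by blast
  have im: "coords ` {c *c x |c. P c} = {c \<cdot>\<^sub>v coords x |c. P c}" for P
    unfolding coords_scl[symmetric] by blast
  have "singular_locus ?n ?X (hf y) = {z. same_point (coords x) z}"
    unfolding singular_locus_eq s im same_point_def by blast
  moreover have "ordinary_quadratic_singularity ?n ?X (hf y) (coords x)"
    unfolding ordinary_quadratic_singularity_def
  proof (intro conjI bexI[OF _ p(1)[unfolded ideal_def]] ballI)
    have "1 *c x \<in> sing y" unfolding s by (intro CollectI exI[of _ 1]) simp
    then show "coords x \<in> singular_locus ?n ?X (hf y)" by (simp add: singular_locus_eq)
    show "dir_deriv (\<lambda>z. hf y \<bullet> z - p z) (coords x) v = 0" if "v \<in> carrier_vec ?n" for v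
      using coords_surj[OF that] p(2) by metis
    have "{v \<in> tangent_space ?n ?X (coords x). \<forall>w \<in> tangent_space ?n ?X (coords x).
          hessian (\<lambda>z. hf y \<bullet> z - p z) (coords x) v w = 0} =
        coords ` {v \<in> Tan x. \<forall>w \<in> Tan x. hessian (\<lambda>z. hf y \<bullet> z - p z) (coords x) (coords v) (coords w) = 0}"
      by (auto simp: tangent_space_eq)
    also have "\<dots> = {c \<cdot>\<^sub>v coords x |c. True}" unfolding p(3) by (rule im)
    finally show "{v \<in> tangent_space ?n ?X (coords x). \<forall>w \<in> tangent_space ?n ?X (coords x).
          hessian (\<lambda>z. hf y \<bullet> z - p z) (coords x) v w = 0} = {c \<cdot>\<^sub>v coords x |c. True}" .
  qed
  ultimately show ?thesis unfolding nodal_section_def by blast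
qed

lemma hessian_GJ:
  assumes "f \<in> GJ"
  shows "hessian (\<lambda>z. p (coords (f (uncoords z)))) (coords x) (coords v) (coords w) =
    hessian p (coords (f x)) (coords (f v)) (coords (f w))"
proof -
  have "((\<lambda>t. dir_deriv (\<lambda>z. p (coords (f (uncoords z)))) (coords x + t \<cdot>\<^sub>v coords v) (coords w))) =
    (\<lambda>t. dir_deriv p (coords (f x) + t \<cdot>\<^sub>v coords (f v)) (coords (f w)))"
    by (simp add: coords_line dir_deriv_GJ[OF assms] GJ_line[OF assms])
  then show ?thesis by (simp add: hessian_def dir_deriv_def[of "\<lambda>y. dir_deriv _ y _"])
qed

text \<open>Agreement on coordinate vectors is enough, since the line through
  \<open>coords x\<close> in the direction \<open>coords v\<close> stays among them.\<close>

lemma dir_deriv_cong: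
  assumes "\<And>x. p (coords x) = q (coords (x :: 'a::coordspace))"
  shows "dir_deriv p (coords (x::'a)) (coords (v::'a)) = dir_deriv q (coords x) (coords v)"
  by (simp add: dir_deriv_def coords_line assms)

lemma hessian_cong:
  assumes "\<And>x. p (coords x) = q (coords (x :: 'a::coordspace))"
  shows "hessian p (coords (x::'a)) (coords (v::'a)) (coords (w::'a)) = hessian q (coords x) (coords v) (coords w)"
  unfolding hessian_def
  by (rule dir_deriv_cong[of "\<lambda>z. dir_deriv p z (coords w)" "\<lambda>z. dir_deriv q z (coords w)"])
    (rule dir_deriv_cong[of p q, OF assms])

lemma node_dual_pair:
  fixes y :: "'a::compalg jordan"
  assumes "dual_pair f f'" "node y (f x)" shows "node (f' y) x"
proof -
  have f: "f \<in> GJ" "\<And>x y. pr (f' y) x = pr y (f x)" using assms(1) by (auto simp: dual_pair_def)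
  have inj: "f u = f v \<longleftrightarrow> u = v" for u v using f(1) by (metis GJ_inverse)
  have fs: "f (c *c u) = c *c f u" for c u by (rule lin_scl[OF GJ_lin[OF f(1)]])
  obtain g where g: "\<And>x. f (g x) = x" using f by (metis GJ_inverse)
  obtain p where p: "p \<in> ideal TYPE('a)"
    "\<And>v :: 'a jordan. dir_deriv (\<lambda>z. hf y \<bullet> z - p z) (coords (f x)) (coords v) = 0"
    "{v \<in> Tan (f x). \<forall>w \<in> Tan (f x). hessian (\<lambda>z. hf y \<bullet> z - p z) (coords (f x)) (coords v) (coords w) = 0}
        = {c *c f x |c. True}" and s: "sing y = {c *c f x |c. c \<noteq> 0}"
    using assms(2) unfolding node_def by blast
  let ?p = "\<lambda>z. p (coords (f (uncoords z)))"
  define F where "F = (\<lambda>z. hf y \<bullet> z - p z)"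
  have eq: "hf (f' y) \<bullet> coords u - ?p (coords u) =
      F (coords (f (uncoords (coords u))))" for u :: "'a jordan"
    by (simp add: F_def hf_coords f)
  have dd: "dir_deriv (\<lambda>z. hf (f' y) \<bullet> z - ?p z) (coords u) (coords v) =
      dir_deriv F (coords (f u)) (coords (f v))" for u v
    by (rule trans[OF dir_deriv_cong dir_deriv_GJ[OF f(1)]]) (rule eq)
  have hh: "hessian (\<lambda>z. hf (f' y) \<bullet> z - ?p z) (coords u) (coords v) (coords w) =
      hessian F (coords (f u)) (coords (f v)) (coords (f w))" for u v w
    by (rule trans[OF hessian_cong hessian_GJ[OF f(1)]]) (rule eq)
  have Tx: "Tan (f x) = f ` Tan x"
  proof (intro equalityI subsetI)
    fix v assume "v \<in> Tan (f x)"
    then have "g v \<in> Tan x" using Tan_GJ_iff[OF f(1), of "g v" x] g[of v] by simp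
    then show "v \<in> f ` Tan x" using g[of v] by (intro image_eqI[of _ _ "g v"]) simp_all
  next
    fix v assume "v \<in> f ` Tan x"
    then show "v \<in> Tan (f x)" using Tan_GJ[OF f(1)] by blast
  qed
  have "sing (f' y) = {c *c x |c. c \<noteq> 0}"
  proof (rule Set.set_eqI)
    fix u show "u \<in> sing (f' y) \<longleftrightarrow> u \<in> {c *c x |c. c \<noteq> 0}"
      unfolding sing_dual_pair[OF assms(1)] s by (simp add: fs[symmetric] inj)
  qed
  moreover have "{v \<in> Tan x. \<forall>w \<in> Tan x. hessian (\<lambda>z. hf (f' y) \<bullet> z - ?p z) (coords x) (coords v) (coords w) = 0}
      = {c *c x |c. True}" (is "?L = ?R")
  proof -
    have "v \<in> ?L \<longleftrightarrow> v \<in> ?R" for v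
    proof -
      have "v \<in> ?L \<longleftrightarrow> f v \<in> {v \<in> Tan (f x). \<forall>w \<in> Tan (f x).
          hessian F (coords (f x)) (coords v) (coords w) = 0}"
        by (simp add: hh Tan_GJ_iff[OF f(1)] Tx inj_image_mem_iff inj_def inj)
      also have "\<dots> \<longleftrightarrow> v \<in> ?R" unfolding p(3)[folded F_def] by (simp add: fs[symmetric] inj)
      finally show ?thesis .
    qed
    then show ?thesis by blast
  qed
  ultimately show ?thesis
    unfolding node_def using ideal_GJ[OF p(1) f(1)] dd p(2)[folded F_def] by (intro conjI bexI[of _ ?p]) auto
qed

lemma node_e2: "node (1, 1, 0, 0, 0, 0 :: 'a::compalg) (0, 0, 1, 0, 0, 0)"
proof -
  let ?y = "(1, 1, 0, 0, 0, 0) :: 'a jordan" and ?e2 = "(0, 0, 1, 0, 0, 0) :: 'a jordan"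
  \<comment> \<open>At \<open>?e2\<close> the differential of \<open>pr ?y (sharp x)\<close> sends
    \<open>v\<close> to \<open>pr ?y (cross ?e2 v)\<close>, the sum of its first two diagonal
    entries, which is \<open>pr ?y v\<close>. So this \<open>?p\<close> cancels the linear term of
    the form.\<close>
  let ?p = "\<lambda>z. pr ?y (sharp (uncoords z))"
  let ?f = "\<lambda>z. hf ?y \<bullet> z - ?p z"
  have dd: "dir_deriv ?f (coords x) (coords v) = pr ?y v - pr ?y (cross x v)" for x v
  proof (rule dir_deriv_coordsI)
    have "?f (coords (x + t *c v)) =
        pr ?y x + t * pr ?y v - (pr ?y (sharp x) + t * pr ?y (cross x v) + t\<^sup>2 * pr ?y (sharp v))" for t
      by (simp only: hf_coords uncoords_coords sharp_add cross_scl_right sharp_scl pr_add_right pr_scl_right)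
    then show "((\<lambda>t. ?f (coords (x + t *c v))) has_field_derivative pr ?y v - pr ?y (cross x v)) (at 0)"
      by (simp only:) (auto intro!: derivative_eq_intros)
  qed
  have hh: "hessian ?f (coords x) (coords v) (coords w) = - pr ?y (cross v w)"
    for x v w :: "'a jordan"
    unfolding hessian_def
  proof (rule dir_deriv_coordsI[of "\<lambda>z. dir_deriv ?f z (coords w)"])
    have "dir_deriv ?f (coords (x + t *c v)) (coords w) =
        pr ?y w - (pr ?y (cross x w) + t * pr ?y (cross v w))" for t
      by (simp only: dd cross_commute[of _ w] cross_add_right cross_scl_right pr_add_right pr_scl_right)
    then show "((\<lambda>t. dir_deriv ?f (coords (x + t *c v)) (coords w)) has_field_derivative
        - pr ?y (cross v w)) (at 0)"
      by (simp only:) (auto intro!: derivative_eq_intros)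
  qed
  have "dir_deriv ?f (coords ?e2) (coords v) = 0" for v :: "'a jordan"
    unfolding dd by (cases v) simp
  moreover have "{v \<in> Tan ?e2. \<forall>w \<in> Tan ?e2. hessian ?f (coords ?e2) (coords v) (coords w) = 0} =
    {c *c ?e2 |c. True}" (is "?L = ?R")
  proof (intro equalityI subsetI)
    fix v assume "v \<in> ?L"
    then obtain s c0 c1 where v: "v = (0, 0, s, c0, c1, 0)" unfolding Tan_e2 by blast
    have w: "pr ?y (cross v (0, 0, s', d0, d1, 0)) = 0" for s' d0 d1
    proof -
      have "(0, 0, s', d0, d1, 0) \<in> Tan ?e2" unfolding Tan_e2 by blast
      then show ?thesis using \<open>v \<in> ?L\<close> hh by simp
    qed
    \<comment> \<open>On the tangent space the Hessian is twice
      \<open>dot c0 d0 + dot c1 d1\<close>; its only kernel is the direction of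
      \<open>?e2\<close>.\<close>
    have "dot d c0 = 0" "dot d c1 = 0" for d
      using w[of 0 d 0] w[of 0 0 d] by (simp_all add: v dot_commute)
    then have "c0 = 0" "c1 = 0" by (blast intro: dot_nondegenerate)+
    then show "v \<in> ?R" by (simp add: v)
  next
    fix v assume "v \<in> ?R"
    then show "v \<in> ?L" by (auto simp: Tan_e2 hh)
  qed
  moreover have "sing ?y = {c *c ?e2 |c. c \<noteq> 0}" by (simp add: sing_rank2)
  ultimately show ?thesis
    unfolding node_def by (intro conjI bexI[OF _ ideal_sharp[of ?y]] allI)
qed

lemma nodal_section:
  fixes y :: "'a::compalg jordan"
  assumes "y \<simeq> (1, 1, 0, 0, 0, 0)"
  shows "nodal_section (cdim TYPE('a jordan)) (severi (level TYPE('a))) (hf y)"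
proof -
  obtain f f' where f: "dual_pair f f'" "f' (1, 1, 0, 0, 0, 0) = y"
    using equiv_sym[OF assms] by (auto simp: equiv_rel_def)
  obtain g where g: "\<And>x. f (g x) = x"
    using f(1) GJ_inverse by (metis dual_pair_def)
  have "node y (g (0, 0, 1, 0, 0, 0))"
    using node_dual_pair[OF f(1), of "(1, 1, 0, 0, 0, 0)" "g (0, 0, 1, 0, 0, 0)"] node_e2
    by (simp add: g f(2))
  then show ?thesis by (rule node_nodal)
qed

section \<open>Rank three: homogeneous sections\<close>

abbreviation curve :: "(complex \<Rightarrow> 'v::cspace) \<Rightarrow> bool" where
  "curve \<equiv> polymap {\<lambda>t. t}"

lemma poly_funs_id: "(\<lambda>t. t) \<in> poly_funs {\<lambda>t. t}"
  by (rule poly_funs.coord) simp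

lemma poly_funs_id_reverse:
  "r \<in> poly_funs {\<lambda>t::complex. t} \<Longrightarrow> (\<lambda>t. r (1 - t)) \<in> poly_funs {\<lambda>t. t}"
  by (induction rule: poly_funs.induct)
    (auto intro: poly_funs.intros poly_funs_diff)

lemma curve_reverse: "curve f \<Longrightarrow> curve (\<lambda>t. f (1 - t))"
  by (induction rule: polymap.induct) (auto intro: polymap.intros poly_funs_id_reverse)

lemma polymap_components:
  assumes "polymap C \<psi>"
  obtains r0 r1 r2 a0 a1 a2 where "\<psi> = (\<lambda>t. (r0 t, r1 t, r2 t, a0 t, a1 t, a2 t))"
    "polymap C r0" "polymap C r1" "polymap C r2" "polymap C a0" "polymap C a1" "polymap C a2"
proof -
  have l: "lin fst" "lin snd" by (simp_all add: lin_def scl_prod_def)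
  note f = polymap_lin[OF _ l(1)] and s = polymap_lin[OF _ l(2)]
  show ?thesis
    by (rule that[of "\<lambda>t. fst (\<psi> t)" "\<lambda>t. fst (snd (\<psi> t))" "\<lambda>t. fst (snd (snd (\<psi> t)))"
          "\<lambda>t. fst (snd (snd (snd (\<psi> t))))" "\<lambda>t. fst (snd (snd (snd (snd (\<psi> t)))))"
          "\<lambda>t. snd (snd (snd (snd (snd (\<psi> t)))))"]) (simp | intro f s assms)+
qed

lemma polymap_dot: "polymap C f \<Longrightarrow> polymap C g \<Longrightarrow> polymap C (\<lambda>s. dot (f s) (g s))"
  by (rule polymap_bilin[OF _ _ lin_dot' lin_dot])

lemma polymap_star: "polymap C f \<Longrightarrow> polymap C g \<Longrightarrow> polymap C (\<lambda>s. f s \<star> g s)"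
  by (rule polymap_bilin[OF _ _ lin_star])

lemma polymap_mult:
  "polymap C f \<Longrightarrow> polymap C g \<Longrightarrow> polymap C (\<lambda>s. f s * g s :: complex)"
  by (simp add: polymap_complex poly_funs.mult)

lemmas polymap_intros = polymap_Pair polymap.const polymap.add polymap_mult polymap_cong_scl
  polymap_dot polymap_star

lemma polymap_rot: assumes "polymap C \<psi>" shows "polymap C (\<lambda>t. rot (\<psi> t))"
  using polymap_lin[OF assms GJ_lin[OF rot_GJ]] .

lemma polymap_E01:
  assumes "polymap C u" "polymap C \<psi>" shows "polymap C (\<lambda>t. E01 (u t) (\<psi> t))"
  using assms(2) by (rule polymap_components) (simp, intro polymap_intros assms(1))

lemma polymap_E10:
  assumes "polymap C u" "polymap C \<psi>" shows "polymap C (\<lambda>t. E10 (u t) (\<psi> t))"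
  using assms(2) by (rule polymap_components) (simp, intro polymap_intros assms(1))

lemma polymap_E:
  assumes "polymap C u" "polymap C \<psi>"
  shows "polymap C (\<lambda>t. E12 (u t) (\<psi> t))" "polymap C (\<lambda>t. E20 (u t) (\<psi> t))"
    "polymap C (\<lambda>t. E21 (u t) (\<psi> t))" "polymap C (\<lambda>t. E02 (u t) (\<psi> t))"
  unfolding E12_def E20_def E21_def E02_def
  by (intro polymap_rot polymap_E01 polymap_E10 assms)+

section \<open>Stabilizers of a linear form and polynomial paths in them\<close>

definition Stab :: "'a::compalg jordan \<Rightarrow> ('a jordan \<Rightarrow> 'a jordan) set" where
  "Stab y = {f \<in> GJ. \<forall>x. pr y (f x) = pr y x}"

lemma StabI: "f \<in> GJ \<Longrightarrow> (\<And>x. pr y (f x) = pr y x) \<Longrightarrow> f \<in> Stab y"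
  and Stab_GJ: "f \<in> Stab y \<Longrightarrow> f \<in> GJ"
  and Stab_pr: "f \<in> Stab y \<Longrightarrow> pr y (f x) = pr y x"
  unfolding Stab_def by blast+

lemma Stab_comp: "f \<in> Stab y \<Longrightarrow> g \<in> Stab y \<Longrightarrow> (\<lambda>x. f (g x)) \<in> Stab y"
  by (rule StabI) (simp_all only: GJ_comp Stab_GJ Stab_pr)

lemma Stab_inverse:
  assumes "f \<in> Stab y" obtains g where "g \<in> Stab y" "\<And>x. g (f x) = x" "\<And>x. f (g x) = x"
proof -
  obtain g where g: "g \<in> GJ" "\<And>x. g (f x) = x" "\<And>x. f (g x) = x"
    using Stab_GJ[OF assms] by (metis GJ_inverse)
  have "pr y (g x) = pr y x" for x using Stab_pr[OF assms, of "g x"] g(3)[of x] by simp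
  then show ?thesis using that g StabI by blast
qed

text \<open>Along a polynomial path of stabilizer elements a polynomial function on the section becomes a
  polynomial in one variable; this gives the irreducibility of the section.\<close>

definition linked :: "'a::compalg jordan \<Rightarrow> ('a jordan \<Rightarrow> 'a jordan) \<Rightarrow> bool" where
  "linked y g \<longleftrightarrow> (\<exists>\<gamma>. (\<forall>t. \<gamma> t \<in> Stab y) \<and> \<gamma> 0 = (\<lambda>x. x) \<and> \<gamma> 1 = g \<and>
     (\<forall>\<psi>. curve \<psi> \<longrightarrow> curve (\<lambda>t. \<gamma> t (\<psi> t))))"

lemma linkedI:
  assumes "\<And>t. \<gamma> t \<in> Stab y" "\<And>x. \<gamma> 0 x = x" "\<And>\<psi>. curve \<psi> \<Longrightarrow> curve (\<lambda>t. \<gamma> t (\<psi> t))"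
  shows "linked y (\<gamma> 1)"
  unfolding linked_def using assms by (intro exI[of _ \<gamma>]) blast

lemma linkedE:
  assumes "linked y g"
  obtains \<gamma> where "\<And>t. \<gamma> t \<in> Stab y" "\<gamma> 0 = (\<lambda>x. x)" "\<gamma> 1 = g"
    "\<And>\<psi>. curve \<psi> \<Longrightarrow> curve (\<lambda>t. \<gamma> t (\<psi> t))"
proof -
  obtain \<gamma> where g: "(\<forall>t. \<gamma> t \<in> Stab y) \<and> \<gamma> 0 = (\<lambda>x. x) \<and> \<gamma> 1 = g \<and>
     (\<forall>\<psi>. curve \<psi> \<longrightarrow> curve (\<lambda>t. \<gamma> t (\<psi> t)))"
    using assms unfolding linked_def by (rule exE)
  show ?thesis by (rule that[of \<gamma>]) (simp_all add: g)
qed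

lemma linked_Stab: "linked y g \<Longrightarrow> g \<in> Stab y"
  unfolding linked_def by blast

lemma linked_comp:
  assumes "linked y f" "linked y g" shows "linked y (\<lambda>x. f (g x))"
proof -
  obtain \<gamma> where
    c: "\<And>t. \<gamma> t \<in> Stab y" "\<gamma> 0 = (\<lambda>x. x)" "\<gamma> 1 = f" "\<And>\<psi>. curve \<psi> \<Longrightarrow> curve (\<lambda>t. \<gamma> t (\<psi> t))"
    using assms(1) by (rule linkedE) blast
  obtain \<delta> where
    d: "\<And>t. \<delta> t \<in> Stab y" "\<delta> 0 = (\<lambda>x. x)" "\<delta> 1 = g" "\<And>\<psi>. curve \<psi> \<Longrightarrow> curve (\<lambda>t. \<delta> t (\<psi> t))"
    using assms(2) by (rule linkedE) blast
  have "linked y ((\<lambda>t x. \<gamma> t (\<delta> t x)) 1)"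
    by (rule linkedI) (simp_all only: c d Stab_comp)
  then show ?thesis by (simp only: c d)
qed

text \<open>Transitivity by elements joined to the identity inside the stabilizer. The connecting
  path is recorded because irreducibility needs it; the scalar \<open>c\<close> accounts for working
  with cones.\<close>

definition homog :: "'a::compalg jordan \<Rightarrow> bool" where
  "homog y \<longleftrightarrow> (\<exists>b. rk1 b \<and> pr y b = 0 \<and>
     (\<forall>x. rk1 x \<longrightarrow> pr y x = 0 \<longrightarrow> (\<exists>c g. c \<noteq> 0 \<and> linked y g \<and> x = c *c g b)))"

lemma homog_dual_pair:
  assumes "homog y" "dual_pair f f'" shows "homog (f' y)"
proof -
  obtain b where b: "rk1 b" "pr y b = 0"
    and orb: "\<And>x. rk1 x \<Longrightarrow> pr y x = 0 \<Longrightarrow> \<exists>c g. c \<noteq> 0 \<and> linked y g \<and> x = c *c g b"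
    using assms(1) unfolding homog_def by blast
  have f: "f \<in> GJ" "\<And>x y. pr (f' y) x = pr y (f x)" using assms(2) unfolding dual_pair_def by blast+
  obtain h where h: "h \<in> GJ" "\<And>x. h (f x) = x" "\<And>x. f (h x) = x"
    using f(1) by (metis GJ_inverse)
  have link: "linked (f' y) (\<lambda>x. h (g (f x)))" if g: "linked y g" for g
  proof -
    obtain \<gamma> where
      c: "\<And>t. \<gamma> t \<in> Stab y" "\<gamma> 0 = (\<lambda>x. x)" "\<gamma> 1 = g" "\<And>\<psi>. curve \<psi> \<Longrightarrow> curve (\<lambda>t. \<gamma> t (\<psi> t))"
      using g by (rule linkedE) blast
    have "linked (f' y) ((\<lambda>t x. h (\<gamma> t (f x))) 1)"
    proof (rule linkedI)
      fix t show "(\<lambda>x. h (\<gamma> t (f x))) \<in> Stab (f' y)"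
      proof (rule StabI)
        show "(\<lambda>x. h (\<gamma> t (f x))) \<in> GJ"
          by (rule GJ_comp[OF h(1) GJ_comp[OF Stab_GJ[OF c(1)] f(1)]])
        show "pr (f' y) (h (\<gamma> t (f x))) = pr (f' y) x" for x
          by (simp only: f(2) h(3) Stab_pr[OF c(1)])
      qed
    next
      fix \<psi> :: "complex \<Rightarrow> 'a jordan" assume "curve \<psi>"
      then show "curve (\<lambda>t. h (\<gamma> t (f (\<psi> t))))"
        by (intro polymap_lin[OF _ GJ_lin[OF h(1)]] c(4) polymap_lin[OF _ GJ_lin[OF f(1)]])
    qed (simp only: c(2) h(2))
    then show ?thesis by (simp only: c(3))
  qed
  show ?thesis
    unfolding homog_def
  proof (intro exI[of _ "h b"] conjI allI impI)
    show "rk1 (h b)" "pr (f' y) (h b) = 0" using b by (simp_all only: GJ_rk1[OF h(1)] f(2) h(3))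
    fix x assume "rk1 x" "pr (f' y) x = 0"
    then obtain c g where "c \<noteq> 0" and g: "linked y g" and fx: "f x = c *c g b"
      using orb[of "f x"] f(2) GJ_rk1[OF f(1)] by metis
    have "x = h (f x)" by (simp only: h(2))
    also have "\<dots> = c *c h (g (f (h b)))"
      by (simp only: fx lin_scl[OF GJ_lin[OF h(1)]] h(3))
    finally show "\<exists>c g. c \<noteq> 0 \<and> linked (f' y) g \<and> x = c *c g (h b)"
      using \<open>c \<noteq> 0\<close> link[OF g] by (intro exI[of _ c] exI[of _ "\<lambda>x. h (g (f x))"] conjI)
  qed
qed

text \<open>Scaling a form changes neither its zeros nor its stabilizer. This bridges normal forms
  with different constants, which are not equivalent in general as \<open>Nrm\<close> is
  invariant.\<close>

lemma homog_scl: assumes "homog y" "c \<noteq> 0" shows "homog (c *c y)"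
proof -
  have "Stab (c *c y) = Stab y" using assms(2) by (simp add: Stab_def pr_scl_left)
  then have "linked (c *c y) = linked y" by (simp add: linked_def[abs_def])
  then show ?thesis using assms by (simp add: homog_def pr_scl_left)
qed

section \<open>Opposite unipotent families fixing a form of rank three\<close>

definition unit_elt :: "'a::compalg" where "unit_elt = bas 0"

lemma dot_unit: "dot unit_elt (unit_elt :: 'a::compalg) = 1"
proof -
  have "0 < cdim TYPE('a)" by (simp add: cdim_level)
  then show ?thesis by (simp add: unit_elt_def dot_bas)
qed

lemma unit_star_star: "(unit_elt \<star> u) \<star> unit_elt = u" "unit_elt \<star> (u \<star> unit_elt) = u"
  by (simp_all add: star_star_left star_star_right dot_unit)

text \<open>A rank three functional vanishing at the base point \<open>e0\<close>. It is fixed by the maps \<open>lowU u w\<close> and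
  by the opposite ones \<open>uppU u w\<close> if \<open>2 dot unit_elt w = dot u u\<close>.\<close>

definition ysp :: "'a::compalg jordan" where "ysp = (0, 1, 0, 0, - unit_elt, 0)"

definition lowU :: "'a::compalg \<Rightarrow> 'a \<Rightarrow> 'a jordan \<Rightarrow> 'a jordan" where
  "lowU u w x = E10 u (E21 (unit_elt \<star> u) (E20 w x))"

definition uppU :: "'a::compalg \<Rightarrow> 'a \<Rightarrow> 'a jordan \<Rightarrow> 'a jordan" where
  "uppU u w x = E12 (unit_elt \<star> u) (E01 u (E02 w x))"

definition uppU_inv :: "'a::compalg \<Rightarrow> 'a \<Rightarrow> 'a jordan \<Rightarrow> 'a jordan" where
  "uppU_inv u w x = E02 (- w) (E01 (- u) (E12 (- (unit_elt \<star> u)) x))"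

lemma uppU_inverse: "uppU_inv u w (uppU u w x) = x" "uppU u w (uppU_inv u w x) = x"
  by (simp_all add: uppU_def uppU_inv_def)

text \<open>\<open>E10 u\<close> adds \<open>2 * dot u a2\<close> to \<open>r1\<close>. The factor
  \<open>E21\<close> compensates it through \<open>a1\<close>, its parameter being chosen so that
  \<open>(unit_elt \<star> u) \<star> unit_elt = u\<close>. What remains is \<open>r0\<close> times
  the defect of the hypothesis.\<close>

lemma lowU_Stab: assumes "2 * dot unit_elt w = dot u u" shows "lowU u w \<in> Stab ysp"
proof (rule StabI)
  show "lowU u w \<in> GJ"
    unfolding lowU_def[abs_def] by (rule GJ_comp[OF E10_GJ GJ_comp[OF E_GJ(3,2)]])
  fix x :: "'a jordan"
  obtain r0 r1 r2 a0 a1 a2 where x: "x = (r0, r1, r2, a0, a1, a2)" by (cases x)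
  have "dot unit_elt (a2 \<star> (unit_elt \<star> u)) = dot ((unit_elt \<star> u) \<star> unit_elt) a2"
    by (metis dot_star_cyclic dot_commute)
  then have "dot unit_elt (a2 \<star> (unit_elt \<star> u)) = dot u a2" by (simp add: unit_star_star)
  then show "pr ysp (lowU u w x) = pr ysp x"
    by (simp add: x ysp_def lowU_def dot_simps assms[symmetric] algebra_simps)
qed

lemma uppU_Stab: assumes "2 * dot unit_elt w = dot u u" shows "uppU u w \<in> Stab ysp"
proof (rule StabI)
  show "uppU u w \<in> GJ"
    unfolding uppU_def[abs_def] by (rule GJ_comp[OF E_GJ(1) GJ_comp[OF E01_GJ E_GJ(4)]])
  fix x :: "'a jordan"
  obtain r0 r1 r2 a0 a1 a2 where x: "x = (r0, r1, r2, a0, a1, a2)" by (cases x)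
  have "dot unit_elt (u \<star> a0) = dot (unit_elt \<star> u) a0"
    by (metis dot_star_cyclic dot_commute)
  then show "pr ysp (uppU u w x) = pr ysp x"
    by (simp add: x ysp_def uppU_def dot_simps dot_star_star_same dot_unit assms[symmetric] algebra_simps)
qed

lemma uppU_inv_Stab: assumes "2 * dot unit_elt w = dot u u" shows "uppU_inv u w \<in> Stab ysp"
proof -
  obtain g where g: "g \<in> Stab ysp" "\<And>x. g (uppU u w x) = x" "\<And>x. uppU u w (g x) = x"
    using uppU_Stab[OF assms] by (metis Stab_inverse)
  have "g x = uppU_inv u w x" for x
    using g(2)[of "uppU_inv u w x"] by (simp only: uppU_inverse)
  then have "g = uppU_inv u w" by blast
  then show ?thesis using g(1) by simp
qed

text \<open>The constraint is homogeneous if \<open>u\<close> has weight 1 and \<open>w\<close> has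
  weight 2, so scaling with these weights contracts an admissible pair to the identity within the
  stabilizer.\<close>

lemma linked_path:
  fixes F :: "'a::compalg \<Rightarrow> 'a \<Rightarrow> 'a jordan \<Rightarrow> 'a jordan"
  assumes "\<And>u w. 2 * dot unit_elt w = dot u u \<Longrightarrow> F u w \<in> Stab ysp" "\<And>x. F 0 0 x = x"
    and "\<And>u w \<psi>. curve u \<Longrightarrow> curve w \<Longrightarrow> curve \<psi> \<Longrightarrow> curve (\<lambda>t. F (u t) (w t) (\<psi> t))"
    and "2 * dot unit_elt w = dot u u"
  shows "linked ysp (F u w)"
proof -
  have "linked ysp ((\<lambda>t x. F (t *c u) (t\<^sup>2 *c w) x) 1)"
  proof (rule linkedI)
    fix t show "(\<lambda>x. F (t *c u) (t\<^sup>2 *c w) x) \<in> Stab ysp"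
      using assms(4) by (intro assms(1)) (simp add: dot_simps power2_eq_square)
  next
    fix \<psi> :: "complex \<Rightarrow> 'a jordan" assume "curve \<psi>"
    then show "curve (\<lambda>t. F (t *c u) (t\<^sup>2 *c w) (\<psi> t))"
      unfolding power2_eq_square
      by (intro assms(3) polymap.scl polymap.const poly_funs.mult poly_funs_id)
  qed (simp add: assms(2))
  then show ?thesis by simp
qed

lemma linked_lowU: assumes "2 * dot unit_elt w = dot u u" shows "linked ysp (lowU u w)"
proof (rule linked_path[OF lowU_Stab _ _ assms])
  show "lowU 0 0 x = x" for x :: "'a jordan" by (cases x) (simp add: lowU_def)
qed (simp_all add: lowU_def polymap_E10 polymap_E polymap_star polymap.const)

lemma linked_uppU_inv: assumes "2 * dot unit_elt w = dot u u" shows "linked ysp (uppU_inv u w)"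
proof (rule linked_path[OF uppU_inv_Stab _ _ assms])
  show "uppU_inv 0 0 x = x" for x :: "'a jordan" by (cases x) (simp add: uppU_inv_def)
  have "curve (\<lambda>t. - f t)" if "curve f" for f :: "complex \<Rightarrow> 'a"
    using polymap_lin[OF that, of uminus] by (simp add: lin_def scl_minus_right)
  then show "curve (\<lambda>t. uppU_inv (u t) (w t) (\<psi> t))"
    if "curve u" "curve w" "curve \<psi>" for u w :: "complex \<Rightarrow> 'a" and \<psi>
    using that by (simp add: uppU_inv_def polymap_E01 polymap_E polymap_star polymap.const)
qed

text \<open>Where \<open>r0\<close> is nonzero, the adjoint equations express \<open>r1\<close>,
  \<open>r2\<close> and \<open>a0\<close> through \<open>r0\<close>, \<open>a1\<close> and
  \<open>a2\<close>. Comparison with the image of \<open>e0\<close> dictates \<open>?u\<close> and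
  \<open>?w\<close>, and lying in the hyperplane is precisely the constraint on them.\<close>

lemma reach_cell:
  assumes "rk1 (r0, r1, r2, a0, a1, a2)" "pr ysp (r0, r1, r2, a0, a1, a2) = 0" "r0 \<noteq> 0"
  shows "\<exists>g. linked ysp g \<and> (r0, r1, r2, a0, a1, a2) = r0 *c g e0"
proof -
  let ?u = "inverse r0 *c a2" and ?w = "inverse r0 *c a1"
  have s: "r2 * r0 = dot a1 a1" "r0 * r1 = dot a2 a2" "a1 \<star> a2 = r0 *c a0"
    using assms(1) by (auto simp: rk1_def zero_prod_def)
  have h: "r1 = 2 * dot unit_elt a1" using assms(2) by (simp add: ysp_def dot_simps)
  have "2 * dot unit_elt ?w = dot ?u ?u"
    using h s(2) assms(3) by (simp add: dot_simps field_simps)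
  then have "linked ysp (lowU ?u ?w)" by (rule linked_lowU)
  moreover have "(r0, r1, r2, a0, a1, a2) = r0 *c lowU ?u ?w e0"
    using s assms(3) by (simp add: lowU_def dot_simps star_simps scl_scl field_simps)
  ultimately show ?thesis by blast
qed

text \<open>The expression is the corner entry of \<open>uppU u w\<close> applied to the element. If
  it vanished for all admissible pairs, its homogeneous parts would vanish separately:
  \<open>u = 0\<close> forces \<open>a1\<close> onto the line of the unit, and being isotropic it is
  zero; then \<open>r1\<close>, \<open>r2\<close>, \<open>a2\<close> and \<open>a0\<close> follow in
  turn.\<close>

lemma reach_outside_cell:
  fixes a0 a1 a2 :: "'a::compalg"
  assumes "rk1 (0, r1, r2, a0, a1, a2)" "pr ysp (0, r1, r2, a0, a1, a2) = 0"
  shows "\<exists>u w. 2 * dot unit_elt w = dot u u \<and>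
    2 * dot w a1 + dot w w * r2 + 2 * dot u (a2 + a0 \<star> w) + dot u u * r1 \<noteq> 0"
proof (rule ccontr)
  let ?e = "unit_elt :: 'a"
  assume "\<not> ?thesis"
  then have F: "2 * dot w a1 + dot w w * r2 + 2 * dot u (a2 + a0 \<star> w) + dot u u * r1 = 0"
    if "2 * dot ?e w = dot u u" for u w using that by blast
  have s: "dot a1 a1 = 0" "r1 * r2 = dot a0 a0" and nz: "(0, r1, r2, a0, a1, a2) \<noteq> 0"
    using assms(1) by (auto simp: rk1_def zero_prod_def)
  have h: "r1 = 2 * dot ?e a1" using assms(2) by (simp add: ysp_def dot_simps)
  have "a1 = dot ?e a1 *c ?e"
  proof (rule dot_eqI)
    fix z
    \<comment> \<open>The part of \<open>z\<close> orthogonal to the unit: admissible together with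
      \<open>u = 0\<close>, and so is its negative.\<close>
    define w where "w = z - dot ?e z *c ?e"
    have w: "dot ?e w = 0" by (simp add: w_def dot_simps dot_unit)
    have pm: "2 * dot w a1 + dot w w * r2 = 0" "- (2 * dot w a1) + dot w w * r2 = 0"
      using F[of w 0] F[of "- w" 0] w by (simp_all add: dot_simps)
    have "4 * dot w a1 = (2 * dot w a1 + dot w w * r2) - (- (2 * dot w a1) + dot w w * r2)" by simp
    then have "dot w a1 = 0" by (simp only: pm) simp
    then show "dot a1 z = dot (dot ?e a1 *c ?e) z"
      by (simp add: w_def dot_simps dot_commute)
  qed
  moreover have "dot ?e a1 = 0"
  proof -
    have "dot a1 a1 = dot ?e a1 * dot ?e a1"
      using arg_cong[OF \<open>a1 = dot ?e a1 *c ?e\<close>, of "\<lambda>v. dot v a1"] by (simp add: dot_simps)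
    then show ?thesis using s by simp
  qed
  ultimately have a1: "a1 = 0" by simp
  then have r1: "r1 = 0" using h by simp
  \<comment> \<open>A multiple of the unit is admissible for any \<open>u\<close>. The result has
    parts of degree 4, 1 and 3 in \<open>u\<close>; they are separated by evaluating at opposite
    units, then at \<open>u\<close> and twice \<open>u\<close>.\<close>
  have G: "(dot u u / 2)\<^sup>2 * r2 + 2 * dot u a2 + dot u u * dot u (a0 \<star> ?e) = 0" for u
    using F[of "(dot u u / 2) *c ?e" u]
    by (simp add: a1 r1 dot_simps star_simps dot_unit power2_eq_square add.assoc)
  have r2: "r2 = 0"
  proof -
    have pm: "r2 / 4 + (2 * dot ?e a2 + dot ?e (a0 \<star> ?e)) = 0"
      "r2 / 4 - (2 * dot ?e a2 + dot ?e (a0 \<star> ?e)) = 0"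
      using G[of ?e] G[of "- ?e"] by (simp_all add: dot_simps dot_unit power2_eq_square algebra_simps)
    have "r2 = 2 * ((r2 / 4 + (2 * dot ?e a2 + dot ?e (a0 \<star> ?e))) +
        (r2 / 4 - (2 * dot ?e a2 + dot ?e (a0 \<star> ?e))))" by simp
    then show ?thesis by (simp only: pm) simp
  qed
  have a2: "a2 = 0"
  proof (rule dot_nondegenerate)
    fix u show "dot u a2 = 0"
    proof -
      have pm: "2 * dot u a2 + dot u u * dot u (a0 \<star> ?e) = 0"
        "4 * dot u a2 + 8 * (dot u u * dot u (a0 \<star> ?e)) = 0"
        using G[of u] G[of "2 *c u"] by (simp_all add: r2 dot_simps)
      have "12 * dot u a2 = 8 * (2 * dot u a2 + dot u u * dot u (a0 \<star> ?e)) -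
          (4 * dot u a2 + 8 * (dot u u * dot u (a0 \<star> ?e)))" by simp
      then show ?thesis by (simp only: pm) simp
    qed
  qed
  have K: "dot u u * dot u (a0 \<star> ?e) = 0" for u using G[of u] by (simp add: r2 a2)
  have "a0 \<star> ?e = 0"
  proof (rule dot_nondegenerate)
    fix z
    \<comment> \<open>The factor \<open>dot u u\<close> can vanish, so it cannot be cancelled at
      \<open>u = z\<close>. The weights 6, 2 and -2 on three translates by the unit eliminate
      \<open>dot ?e z\<close> and \<open>dot z z\<close>.\<close>
    have "dot ?e (a0 \<star> ?e) = 0" using K[of ?e] by (simp add: dot_unit)
    then have pm: "(1 + 2 * dot ?e z + dot z z) * dot z (a0 \<star> ?e) = 0"
      "(1 - 2 * dot ?e z + dot z z) * dot z (a0 \<star> ?e) = 0"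
      "2 * ((1 + 4 * dot ?e z + 4 * dot z z) * dot z (a0 \<star> ?e)) = 0"
      using K[of "?e + z"] K[of "?e - z"] K[of "?e + 2 *c z"]
      by (simp_all add: dot_simps dot_unit dot_commute[of z ?e] algebra_simps)
    have "6 * dot z (a0 \<star> ?e) = 6 * ((1 + 2 * dot ?e z + dot z z) * dot z (a0 \<star> ?e)) +
        2 * ((1 - 2 * dot ?e z + dot z z) * dot z (a0 \<star> ?e)) -
        2 * ((1 + 4 * dot ?e z + 4 * dot z z) * dot z (a0 \<star> ?e))" by (simp add: algebra_simps)
    then show "dot z (a0 \<star> ?e) = 0" by (simp only: pm) simp
  qed
  then have "a0 = 0" using unit_star_star(2)[of a0] by simp
  then show False using nz a1 a2 r1 r2 by (simp add: zero_prod_def)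
qed

lemma homog_ysp: "homog (ysp :: 'a::compalg jordan)"
  unfolding homog_def
proof (intro exI[of _ e0] conjI allI impI)
  show "rk1 (e0 :: 'a jordan)" by (rule rk1_e0)
  show "pr ysp (e0 :: 'a jordan) = 0" by (simp add: ysp_def)
  fix x :: "'a jordan" assume x: "rk1 x" "pr ysp x = 0"
  obtain r0 r1 r2 a0 a1 a2 where x': "x = (r0, r1, r2, a0, a1, a2)" by (cases x)
  show "\<exists>c g. c \<noteq> 0 \<and> linked ysp g \<and> x = c *c g e0"
  proof (cases "r0 = 0")
    case False
    then show ?thesis using reach_cell x unfolding x' by blast
  next
    case True
    obtain u w where uw: "2 * dot unit_elt w = dot u u"
      and n: "2 * dot w a1 + dot w w * r2 + 2 * dot u (a2 + a0 \<star> w) + dot u u * r1 \<noteq> 0"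
      using reach_outside_cell x unfolding x' True by blast
    obtain s0 s1 s2 b0 b1 b2 where z: "uppU u w x = (s0, s1, s2, b0, b1, b2)"
      by (cases "uppU u w x")
    have "s0 \<noteq> 0" using n z by (auto simp: x' True uppU_def)
    moreover have "rk1 (s0, s1, s2, b0, b1, b2)"
      using x(1) GJ_rk1[OF Stab_GJ[OF uppU_Stab[OF uw]], of x] by (simp only: z)
    moreover have "pr ysp (s0, s1, s2, b0, b1, b2) = 0"
      using x(2) Stab_pr[OF uppU_Stab[OF uw], of x] by (simp only: z)
    ultimately obtain g where g: "linked ysp g" "(s0, s1, s2, b0, b1, b2) = s0 *c g e0"
      using reach_cell by blast
    have "x = uppU_inv u w (uppU u w x)" by (simp only: uppU_inverse)
    also have "\<dots> = s0 *c uppU_inv u w (g e0)"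
      by (simp only: z g(2) lin_scl[OF GJ_lin[OF Stab_GJ[OF uppU_inv_Stab[OF uw]]]])
    finally show ?thesis
      using \<open>s0 \<noteq> 0\<close> linked_comp[OF linked_uppU_inv[OF uw] g(1)]
      by (intro exI[of _ s0] exI[of _ "\<lambda>x. uppU_inv u w (g x)"] conjI)
  qed
qed

lemma homog_equiv: "homog y \<Longrightarrow> y \<simeq> y' \<Longrightarrow> homog y'"
  unfolding equiv_rel_def using homog_dual_pair by blast

lemma Nrm_normal_form:
  fixes y :: "'a::compalg jordan"
  assumes "Nrm y \<noteq> 0" shows "\<exists>c. c \<noteq> 0 \<and> y \<simeq> (c, c, c, 0, 0, 0)"
proof -
  have "Nrm (0 :: 'a jordan) = 0" by (simp add: zero_prod_def)
  then have "y \<noteq> 0" using assms by (intro notI) simp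
  moreover have "\<not> y \<simeq> (1, 1, 0, 0, 0, 0)" "\<not> y \<simeq> (1, 0, 0, 0, 0, 0)"
    using assms equiv_Nrm[of y "(1, 1, 0, 0, 0, 0)"] equiv_Nrm[of y "(1, 0, 0, 0, 0, 0)"] by auto
  ultimately show ?thesis using equiv_normal_form[of y] by blast
qed

text \<open>\<open>ysp\<close> has norm -1, hence is equivalent to a nonzero multiple of the
  identity matrix; scaling adjusts the multiple.\<close>

lemma homog_rank3:
  fixes y :: "'a::compalg jordan"
  assumes "y \<simeq> (c, c, c, 0, 0, 0)" "c \<noteq> 0" shows "homog y"
proof -
  have N: "Nrm (ysp :: 'a jordan) = - 1" by (simp add: ysp_def dot_simps dot_unit)
  then have "Nrm (ysp :: 'a jordan) \<noteq> 0" by simp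
  from Nrm_normal_form[OF this]
  obtain d where d: "d \<noteq> 0" "(ysp :: 'a jordan) \<simeq> (d, d, d, 0, 0, 0)" by blast
  have "homog (d, d, d, 0, 0, 0 :: 'a)" by (rule homog_equiv[OF homog_ysp d(2)])
  from homog_scl[OF this, of "c / d"] have "homog (c, c, c, 0, 0, 0 :: 'a)" using assms(2) d(1) by simp
  then show ?thesis by (rule homog_equiv[OF _ equiv_sym[OF assms(1)]])
qed

text \<open>Two points of the section are joined by a polynomial curve inside its cone. Along it
  \<open>p\<close> and \<open>q\<close> become polynomials in one variable whose product vanishes,
  although neither is zero.\<close>

lemma homog_prime:
  fixes y :: "'a::compalg jordan"
  assumes "homog y" "p \<in> poly_funs (vec_coords (cdim TYPE('a jordan)))"
    "q \<in> poly_funs (vec_coords (cdim TYPE('a jordan)))"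
    and pq: "\<And>x. rk1 x \<Longrightarrow> pr y x = 0 \<Longrightarrow> p (coords x) * q (coords x) = 0"
    and x: "rk1 x" "pr y x = 0" "p (coords x) \<noteq> 0"
    and x': "rk1 x'" "pr y x' = 0" "q (coords x') \<noteq> 0"
  shows False
proof -
  obtain b where b: "rk1 b" "pr y b = 0"
    and orb: "\<And>x. rk1 x \<Longrightarrow> pr y x = 0 \<Longrightarrow> \<exists>c g. c \<noteq> 0 \<and> linked y g \<and> x = c *c g b"
    using assms(1) unfolding homog_def by blast
  obtain c g where c: "c \<noteq> 0" "linked y g" "x = c *c g b" using orb[OF x(1,2)] by blast
  obtain c' g' where c': "c' \<noteq> 0" "linked y g'" "x' = c' *c g' b" using orb[OF x'(1,2)] by blast
  obtain \<gamma> where \<gamma>: "\<And>t. \<gamma> t \<in> Stab y" "\<gamma> 0 = (\<lambda>x. x)" "\<gamma> 1 = g"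
    "\<And>\<psi>. curve \<psi> \<Longrightarrow> curve (\<lambda>t. \<gamma> t (\<psi> t))"
    using c(2) by (rule linkedE) blast
  obtain \<delta> where \<delta>: "\<And>t. \<delta> t \<in> Stab y" "\<delta> 0 = (\<lambda>x. x)" "\<delta> 1 = g'"
    "\<And>\<psi>. curve \<psi> \<Longrightarrow> curve (\<lambda>t. \<delta> t (\<psi> t))"
    using c'(2) by (rule linkedE) blast
  \<comment> \<open>The curve runs from \<open>x'\<close> at 0 to \<open>x\<close> at 1: one path is
    traversed backwards while the other is traversed forwards. The interpolated scalar may vanish
    somewhere, so its polynomial \<open>R\<close> is multiplied to the product below.\<close>
  define s where "s t = t * c + (1 - t) * c'" for t
  define \<psi> where "\<psi> t = s t *c \<gamma> t (\<delta> (1 - t) b)" for t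
  have sp: "s \<in> poly_funs {\<lambda>t. t}"
    unfolding s_def[abs_def]
    by (intro poly_funs.add poly_funs.mult poly_funs_diff poly_funs.const poly_funs_id)
  have "curve \<psi>"
    unfolding \<psi>_def[abs_def]
    by (intro polymap.scl sp \<gamma>(4) curve_reverse[of "\<lambda>t. \<delta> t b"] \<delta>(4) polymap.const)
  then have "(\<lambda>t. p (coords (\<psi> t))) \<in> poly_funs {\<lambda>t. t}" "(\<lambda>t. q (coords (\<psi> t))) \<in> poly_funs {\<lambda>t. t}"
    by (rule poly_funs_comp[OF assms(2)], rule poly_funs_comp[OF assms(3)])
  then obtain P Q where P: "\<And>t. p (coords (\<psi> t)) = poly P t" and Q: "\<And>t. q (coords (\<psi> t)) = poly Q t"
    using poly_funs_id_poly by meson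
  obtain R where R: "\<And>t. s t = poly R t" using poly_funs_id_poly[OF sp] by blast
  have "poly (R * (P * Q)) t = 0" for t
  proof (cases "s t = 0")
    case False
    have st: "\<gamma> t \<in> Stab y" "\<delta> (1 - t) \<in> Stab y" by (rule \<gamma>(1) \<delta>(1))+
    have "rk1 (\<psi> t)" using b False by (simp add: \<psi>_def rk1_scl GJ_rk1 Stab_GJ[OF st(1)] Stab_GJ[OF st(2)])
    moreover have "pr y (\<psi> t) = 0" using b by (simp add: \<psi>_def pr_scl_right Stab_pr[OF st(1)] Stab_pr[OF st(2)])
    ultimately show ?thesis using pq[of "\<psi> t"] by (simp add: P Q)
  qed (simp add: R)
  then have "R * (P * Q) = 0" using poly_all_0_iff_0 by blast
  moreover have "poly R 1 \<noteq> 0" using c(1) by (simp add: R[symmetric] s_def)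
  moreover have "poly P 1 \<noteq> 0" using x(3) by (simp add: P[symmetric] \<psi>_def s_def \<gamma> \<delta> c(3))
  moreover have "poly Q 0 \<noteq> 0" using x'(3) by (simp add: Q[symmetric] \<psi>_def s_def \<gamma> \<delta> c'(3))
  ultimately show False by auto
qed

section \<open>The section as a projective variety with a transitive algebraic group\<close>

lemma projective_variety_section:
  fixes y :: "'a::compalg jordan"
  assumes "homog y"
  shows "projective_variety (cdim TYPE('a jordan)) (coords ` {x. rk1 x \<and> pr y x = 0})"
proof -
  let ?n = "cdim TYPE('a jordan)" and ?S = "{x. rk1 x \<and> pr y x = 0}"
  have "projective_set ?n (coords ` ?S)"
    unfolding projective_set_def
  proof (intro conjI ballI allI impI)
    show "0\<^sub>v ?n \<notin> coords ` ?S"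
    proof
      assume "0\<^sub>v ?n \<in> coords ` ?S"
      then obtain x :: "'a jordan" where "coords x = 0\<^sub>v ?n" "rk1 x" by auto
      then show False by (simp only: coords_eq_0_iff rk1_def) simp
    qed
    define P where "P = insert (\<lambda>z. pr y (uncoords z)) (range (\<lambda>u z. pr u (sharp (uncoords z :: 'a jordan))))"
    have "P \<subseteq> poly_funs (vec_coords ?n)"
      unfolding P_def by (auto intro!: poly_funs_pr polymap_sharp polymap_uncoords_id)
    moreover have "insert (0\<^sub>v ?n) (coords ` ?S) = {z \<in> carrier_vec ?n. \<forall>p\<in>P. p z = 0}"
    proof -
      have s: "(\<forall>p\<in>P. p (coords x) = 0) \<longleftrightarrow> pr y x = 0 \<and> sharp x = 0" for x :: "'a jordan"
      proof -
        have "(\<forall>p\<in>P. p (coords x) = 0) \<longleftrightarrow> pr y x = 0 \<and> (\<forall>u. pr u (sharp x) = 0)"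
          unfolding P_def by (simp only: ball_simps uncoords_coords)
        also have "(\<forall>u. pr u (sharp x) = 0) \<longleftrightarrow> sharp x = 0"
          by (metis pr_commute pr_nondegenerate pr_zero_right)
        finally show ?thesis .
      qed
      have "z \<in> insert (0\<^sub>v ?n) (coords ` ?S) \<longleftrightarrow> z \<in> carrier_vec ?n \<and> (\<forall>p\<in>P. p z = 0)" for z
      proof (cases "z \<in> carrier_vec ?n")
        case True
        then obtain x :: "'a jordan" where x: "z = coords x" using coords_surj by metis
        have "coords x \<in> coords ` ?S \<longleftrightarrow> x \<in> ?S" by (simp add: image_iff coords_eq_iff)
        then have "z \<in> insert (0\<^sub>v ?n) (coords ` ?S) \<longleftrightarrow> x = 0 \<or> x \<in> ?S"
          by (simp add: x coords_eq_0_iff)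
        also have "\<dots> \<longleftrightarrow> pr y x = 0 \<and> sharp x = 0"
          using sharp_scl[of 0 "0 :: 'a jordan"] by (cases "x = 0") (simp_all add: rk1_def conj_commute)
        finally show ?thesis using True by (simp only: s x simp_thms)
      qed auto
      then show ?thesis by blast
    qed
    ultimately show "zariski_closed ?n (insert (0\<^sub>v ?n) (coords ` ?S))"
      unfolding zariski_closed_def by blast
    fix v c assume "v \<in> coords ` ?S" "c \<noteq> (0::complex)"
    then obtain x where "v = coords x" "rk1 (c *c x)" "pr y (c *c x) = 0"
      by (auto simp: rk1_scl pr_scl_right)
    then show "c \<cdot>\<^sub>v v \<in> coords ` ?S" by (intro image_eqI[of _ _ "c *c x"]) (simp_all add: coords_scl)
  qed
  moreover have "coords ` ?S \<noteq> {}" using assms unfolding homog_def by blast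
  moreover have "p \<in> vanishing_ideal ?n (coords ` ?S) \<or> q \<in> vanishing_ideal ?n (coords ` ?S)"
    if "p \<in> poly_funs (vec_coords ?n)" "q \<in> poly_funs (vec_coords ?n)"
      "(\<lambda>x. p x * q x) \<in> vanishing_ideal ?n (coords ` ?S)" for p q
    using homog_prime[OF assms that(1,2)] that unfolding vanishing_ideal_def by blast
  ultimately show ?thesis unfolding projective_variety_def by blast
qed

text \<open>For fixed \<open>x\<close>, preservation of \<open>Nrm\<close> and of
  \<open>pr y\<close> at \<open>x\<close> are polynomial conditions on the matrix; all
  \<open>x\<close> together define the group.\<close>

lemma linear_algebraic_group_Stab:
  "linear_algebraic_group (cdim TYPE('a jordan)) (matf ` Stab (y :: 'a::compalg jordan))"
proof -
  let ?n = "cdim TYPE('a jordan)"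
  \<comment> \<open>An explicit sum over a fixed range is polynomial in the entries of
    \<open>g\<close> even for matrices of the wrong size.\<close>
  define act :: "complex mat \<Rightarrow> 'a jordan \<Rightarrow> 'a jordan"
    where "act g x = uncoords (vec ?n (\<lambda>i. \<Sum>j<?n. g $$ (i, j) * coords x $ j))" for g x
  have act: "act g x = uncoords (g *\<^sub>v coords x)" if "g \<in> carrier_mat ?n ?n" for g x
    using that unfolding act_def
    by (intro arg_cong[of _ _ uncoords]) (auto simp: scalar_prod_def lessThan_atLeast0)
  have actp: "polymap (mat_coords ?n) (\<lambda>g. act g x)" for x
    unfolding act_def
    by (rule polymap_uncoords)
      (simp, intro poly_funs_sum poly_funs.mult poly_funs_mat_coord poly_funs.const, simp_all)
  define P where "P = range (\<lambda>x g. Nrm (act g x) - Nrm x) \<union> range (\<lambda>x g. pr y (act g x) - pr y x)"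
  have Pp: "P \<subseteq> poly_funs (mat_coords ?n)"
    unfolding P_def
    by (auto intro!: poly_funs_diff poly_funs_Nrm poly_funs_pr actp poly_funs.const)
  have P: "(\<forall>p\<in>P. p g = 0) \<longleftrightarrow> (\<forall>x. Nrm (act g x) = Nrm x) \<and> (\<forall>x. pr y (act g x) = pr y x)" for g
    unfolding P_def by (simp only: ball_Un ball_simps right_minus_eq)
  have "matf ` Stab y = {g \<in> carrier_mat ?n ?n. invertible_mat g \<and> (\<forall>p\<in>P. p g = 0)}"
  proof (intro equalityI subsetI)
    fix g assume "g \<in> matf ` Stab y"
    then obtain f where f: "f \<in> Stab y" "g = matf f" by blast
    note G = Stab_GJ[OF f(1)]
    have a: "act (matf f) x = f x" for x
      by (simp add: act matf_coords[OF GJ_lin[OF G]])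
    have "invertible_mat g" using matf_SL3[OF G] by (simp add: SL3_group_def f(2))
    then show "g \<in> {g \<in> carrier_mat ?n ?n. invertible_mat g \<and> (\<forall>p\<in>P. p g = 0)}"
      using f(2) by (simp only: mem_Collect_eq P a GJ_Nrm[OF G] Stab_pr[OF f(1)] matf_carrier simp_thms)
  next
    fix g assume "g \<in> {g \<in> carrier_mat ?n ?n. invertible_mat g \<and> (\<forall>p\<in>P. p g = 0)}"
    then have g: "g \<in> carrier_mat ?n ?n" "invertible_mat g"
      and N: "\<And>x. Nrm (act g x) = Nrm x" and h: "\<And>x. pr y (act g x) = pr y x"
      unfolding mem_Collect_eq P by blast+
    have "g \<in> SL3_group (level TYPE('a))"
    proof -
      have "jordan_det (level TYPE('a)) (g *\<^sub>v v) = jordan_det (level TYPE('a)) v"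
        if v: "v \<in> carrier_vec ?n" for v
      proof -
        obtain x :: "'a jordan" where x: "v = coords x" using v coords_surj by metis
        have "g *\<^sub>v v \<in> carrier_vec ?n" using g(1) v by auto
        then have "g *\<^sub>v v = coords (act g x)" by (simp add: act[OF g(1)] coords_uncoords x)
        then show ?thesis by (simp only: x jordan_det_coords N)
      qed
      then show ?thesis using g by (simp add: SL3_group_def cdim_jordan)
    qed
    then obtain f :: "'a jordan \<Rightarrow> 'a jordan" where f: "f \<in> GJ" "g = matf f" by (metis SL3_GJ)
    have "act g x = f x" for x
      using act[OF g(1), of x] by (simp add: f(2) matf_coords[OF GJ_lin[OF f(1)]])
    then have "f \<in> Stab y" using h f(1) by (intro StabI) simp_all
    then show "g \<in> matf ` Stab y" using f(2) by blast
  qed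
  then have "\<exists>P \<subseteq> poly_funs (mat_coords ?n).
      matf ` Stab y = {g \<in> carrier_mat ?n ?n. invertible_mat g \<and> (\<forall>p\<in>P. p g = 0)}"
    using Pp by blast
  moreover have "1\<^sub>m ?n \<in> matf ` Stab y"
  proof -
    have "(\<lambda>x. x) \<in> Stab y"
      by (rule StabI) (rule GJI[where g="\<lambda>x. x"], simp_all add: lin_def)
    then show ?thesis using matf_id[where 'a="'a jordan"] by (metis imageI)
  qed
  moreover have "g * h \<in> matf ` Stab y" if gh: "g \<in> matf ` Stab y" "h \<in> matf ` Stab y" for g h
  proof -
    obtain f f' where f: "f \<in> Stab y" "g = matf f" and f': "f' \<in> Stab y" "h = matf f'"
      using gh by blast
    have "g * h = matf (\<lambda>x. f (f' x))"
      unfolding f(2) f'(2) by (rule matf_comp) (rule GJ_lin Stab_GJ f f')+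
    then show ?thesis using Stab_comp[OF f(1) f'(1)] by blast
  qed
  moreover have "\<exists>h\<in>matf ` Stab y. g * h = 1\<^sub>m ?n" if g: "g \<in> matf ` Stab y" for g
  proof -
    obtain f where f: "f \<in> Stab y" "g = matf f" using g by blast
    obtain f' where f': "f' \<in> Stab y" "\<And>x. f (f' x) = x" using f(1) by (metis Stab_inverse)
    have "g * matf f' = 1\<^sub>m ?n"
      unfolding f(2) by (rule matf_inverse) (rule GJ_lin Stab_GJ f f')+
    then show ?thesis using f'(1) by blast
  qed
  ultimately show ?thesis unfolding linear_algebraic_group_def by blast
qed

lemma algebraic_action_Stab:
  fixes y :: "'a::compalg jordan"
  shows "algebraic_action (cdim TYPE('a jordan)) (matf ` Stab y) (cdim TYPE('a jordan))
    (coords ` {x. rk1 x \<and> pr y x = 0}) (*\<^sub>v)"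
proof -
  let ?n = "cdim TYPE('a jordan)" and ?S = "{x. rk1 x \<and> pr y x = 0}" and ?G = "matf ` Stab y"
  have gc: "g \<in> carrier_mat ?n ?n" if "g \<in> ?G" for g using that by auto
  have xc: "x \<in> carrier_vec ?n" if "x \<in> coords ` ?S" for x using that by auto
  have inv: "g *\<^sub>v x \<in> coords ` ?S" if g: "g \<in> ?G" and x: "x \<in> coords ` ?S" for g x
  proof -
    obtain f where f: "f \<in> Stab y" "g = matf f" using g by blast
    obtain z where z: "rk1 z" "pr y z = 0" "x = coords z" using x by blast
    have "g *\<^sub>v x = coords (f z)" by (simp only: f(2) z(3) matf_coords[OF GJ_lin[OF Stab_GJ[OF f(1)]]])
    moreover have "f z \<in> ?S"
      using z by (simp only: mem_Collect_eq GJ_rk1[OF Stab_GJ[OF f(1)]] Stab_pr[OF f(1)] simp_thms)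
    ultimately show ?thesis by blast
  qed
  have refl: "same_point x x" for x unfolding same_point_def by (rule exI[of _ 1]) simp
  have loc: "\<exists>F :: nat \<Rightarrow> complex mat \<times> complex vec \<Rightarrow> complex.
        (\<forall>i<?n. F i \<in> poly_funs (mat_vec_coords ?n ?n)) \<and>
        (\<exists>i<?n. F i (g0, x0) \<noteq> 0) \<and>
        (\<forall>g\<in>?G. \<forall>x\<in>coords ` ?S. (\<exists>i<?n. F i (g, x) \<noteq> 0) \<longrightarrow>
           same_point (g *\<^sub>v x) (vec ?n (\<lambda>i. F i (g, x))))"
    if g0: "g0 \<in> ?G" and x0: "x0 \<in> coords ` ?S" for g0 x0
  proof -
    define F :: "nat \<Rightarrow> complex mat \<times> complex vec \<Rightarrow> complex"
      where "F i = (\<lambda>gx. \<Sum>j<?n. fst gx $$ (i, j) * snd gx $ j)" for i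
    have "F i \<in> poly_funs (mat_vec_coords ?n ?n)" if i: "i < ?n" for i
    proof -
      have "(\<lambda>gx. fst gx $$ (i, j)) \<in> poly_funs (mat_vec_coords ?n ?n)"
        "(\<lambda>gx. snd gx $ j) \<in> poly_funs (mat_vec_coords ?n ?n)" if "j < ?n" for j
      proof -
        have "(\<lambda>g. g $$ (i, j)) \<circ> fst \<in> mat_vec_coords ?n ?n"
          unfolding mat_vec_coords_def using i that
          by (intro UnI1 imageI) (auto simp: mat_coords_def)
        from poly_funs.coord[OF this]
        show "(\<lambda>gx. fst gx $$ (i, j)) \<in> poly_funs (mat_vec_coords ?n ?n)" by (simp add: comp_def)
        have "(\<lambda>z. z $ j) \<circ> snd \<in> mat_vec_coords ?n ?n"
          unfolding mat_vec_coords_def using that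
          by (intro UnI2 imageI) (auto simp: vec_coords_def)
        from poly_funs.coord[OF this]
        show "(\<lambda>gx. snd gx $ j) \<in> poly_funs (mat_vec_coords ?n ?n)" by (simp add: comp_def)
      qed
      then show ?thesis unfolding F_def by (intro poly_funs_sum poly_funs.mult) simp_all
    qed
    moreover have F: "vec ?n (\<lambda>i. F i (g, x)) = g *\<^sub>v x" if "g \<in> ?G" "x \<in> coords ` ?S" for g x
      using gc[OF that(1)] xc[OF that(2)]
      by (auto simp: F_def scalar_prod_def lessThan_atLeast0 vec_eq_iff)
    \<comment> \<open>The homogeneous coordinates are the entries of the matrix-vector product. They
      have no common zero because the image lies in the section, which omits the origin.\<close>
    moreover have "\<exists>i<?n. F i (g0, x0) \<noteq> 0"
    proof (rule ccontr)
      assume "\<not> ?thesis"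
      then have "vec ?n (\<lambda>i. F i (g0, x0)) = 0\<^sub>v ?n" by (auto simp: vec_eq_iff)
      then have "0\<^sub>v ?n \<in> coords ` ?S" using F[OF g0 x0] inv[OF g0 x0] by simp
      then obtain z :: "'a jordan" where "coords z = 0\<^sub>v ?n" "rk1 z" by auto
      then show False by (simp only: coords_eq_0_iff rk1_def) simp
    qed
    ultimately show ?thesis using refl by (intro exI[of _ F]) simp
  qed
  show ?thesis
    unfolding algebraic_action_def
  proof (intro conjI ballI impI)
    fix g assume g: "g \<in> ?G"
    fix x assume x: "x \<in> coords ` ?S"
    show "g *\<^sub>v x \<in> coords ` ?S" by (rule inv[OF g x])
    show "same_point (g *\<^sub>v x) (g *\<^sub>v z)" if "same_point x z" for z
      using that mult_mat_vec[OF gc[OF g] xc[OF x]] unfolding same_point_def by metis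
    show "same_point (g * h *\<^sub>v x) (g *\<^sub>v (h *\<^sub>v x))" if "h \<in> ?G" for h
      using assoc_mult_mat_vec[OF gc[OF g] gc[OF that] xc[OF x]] refl by simp
    show "\<exists>F :: nat \<Rightarrow> complex mat \<times> complex vec \<Rightarrow> complex.
        (\<forall>i<?n. F i \<in> poly_funs (mat_vec_coords ?n ?n)) \<and>
        (\<exists>i<?n. F i (g, x) \<noteq> 0) \<and>
        (\<forall>g\<in>?G. \<forall>x\<in>coords ` ?S. (\<exists>i<?n. F i (g, x) \<noteq> 0) \<longrightarrow>
           same_point (g *\<^sub>v x) (vec ?n (\<lambda>i. F i (g, x))))"
      by (rule loc[OF g x])
  next
    fix x assume "x \<in> coords ` ?S"
    then show "same_point (1\<^sub>m ?n *\<^sub>v x) x" by (simp only: one_mult_mat_vec[OF xc] refl)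
  qed
qed

lemma homogeneous_variety_section:
  fixes y :: "'a::compalg jordan"
  assumes "homog y"
  shows "homogeneous_variety (cdim TYPE('a jordan)) (coords ` {x. rk1 x \<and> pr y x = 0})"
proof -
  let ?S = "{x. rk1 x \<and> pr y x = 0}"
  obtain b where orb: "\<And>x. rk1 x \<Longrightarrow> pr y x = 0 \<Longrightarrow> \<exists>c g. c \<noteq> 0 \<and> linked y g \<and> x = c *c g b"
    using assms unfolding homog_def by blast
  have "\<exists>g\<in>matf ` Stab y. same_point (g *\<^sub>v v) w" if v: "v \<in> coords ` ?S" and w: "w \<in> coords ` ?S" for v w
  proof -
    obtain x x' where x: "rk1 x" "pr y x = 0" "v = coords x" and x': "rk1 x'" "pr y x' = 0" "w = coords x'"
      using v w by blast
    obtain c g where c: "c \<noteq> 0" "linked y g" "x = c *c g b" using orb[OF x(1,2)] by blast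
    obtain c' g' where c': "c' \<noteq> 0" "linked y g'" "x' = c' *c g' b" using orb[OF x'(1,2)] by blast
    obtain h where h: "h \<in> Stab y" "\<And>x. h (g x) = x" using linked_Stab[OF c(2)] by (metis Stab_inverse)
    let ?f = "\<lambda>x. g' (h x)"
    have f: "?f \<in> Stab y" by (rule Stab_comp[OF linked_Stab[OF c'(2)] h(1)])
    have "?f x = c *c g' b"
      by (simp only: c(3) lin_scl[OF GJ_lin[OF Stab_GJ[OF h(1)]]] h(2)
          lin_scl[OF GJ_lin[OF Stab_GJ[OF linked_Stab[OF c'(2)]]]])
    then have "x' = (c' / c) *c ?f x" using c(1) by (simp add: c'(3) scl_scl)
    then have "w = (c' / c) \<cdot>\<^sub>v (matf ?f *\<^sub>v v)"
      by (simp only: x(3) x'(3) coords_scl matf_coords[OF GJ_lin[OF Stab_GJ[OF f]]])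
    then have "same_point (matf ?f *\<^sub>v v) w"
      unfolding same_point_def using c(1) c'(1) by (intro exI[of _ "c' / c"]) simp
    then show ?thesis using f by blast
  qed
  then show ?thesis
    unfolding homogeneous_variety_def
    using projective_variety_section[OF assms] linear_algebraic_group_Stab[of y] algebraic_action_Stab[of y]
    by blast
qed

lemma homogeneous_section_rank3:
  fixes y :: "'a::compalg jordan"
  assumes "y \<simeq> (c, c, c, 0, 0, 0)" "c \<noteq> 0"
  shows "homogeneous_section (cdim TYPE('a jordan)) (severi (level TYPE('a))) (hf y)"
proof -
  obtain f f' where f: "dual_pair f f'" "f' (c, c, c, 0, 0, 0) = y"
    using equiv_sym[OF assms(1)] unfolding equiv_rel_def by blast
  have "x \<notin> sing y" for x
    using sing_dual_pair[OF f(1), of x "(c, c, c, 0, 0, 0)"] sing_rank3[OF assms(2), where 'a='a]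
    by (simp only: f(2)) blast
  then have "sing y = {}" by blast
  then show ?thesis
    unfolding homogeneous_section_def singular_locus_eq hyperplane_section_eq
    using homogeneous_variety_section[OF homog_rank3[OF assms]] by blast
qed

section \<open>The classification\<close>

text \<open>A linear inverse of \<open>hf\<close> defined on vectors, which makes the norm of a form
  a polynomial in the coordinates of the hyperplane.\<close>

definition hf_inv :: "complex vec \<Rightarrow> 'a::compalg jordan" where
  "hf_inv z = (case uncoords z of (s0, s1, s2, c0, c1, c2) \<Rightarrow>
     (s0, s1, s2, (1/2) *c c0, (1/2) *c c1, (1/2) *c c2))"

lemma hf_inv_hf [simp]: "hf_inv (hf y) = y"
  by (cases y) (simp add: hf_inv_def hf_def scl_scl)

lemma polymap_hf_inv:
  "polymap (vec_coords (cdim TYPE('a jordan))) (hf_inv :: _ \<Rightarrow> 'a::compalg jordan)"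
proof -
  have "lin (\<lambda>(s0, s1, s2, c0, c1, c2). (s0, s1, s2, (1/2) *c c0, (1/2) *c c1, (1/2) *c c2) :: 'a jordan)"
    by (rule linI; clarsimp simp: scl_add_right scl_scl mult.commute)
  from polymap_lin[OF polymap_uncoords_id this] show ?thesis
    unfolding hf_inv_def[abs_def] .
qed

lemma classification:
  defines "n \<equiv> cdim TYPE('a::compalg jordan)" and "X \<equiv> severi (level TYPE('a))"
  defines "H \<equiv> carrier_vec n - {0\<^sub>v n}"
  shows "(\<forall>h\<in>H. homogeneous_section n X h \<or> nodal_section n X h \<or>
                 quadric_singular_section n (2 ^ level TYPE('a)) X h) \<and>
         (\<exists>h\<in>H. homogeneous_section n X h) \<and>
         (\<exists>h\<in>H. nodal_section n X h) \<and>
         (\<exists>h\<in>H. quadric_singular_section n (2 ^ level TYPE('a)) X h) \<and>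
         (\<exists>Z. zariski_closed n Z \<and> Z \<noteq> carrier_vec n \<and>
              (\<forall>h \<in> H - Z. homogeneous_section n X h))"
proof -
  note types = homogeneous_section_rank3 nodal_section quadric_section
  have H: "\<exists>y :: 'a jordan. y \<noteq> 0 \<and> h = hf y" if "h \<in> H" for h
    using that hf_surj[of h, where 'a='a] hf_eq_0_iff[where 'a='a] unfolding H_def n_def by blast
  have hfH: "hf y \<in> H" if "y \<noteq> 0" for y :: "'a jordan"
    using that by (simp add: H_def n_def hf_eq_0_iff)
  have 1: "homogeneous_section n X h \<or> nodal_section n X h \<or>
      quadric_singular_section n (2 ^ level TYPE('a)) X h" if h: "h \<in> H" for h
  proof -
    obtain y :: "'a jordan" where "y \<noteq> 0" "h = hf y" using H[OF h] by blast
    then show ?thesis using equiv_normal_form[of y] types unfolding n_def X_def by blast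
  qed
  have nz: "(1, 1, 1, 0, 0, 0) \<noteq> (0 :: 'a jordan)" "(1, 1, 0, 0, 0, 0) \<noteq> (0 :: 'a jordan)"
    "(1, 0, 0, 0, 0, 0) \<noteq> (0 :: 'a jordan)"
    by (simp_all add: zero_prod_def)
  have 2: "homogeneous_section n X (hf (1, 1, 1, 0, 0, 0 :: 'a))"
    "nodal_section n X (hf (1, 1, 0, 0, 0, 0 :: 'a))"
    "quadric_singular_section n (2 ^ level TYPE('a)) X (hf (1, 0, 0, 0, 0, 0 :: 'a))"
    unfolding n_def X_def by (rule types equiv_refl one_neq_zero)+
  \<comment> \<open>Genericity is made precise by the cubic hypersurface of forms with norm zero;
    outside it only the rank three normal form remains.\<close>
  define Z where "Z = {z \<in> carrier_vec n. Nrm (hf_inv z :: 'a jordan) = 0}"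
  have "zariski_closed n Z"
    unfolding zariski_closed_def Z_def n_def
    by (rule exI[of _ "{\<lambda>z. Nrm (hf_inv z :: 'a jordan)}"]) (simp add: poly_funs_Nrm polymap_hf_inv)
  moreover have "hf (1, 1, 1, 0, 0, 0 :: 'a) \<notin> Z" by (simp add: Z_def)
  then have "Z \<noteq> carrier_vec n" using hf_carrier unfolding n_def by blast
  moreover have "homogeneous_section n X h" if h: "h \<in> H - Z" for h
  proof -
    obtain y :: "'a jordan" where y: "h = hf y" using H h by blast
    have "hf y \<in> carrier_vec n" by (simp add: n_def)
    then have "Nrm y \<noteq> 0" using h y by (simp add: Z_def)
    then show ?thesis
      using Nrm_normal_form[of y] types(1) unfolding y n_def X_def by blast
  qed
  ultimately have 3: "\<exists>Z. zariski_closed n Z \<and> Z \<noteq> carrier_vec n \<and>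
      (\<forall>h \<in> H - Z. homogeneous_section n X h)" by blast
  show ?thesis using 1 2 3 hfH[OF nz(1)] hfH[OF nz(2)] hfH[OF nz(3)] by blast
qed

theorem proposition8p1:
  fixes k m n :: nat and X H :: "complex vec set"
  assumes "k \<le> 3"
    and "m = 2 ^ k"
    and "n = 3 * m + 3"
    and "X = severi k"
    and "H = carrier_vec n - {0\<^sub>v n}"
  shows "(\<forall>h\<in>H. homogeneous_section n X h \<or> nodal_section n X h \<or>
                 quadric_singular_section n m X h) \<and>
         (\<exists>h\<in>H. homogeneous_section n X h) \<and>
         (\<exists>h\<in>H. nodal_section n X h) \<and>
         (\<exists>h\<in>H. quadric_singular_section n m X h) \<and>
         (\<exists>Z. zariski_closed n Z \<and> Z \<noteq> carrier_vec n \<and>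
              (\<forall>h \<in> H - Z. homogeneous_section n X h))"
proof -
  have l: "level TYPE(complex) = 0" "level TYPE(complex cd) = 1"
    "level TYPE(complex cd cd) = 2" "level TYPE(complex cd cd cd) = 3"
    by (simp_all add: level_complex_def level_cd_def)
  \<comment> \<open>The four values of \<open>k\<close> correspond to zero to three doublings of
    \<open>complex\<close>, all of which are composition algebras.\<close>
  consider "k = 0" | "k = 1" | "k = 2" | "k = 3" using assms(1) by linarith
  then show ?thesis
  proof cases
    case 1 show ?thesis
      using classification[where 'a=complex] unfolding cdim_jordan l assms(2-5) 1 .
  next
    case 2 show ?thesis
      using classification[where 'a="complex cd"] unfolding cdim_jordan l assms(2-5) 2 .
  next
    case 3 show ?thesis
      using classification[where 'a="complex cd cd"] unfolding cdim_jordan l assms(2-5) 3 .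
  next
    case 4 show ?thesis
      using classification[where 'a="complex cd cd cd"] unfolding cdim_jordan l assms(2-5) 4 .
  qed
qed

end
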